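(* Let $m\ge 1$ be a real number and let $u,v\in\mathcal F^2_m$, neither identically zero. The following conditions are equivalent: (1) The product $T=T_uT_{\overline v}$ is bounded on $\mathcal F^2_m$. (2) There exist a polynomial $g$ of degree at most $m$ and a nonzero complex constant $c$ such that $u(z)=e^{g(z)}$ and $v(z)=c\,e^{-g(z)}$ for all $z\in\mathbb C$. (3) The function $z\mapsto \widetilde{|u|^2}(z)\,\widetilde{|v|^2}(z)$ is bounded on $\mathbb C$. Furthermore, in the affirmative case, $\|T\|\le C_1 e^{C_2\|g\|_{H^2}^2}$, where $C_1,C_2$ are positive constants independent of $g$.
   Context: For real $m\ge1$, $d\lambda_m(z)=e^{-|z|^{2m}}\,dA(z)$ where $dA$ is Lebesgue area measure on $\mathbb C$, and $\mathcal F^2_m$ is the Hilbert space of entire functions in $L^2(\mathbb C,d\lambda_m)$. Its reproducing kernel is $K_m(z,w)=\frac{m}{\pi}\sum_{k=0}^\infty \frac{(z\overline w)^k}{\Gamma(\frac{k+1}{m})}$. $P$ denotes the orthogonal projection of $L^2(\mathbb C,d\lambda_m)$ onto $\mathcal F^2_m$, and for a symbol $\varphi$ the Toeplitz operator $T_\varphi f=P(\varphi f)$, i.e. $T_\varphi f(z)=\int_{\mathbb C}K_m(z,w)\varphi(w)f(w)\,d\lambda_m(w)$, is densely defined on finite linear combinations of kernel functions $K_m(\cdot,w)$; "bounded" means it extends to a bounded operator on $\mathcal F^2_m$. The Berezin transform of a function $\varphi\ge0$ (or integrable against it) is $\widetilde\varphi(z)=\int_{\mathbb C}\varphi(w)\frac{|K_m(w,z)|^2}{K_m(z,z)}\,d\lambda_m(w)$.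 For a polynomial $g(z)=\sum_k a_kz^k$, $\|g\|_{H^2}^2=\sum_k|a_k|^2$ is its norm in the Hardy space of the unit disc. *)

theory Defs
  imports "HOL-Analysis.Analysis" "HOL-Computational_Algebra.Polynomial"
begin

definition fock_weight :: "real \<Rightarrow> complex \<Rightarrow> real" where
  "fock_weight m z = exp (- ((cmod z) powr (2 * m)))"

definition fock :: "real \<Rightarrow> (complex \<Rightarrow> complex) set" where
  "fock m = {f. f holomorphic_on UNIV \<and>
     (\<integral>\<^sup>+ z. ennreal ((cmod (f z))\<^sup>2 * fock_weight m z) \<partial>lborel) < \<infinity>}"

definition fock_norm :: "real \<Rightarrow> (complex \<Rightarrow> complex) \<Rightarrow> real" where
  "fock_norm m f = sqrt (\<integral> z. (cmod (f z))\<^sup>2 * fock_weight m z \<partial>lborel)"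

definition fock_kernel :: "real \<Rightarrow> complex \<Rightarrow> complex \<Rightarrow> complex" where
  "fock_kernel m z w = complex_of_real (m / pi) *
     (\<Sum>k. (z * cnj w) ^ k / complex_of_real (Gamma (real (k + 1) / m)))"

definition kernel_span :: "real \<Rightarrow> (complex \<Rightarrow> complex) set" where
  "kernel_span m = {f. \<exists>(n::nat) (a::nat \<Rightarrow> complex) (w::nat \<Rightarrow> complex).
      f = (\<lambda>z. \<Sum>i<n. a i * fock_kernel m z (w i))}"

definition toeplitz :: "real \<Rightarrow> (complex \<Rightarrow> complex) \<Rightarrow> (complex \<Rightarrow> complex) \<Rightarrow> (complex \<Rightarrow> complex)" where
  "toeplitz m \<phi> f = (\<lambda>z. \<integral> w. fock_kernel m z w * \<phi> w * f w * complex_of_real (fock_weight m w) \<partial>lborel)"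

definition toeplitz_prod :: "real \<Rightarrow> (complex \<Rightarrow> complex) \<Rightarrow> (complex \<Rightarrow> complex) \<Rightarrow> (complex \<Rightarrow> complex) \<Rightarrow> (complex \<Rightarrow> complex)" where
  "toeplitz_prod m u v f = toeplitz m u (toeplitz m (\<lambda>w. cnj (v w)) f)"

text \<open>Boundedness: extends from the span of kernel functions to a bounded operator on F^2_m.\<close>
definition toeplitz_prod_bounded :: "real \<Rightarrow> (complex \<Rightarrow> complex) \<Rightarrow> (complex \<Rightarrow> complex) \<Rightarrow> bool" where
  "toeplitz_prod_bounded m u v \<longleftrightarrow> (\<exists>C. \<forall>f\<in>kernel_span m.
      toeplitz_prod m u v f \<in> fock m \<and> fock_norm m (toeplitz_prod m u v f) \<le> C * fock_norm m f)"

definition berezin :: "real \<Rightarrow> (complex \<Rightarrow> real) \<Rightarrow> complex \<Rightarrow> ennreal" where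
  "berezin m \<phi> z = (\<integral>\<^sup>+ w. ennreal (\<phi> w * (cmod (fock_kernel m w z))\<^sup>2 / Re (fock_kernel m z z)
      * fock_weight m w) \<partial>lborel)"

definition H2_norm_sq :: "complex poly \<Rightarrow> real" where
  "H2_norm_sq g = (\<Sum>k\<le>degree g. (cmod (coeff g k))\<^sup>2)"

end

theory Submission
  imports Defs "HOL-Complex_Analysis.Complex_Analysis" "HOL-Real_Asymp.Real_Asymp"
begin

text \<open>On the span of the kernel functions, $T_uT_{\bar v}$ sends $K_a$ to $\overline{v(a)}\,uK_a$.

  Necessity: boundedness, and equally the bound on the Berezin transforms, gives
  $|v(a)|^2\widetilde{|u|^2}(a)\le B$ for all $a$. Hence $uv$ is bounded, so constant, and $u=e^g$.
  Evaluating $uK_a$ at $b$ bounds $\mathrm{Re}\,g(b)-\mathrm{Re}\,g(a)$ by a constant minus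
  $\log(|K(a,b)|/\sqrt{K(a,a)K(b,b)})$. Along a ray this is a second difference of the convex
  function $t\mapsto\log K(e^{t/2},e^{t/2})=O(e^{mt})$; summing over a chain of points gives
  $\mathrm{Re}\,g(z)=O(|z|^m\log|z|)$, and Borel--Caratheodory gives $\deg g\le m$.

  Sufficiency: the Schur test for $e^{\mathrm{Re}\,g(z)-\mathrm{Re}\,g(w)}|K(z,w)|$ with respect to
  $e^{-(|z|^{2m}+|w|^{2m})/2}\,dA$. The off-diagonal decay needs no contour asymptotics of the
  Mittag-Leffler function $E(z)=\sum_k z^k/\Gamma((k+1)/m)$: the numbers $k!/\Gamma((k+1)/m)$ are moments
  of a positive measure on the half line, so $E$ is a positive mixture of exponentials and
  $|E(z)|\le E(\max(\mathrm{Re}\,z,0))$.\<close>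

section \<open>Power series dominated by their values on the positive axis\<close>

text \<open>(1) and (3) are used through one number per point: the squared norm of T on the
  normalised kernel at a, which is \<open>|v(a)|^2\<close> times the Berezin transform of
  \<open>|u|^2\<close> at a. It is bounded under (3) because \<open>|v|^2\<close> lies below its own
  Berezin transform. The way back to (3) multiplies the numbers for (u, v) and (v, u); the extra
  factor \<open>|uv|^2\<close> is the constant \<open>|c|^2\<close>.

  The moment measure behind the Mittag-Leffler estimate is never constructed. Gauss' product reaches
  the coefficients from an exponential by averages over dilates and one limit, each preserving
  domination on the axis. The positive part of Re z keeps arguments on the half-line, where the
  series is monotone and has an elementary bound.

  The square of the Hardy norm in the exponent comes from completing a square: the bound for g(z) -
  g(w) is linear in |z - w| and in the Hardy norm, while the kernel decays quadratically in |z - w|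
  at the same local scale. The logarithm in the growth of Re g is harmless, as only coefficients
  with k > m must vanish.\<close>

definition dominated_on_axis :: "(nat \<Rightarrow> real) \<Rightarrow> bool" where
  "dominated_on_axis c \<longleftrightarrow> (\<forall>k. 0 \<le> c k) \<and> (\<forall>x. summable (\<lambda>k. c k * x ^ k)) \<and>
     (\<forall>z::complex. cmod (\<Sum>k. of_real (c k) * z ^ k) \<le> (\<Sum>k. c k * max (Re z) 0 ^ k))"

lemma summable_of_real_power_series:
  fixes z :: complex
  assumes "\<And>k. 0 \<le> c k" "\<And>x::real. summable (\<lambda>k. c k * x ^ k)"
  shows "summable (\<lambda>k. norm (of_real (c k) * z ^ k))"
  using assms(2)[of "norm z"] assms(1) by (simp add: norm_mult norm_power)

lemma dominated_on_axis_cmult: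
  assumes "dominated_on_axis c" "b \<ge> 0"
  shows "dominated_on_axis (\<lambda>k. b * c k)"
proof -
  have s: "summable (\<lambda>k. c k * x ^ k)" for x using assms by (auto simp: dominated_on_axis_def)
  have n: "0 \<le> c k" for k using assms by (auto simp: dominated_on_axis_def)
  have sz: "summable (\<lambda>k. of_real (c k) * z ^ k)" for z :: complex
    using summable_of_real_power_series[OF n s] by (rule summable_norm_cancel)
  have 1: "(\<Sum>k. of_real (b * c k) * z ^ k) = of_real b * (\<Sum>k. of_real (c k) * z ^ k)" for z :: complex
    by (simp add: suminf_mult[OF sz, symmetric] mult.assoc)
  have 2: "(\<Sum>k. b * c k * x ^ k) = b * (\<Sum>k. c k * x ^ k)" for x
    by (simp add: suminf_mult[OF s, symmetric] mult.assoc)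
  have 3: "cmod (\<Sum>k. of_real (c k) * z ^ k) \<le> (\<Sum>k. c k * max (Re z) 0 ^ k)" for z
    using assms by (auto simp: dominated_on_axis_def)
  show ?thesis unfolding dominated_on_axis_def 1 2
    using n s assms(2) 3 by (auto simp: norm_mult mult.assoc intro!: mult_left_mono summable_mult)
qed

lemma dominated_on_axis_exp:
  assumes "b \<ge> 0"
  shows "dominated_on_axis (\<lambda>k. b ^ k / fact k)"
proof -
  have 1: "(\<Sum>k. of_real (b ^ k / fact k) * z ^ k) = exp (of_real b * z)" for z :: complex
    by (simp add: exp_def scaleR_conv_of_real power_mult_distrib field_simps)
  have 2: "(\<Sum>k. b ^ k / fact k * x ^ k) = exp (b * x)" for x
    by (simp add: exp_def scaleR_conv_of_real power_mult_distrib field_simps)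
  have 3: "summable (\<lambda>k. b ^ k / fact k * x ^ k)" for x
    using summable_exp[of "b * x"] by (simp add: power_mult_distrib field_simps)
  show ?thesis unfolding dominated_on_axis_def 1 2
    using assms 3 by (auto simp: norm_exp_eq_Re mult_left_mono)
qed

text \<open>The factor $(a(k+1)+j)/(k+1+j) = a + (1-a)j\int_0^1 t^{k+j}\,dt$ acts on the power series
  $F$ as an average of the dilates $F(tz)$ with positive weights.\<close>

lemma dominated_on_axis_step:
  fixes a :: real and j :: nat
  assumes c: "dominated_on_axis c" and a: "0 \<le> a" "a \<le> 1"
  shows "dominated_on_axis (\<lambda>k. c k * ((a * real (k + 1) + real j) / (real (k + 1) + real j)))"
proof -
  have s: "summable (\<lambda>k. c k * x ^ k)" for x using c by (auto simp: dominated_on_axis_def)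
  have n: "0 \<le> c k" for k using c by (auto simp: dominated_on_axis_def)
  have dom: "cmod (\<Sum>k. of_real (c k) * z ^ k) \<le> (\<Sum>k. c k * max (Re z) 0 ^ k)" for z
    using c by (auto simp: dominated_on_axis_def)
  define r where "r k = (a * real (k + 1) + real j) / (real (k + 1) + real j)" for k
  define q where "q k = 1 / (real (k + 1) + real j)" for k
  have r: "r k = a + (1 - a) * real j * q k" for k
    by (simp add: r_def q_def field_simps)
  have q01: "0 \<le> q k" "q k \<le> 1" for k by (auto simp: q_def)
  have r01: "0 \<le> r k" "r k \<le> 1" for k
    using a by (auto simp: r_def divide_simps mult_left_le_one_le)
  have szn: "summable (\<lambda>k. norm (of_real (c k) * z ^ k))" for z :: complex
    by (rule summable_of_real_power_series[OF n s])
  have sz: "summable (\<lambda>k. of_real (c k) * z ^ k)" for z :: complex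
    using szn by (rule summable_norm_cancel)
  \<comment> \<open>\<open>q k\<close> is the integral of \<open>t ^ (k + j)\<close> over [0,1]. Sum
    and integral are exchanged twice, for the complex series and for its real majorant, by absolute
    convergence.\<close>
  have int: "(\<lambda>k. of_real (q k) * (of_real (c k) * z ^ k)) sums
      (\<integral>t. indicator {0..1} t *\<^sub>R (of_real t ^ j * (\<Sum>k. of_real (c k) * (of_real t * z) ^ k)) \<partial>lborel)"
    (is "_ sums integral\<^sup>L _ ?F")
    and intF: "integrable lborel (\<lambda>t. indicator {0..1} t *\<^sub>R (of_real t ^ j * (\<Sum>k. of_real (c k) * (of_real t * z) ^ k)))"
    and intq: "integrable lborel (\<lambda>t. indicator {0..1} t *\<^sub>R (t ^ j * (\<Sum>k. c k * (t * x) ^ k)))"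
    and intx: "x \<ge> 0 \<Longrightarrow> (\<lambda>k. q k * (c k * x ^ k)) sums
      (\<integral>t. indicator {0..1} t *\<^sub>R (t ^ j * (\<Sum>k. c k * (t * x) ^ k)) \<partial>lborel)"
    for z :: complex and x :: real
  proof -
    have pw: "has_bochner_integral lborel (\<lambda>t. t ^ (k + j) * indicator {0..1} t) (q k)" for k
      using integral_power[of 0 1 "k + j"] borel_integrable_atLeastAtMost[of 0 1 "\<lambda>t. t ^ (k + j)"]
      by (simp add: q_def has_bochner_integral_iff add_ac)
    let ?f = "\<lambda>k t. indicator {0..1} t *\<^sub>R (of_real t ^ j * (of_real (c k) * (of_real t * z) ^ k))"
    have fe: "?f k = (\<lambda>t. (of_real (c k) * z ^ k) * complex_of_real (t ^ (k + j) * indicator {0..1} t))" for k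
      by (auto simp: fun_eq_iff scaleR_conv_of_real power_mult_distrib power_add algebra_simps split: split_indicator)
    have fi: "has_bochner_integral lborel (?f k) (of_real (c k) * z ^ k * of_real (q k))" for k
      unfolding fe by (intro has_bochner_integral_mult_right has_bochner_integral_of_real pw)
    have fn: "norm (?f k t) = norm (of_real (c k) * z ^ k) * (t ^ (k + j) * indicator {0..1} t)" for k t
      by (simp add: fe norm_mult norm_power abs_mult power_mult_distrib power_add split: split_indicator)
    have fin: "(\<integral>t. norm (?f k t) \<partial>lborel) = norm (of_real (c k) * z ^ k) * q k" for k
      unfolding fn using pw[of k] by (simp add: has_bochner_integral_iff)
    have S: "summable (\<lambda>k. \<integral>t. norm (?f k t) \<partial>lborel)" unfolding fin
      by (rule summable_comparison_test'[OF szn[of z], of 0])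
         (auto simp: abs_mult norm_mult q01 intro!: mult_left_le)
    have A: "AE t in lborel. summable (\<lambda>k. norm (?f k t))"
    proof (rule AE_I2)
      fix t :: real
      have "summable (\<lambda>k. norm (of_real (c k) * (of_real t * z) ^ k))" by (rule szn)
      from summable_mult[OF this, of "indicator {0..1} t * norm (t ^ j)"]
      show "summable (\<lambda>k. norm (?f k t))" by (simp add: norm_mult norm_power power_abs mult_ac)
    qed
    have I: "integrable lborel (?f k)" for k using fi[of k] by (simp add: has_bochner_integral_iff)
    have sum_eq: "(\<Sum>k. ?f k t) = ?F t" for t
      using sz[of "of_real t * z"] by (cases "t \<in> {0..1}") (simp_all add: suminf_mult)
    have "(\<lambda>k. integral\<^sup>L lborel (?f k)) sums (\<integral>t. (\<Sum>k. ?f k t) \<partial>lborel)"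
      by (rule sums_integral[OF I A S])
    moreover have "integral\<^sup>L lborel (?f k) = of_real (q k) * (of_real (c k) * z ^ k)" for k
      using fi[of k] by (simp add: has_bochner_integral_iff mult_ac)
    ultimately show "(\<lambda>k. of_real (q k) * (of_real (c k) * z ^ k)) sums integral\<^sup>L lborel ?F"
      by (simp add: sum_eq)
    show "integrable lborel ?F"
      using integrable_suminf[OF I A S] by (simp add: sum_eq)
    let ?g = "\<lambda>k t. indicator {0..1} t *\<^sub>R (t ^ j * (c k * (t * x) ^ k))"
    have ge: "?g k = (\<lambda>t. (c k * x ^ k) * (t ^ (k + j) * indicator {0..1} t))" for k
      by (auto simp: fun_eq_iff power_mult_distrib power_add algebra_simps split: split_indicator)
    have gi: "has_bochner_integral lborel (?g k) (c k * x ^ k * q k)" for k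
      unfolding ge by (intro has_bochner_integral_mult_right pw)
    have gn: "norm (?g k t) = norm (c k * x ^ k) * (t ^ (k + j) * indicator {0..1} t)" for k t
      by (simp add: ge abs_mult power_mult_distrib power_add split: split_indicator)
    have sxn: "summable (\<lambda>k. norm (c k * y ^ k))" for y
      using s[of "abs y"] n by (simp add: abs_mult power_abs)
    have gin: "(\<integral>t. norm (?g k t) \<partial>lborel) = norm (c k * x ^ k) * q k" for k
      unfolding gn using pw[of k] by (simp add: has_bochner_integral_iff)
    have Sg: "summable (\<lambda>k. \<integral>t. norm (?g k t) \<partial>lborel)" unfolding gin
      by (rule summable_comparison_test'[OF sxn[of x], of 0])
         (auto simp: abs_mult norm_mult q01 intro!: mult_left_le)
    have Ag: "AE t in lborel. summable (\<lambda>k. norm (?g k t))"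
    proof (rule AE_I2)
      fix t :: real
      from summable_mult[OF sxn[of "t * x"], of "indicator {0..1} t * norm (t ^ j)"]
      show "summable (\<lambda>k. norm (?g k t))" by (simp add: norm_mult abs_mult norm_power power_abs mult_ac)
    qed
    have Ig: "integrable lborel (?g k)" for k using gi[of k] by (simp add: has_bochner_integral_iff)
    have gsum_eq: "(\<Sum>k. ?g k t) = indicator {0..1} t *\<^sub>R (t ^ j * (\<Sum>k. c k * (t * x) ^ k))" for t
      using s[of "t * x"] by (cases "t \<in> {0..1}") (simp_all add: suminf_mult)
    have "(\<lambda>k. integral\<^sup>L lborel (?g k)) sums (\<integral>t. (\<Sum>k. ?g k t) \<partial>lborel)"
      by (rule sums_integral[OF Ig Ag Sg])
    moreover have "integral\<^sup>L lborel (?g k) = q k * (c k * x ^ k)" for k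
      using gi[of k] by (simp add: has_bochner_integral_iff mult_ac)
    ultimately show "(\<lambda>k. q k * (c k * x ^ k)) sums
      (\<integral>t. indicator {0..1} t *\<^sub>R (t ^ j * (\<Sum>k. c k * (t * x) ^ k)) \<partial>lborel)"
      by (simp only: gsum_eq)
    show "integrable lborel (\<lambda>t. indicator {0..1} t *\<^sub>R (t ^ j * (\<Sum>k. c k * (t * x) ^ k)))"
      using integrable_suminf[OF Ig Ag Sg] by (simp only: gsum_eq)
  qed
  have key: "cmod (\<Sum>k. of_real (c k * r k) * z ^ k) \<le> (\<Sum>k. c k * r k * max (Re z) 0 ^ k)" for z :: complex
  proof -
    define p where "p = max (Re z) 0"
    have p0: "p \<ge> 0" by (simp add: p_def)
    let ?I = "\<integral>t. indicator {0..1} t *\<^sub>R (of_real t ^ j * (\<Sum>k. of_real (c k) * (of_real t * z) ^ k)) \<partial>lborel"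
    let ?J = "\<integral>t. indicator {0..1} t *\<^sub>R (t ^ j * (\<Sum>k. c k * (t * p) ^ k)) \<partial>lborel"
    have "(\<lambda>k. of_real a * (of_real (c k) * z ^ k) + of_real ((1-a) * j) * (of_real (q k) * (of_real (c k) * z ^ k)))
       sums (of_real a * (\<Sum>k. of_real (c k) * z ^ k) + of_real ((1-a)*j) * ?I)"
      by (intro sums_add sums_mult int summable_sums sz)
    then have L: "(\<Sum>k. of_real (c k * r k) * z ^ k) = of_real a * (\<Sum>k. of_real (c k) * z ^ k) + of_real ((1-a)*j) * ?I"
      by (simp add: sums_iff r algebra_simps)
    have "(\<lambda>k. a * (c k * p ^ k) + ((1-a) * j) * (q k * (c k * p ^ k)))
       sums (a * (\<Sum>k. (c k) * p ^ k) + ((1-a)*j) * ?J)"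
      by (intro sums_add sums_mult intx p0 summable_sums s)
    then have R: "(\<Sum>k. c k * r k * p ^ k) = a * (\<Sum>k. (c k) * p ^ k) + ((1-a)*j) * ?J"
      by (simp add: sums_iff r algebra_simps)
    have "norm ?I \<le> ?J"
    proof (rule order_trans[OF integral_norm_bound integral_mono[OF integrable_norm[OF intF] intq]])
      fix t :: real
      have "cmod (\<Sum>k. of_real (c k) * (of_real t * z) ^ k) \<le> (\<Sum>k. c k * (t * p) ^ k)" if "t \<in> {0..1}"
      proof -
        \<comment> \<open>Dilation by a nonnegative t commutes with the positive part, so the
          hypothesis at \<open>of_real t * z\<close> yields exactly the integrand of the
          majorant.\<close>
        have "max (Re (of_real t * z)) 0 = t * p" using that
          by (auto simp: p_def max_def mult_nonneg_nonneg mult_nonneg_nonpos mult_le_0_iff)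
        then show ?thesis using dom[of "of_real t * z"] by simp
      qed
      then show "norm (indicator {0..1} t *\<^sub>R (of_real t ^ j * (\<Sum>k. of_real (c k) * (of_real t * z) ^ k)))
         \<le> indicator {0..1} t *\<^sub>R (t ^ j * (\<Sum>k. c k * (t * p) ^ k))"
        by (auto simp: norm_mult norm_power mult_left_mono split: split_indicator)
    qed
    moreover have "cmod (\<Sum>k. of_real (c k) * z ^ k) \<le> (\<Sum>k. c k * p ^ k)" unfolding p_def by (rule dom)
    ultimately have "norm (of_real a * (\<Sum>k. of_real (c k) * z ^ k) + of_real ((1-a)*j) * ?I)
      \<le> a * (\<Sum>k. (c k) * p ^ k) + ((1-a)*j) * ?J"
    proof (intro norm_triangle_le add_mono)
      have n: "norm (complex_of_real b * w) = b * norm w" if "b \<ge> 0" for b w using that by (simp add: norm_mult)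
      show "norm (of_real a * (\<Sum>k. of_real (c k) * z ^ k)) \<le> a * (\<Sum>k. (c k) * p ^ k)"
        if "cmod (\<Sum>k. of_real (c k) * z ^ k) \<le> (\<Sum>k. c k * p ^ k)"
        unfolding n[OF a(1)] using a that by (intro mult_left_mono)
      show "norm (of_real ((1-a)*j) * ?I) \<le> ((1-a)*j) * ?J" if "norm ?I \<le> ?J"
      proof -
        have "(1-a)*j \<ge> 0" using a by simp
        then show ?thesis unfolding n[OF \<open>(1-a)*j \<ge> 0\<close>] using that by (intro mult_left_mono)
      qed
    qed
    then show ?thesis unfolding L p_def[symmetric] R .
  qed
  have "summable (\<lambda>k. c k * r k * x ^ k)" for x
  proof (rule summable_comparison_test'[of _ 0])
    show "summable (\<lambda>k. c k * \<bar>x\<bar> ^ k)" by (rule s)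
    fix k show "norm (c k * r k * x ^ k) \<le> c k * \<bar>x\<bar> ^ k"
      using n r01[of k] by (simp add: abs_mult power_abs mult_right_mono mult_left_le)
  qed
  then have "dominated_on_axis (\<lambda>k. c k * r k)"
    unfolding dominated_on_axis_def using key n r01(1) by (auto intro!: mult_nonneg_nonneg)
  then show ?thesis unfolding r_def .
qed

section \<open>The Mittag-Leffler function on the positive axis\<close>

text \<open>Log-convexity of Gamma between s = j + \<theta> and s + 1: the point j + 1 divides this
  interval with weights \<theta> and 1 - \<theta>, and Gamma(s + 1) = s Gamma(s) with s \<le> j +
  1.\<close>

lemma Gamma_add_fraction_ge:
  fixes j :: nat and \<theta> :: real
  assumes "0 \<le> \<theta>" "\<theta> \<le> 1" "real j + \<theta> > 0"
  shows "fact j \<le> Gamma (real j + \<theta>) * (real j + 1) powr (1 - \<theta>)"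
proof -
  let ?s = "real j + \<theta>"
  have "(ln \<circ> Gamma) ((1 - (1 - \<theta>)) *\<^sub>R ?s + (1 - \<theta>) *\<^sub>R (?s + 1)) \<le>
     (1 - (1 - \<theta>)) * (ln \<circ> Gamma) ?s + (1 - \<theta>) * (ln \<circ> Gamma) (?s + 1)"
    using assms by (intro convex_onD[OF log_convex_Gamma_real]) auto
  moreover have "(1 - (1 - \<theta>)) *\<^sub>R ?s + (1 - \<theta>) *\<^sub>R (?s + 1) = real j + 1"
    by (simp add: algebra_simps)
  moreover have "Gamma (?s + 1) = ?s * Gamma ?s"
    using assms by (intro Gamma_plus1) (auto elim!: nonpos_Ints_cases)
  ultimately have "ln (Gamma (real j + 1)) \<le> \<theta> * ln (Gamma ?s) + (1 - \<theta>) * ln (?s * Gamma ?s)"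
    by (simp add: add_ac)
  also have "ln (?s * Gamma ?s) = ln ?s + ln (Gamma ?s)"
    using assms(3) Gamma_real_pos[OF assms(3)] by (rule ln_mult_pos)
  also have "\<theta> * ln (Gamma ?s) + (1 - \<theta>) * (ln ?s + ln (Gamma ?s)) = ln (Gamma ?s) + (1 - \<theta>) * ln ?s"
    by (simp add: algebra_simps)
  also have "(1 - \<theta>) * ln ?s \<le> (1 - \<theta>) * ln (real j + 1)"
    using assms by (intro mult_left_mono) auto
  finally have "ln (fact j) \<le> ln (Gamma ?s) + (1 - \<theta>) * ln (real j + 1)"
    using Gamma_fact[of j, where 'a = real] by (simp add: add_ac)
  then have "exp (ln (fact j)) \<le> exp (ln (Gamma ?s) + (1 - \<theta>) * ln (real j + 1))"
    by (subst exp_le_cancel_iff)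
  then show ?thesis using assms by (simp add: exp_add powr_def)
qed

text \<open>Replaces a term with fractional exponent by terms of the exponential series. The mixed
  factor y^\<theta> (j+1)^(1-\<theta>) left by the Gamma estimate is split with Young's
  inequality.\<close>

lemma powr_div_Gamma_le:
  fixes s y :: real
  assumes "s > 0" "y > 0"
  defines "j \<equiv> nat \<lfloor>s\<rfloor>"
  shows "y powr s / Gamma s \<le> (y ^ (j + 1) + real (j + 1) * y ^ j) / fact j"
proof -
  define \<theta> where "\<theta> = s - real j"
  have th: "0 \<le> \<theta>" "\<theta> \<le> 1" and s: "s = real j + \<theta>"
    using assms unfolding \<theta>_def j_def by linarith+
  have G: "Gamma s > 0" using assms by simp
  have "fact j \<le> Gamma s * (real j + 1) powr (1 - \<theta>)"
    using Gamma_add_fraction_ge[OF th, of j] s assms(1) by (metis)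
  then have "1 / Gamma s \<le> (real j + 1) powr (1 - \<theta>) / fact j"
    using G by (simp add: field_simps)
  then have "y powr s * (1 / Gamma s) \<le> y powr s * ((real j + 1) powr (1 - \<theta>) / fact j)"
    by (rule mult_left_mono) simp
  also have "y powr s * ((real j + 1) powr (1 - \<theta>) / fact j) =
     y ^ j / fact j * (y powr \<theta> * (real j + 1) powr (1 - \<theta>))"
    using assms(2) unfolding s by (simp add: powr_add powr_realpow)
  also have "\<dots> \<le> y ^ j / fact j * (\<theta> * y + (1 - \<theta>) * (real j + 1))"
    using th assms(2) by (intro mult_left_mono Youngs_inequality_0) auto
  also have "\<dots> \<le> y ^ j / fact j * (y + (real j + 1))"
    using th assms(2) by (intro mult_left_mono add_mono) (auto intro!: mult_left_le_one_le)
  finally show ?thesis by (simp add: field_simps)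
qed

lemma sums_shifted_exp_series:
  fixes y :: real
  assumes "y \<ge> 0"
  shows "(\<lambda>j. (y ^ (j + 1) + real (j + 1) * y ^ j) / fact j) sums ((1 + 2 * y) * exp y)"
proof -
  have 1: "(\<lambda>j. y ^ j / fact j) sums exp y"
    using exp_converges[of y] by (simp add: scaleR_conv_of_real field_simps)
  have 2: "(\<lambda>j. real j * y ^ j / fact j) sums (y * exp y)"
  proof (rule sums_Suc_imp)
    have "real (Suc n) * y ^ Suc n / fact (Suc n) = y * (y ^ n / fact n)" for n
      by (simp add: fact_Suc del: of_nat_Suc)
    then show "(\<lambda>n. real (Suc n) * y ^ Suc n / fact (Suc n)) sums (y * exp y)"
      using sums_mult[OF 1, of y] by simp
  qed simp
  have "(\<lambda>j. y * (y ^ j / fact j) + (real j * y ^ j / fact j + y ^ j / fact j)) sums (y * exp y + (y * exp y + exp y))"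
    by (intro sums_add sums_mult 1 2)
  then show ?thesis by (simp add: field_simps)
qed

text \<open>In a fibre, k + 1 runs through integers of the half-open interval from m j to m j + m,
  whose length is m.\<close>

lemma card_floor_fibre_le:
  fixes m :: real
  assumes "m \<ge> 1" "finite K"
  shows "real (card {k \<in> K. nat \<lfloor>real (k + 1) / m\<rfloor> = j}) \<le> m + 1"
proof -
  let ?A = "{k \<in> K. nat \<lfloor>real (k + 1) / m\<rfloor> = j}"
  have "\<lceil>m * j\<rceil> \<le> int (k + 1) \<and> int (k+1) < \<lceil>m * j\<rceil> + \<lceil>m\<rceil>" if "k \<in> ?A" for k
  proof -
    have "real j \<le> real (k + 1) / m" "real (k + 1) / m < real j + 1"
      using that assms by (auto simp: le_nat_iff)
    then have "m * j \<le> k + 1" "k + 1 < m * j + m" using assms by (auto simp: field_simps)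
    then show ?thesis by linarith
  qed
  then have "(\<lambda>k. int (k+1)) ` ?A \<subseteq> {\<lceil>m * j\<rceil>..<\<lceil>m * j\<rceil> + \<lceil>m\<rceil>}" by auto
  then have "card ((\<lambda>k. int (k+1)) ` ?A) \<le> card {\<lceil>m * j\<rceil>..<\<lceil>m * j\<rceil> + \<lceil>m\<rceil>}"
    by (intro card_mono) auto
  moreover have "card ((\<lambda>k. int (k+1)) ` ?A) = card ?A" by (intro card_image) (auto simp: inj_on_def)
  ultimately have "card ?A \<le> nat \<lceil>m\<rceil>" by simp
  then show ?thesis using assms by linarith
qed

text \<open>Grouping the indices by the integer part of (k+1)/m uses each term of the shifted
  exponential series at most m + 1 times.\<close>

lemma sum_powr_div_Gamma_le:
  fixes m y :: real
  assumes m: "m \<ge> 1" and y: "y > 0"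
  shows "(\<Sum>k<n. y powr (real (k + 1) / m) / Gamma (real (k + 1) / m)) \<le> (m + 1) * ((1 + 2 * y) * exp y)"
proof -
  define T where "T j = (y ^ (j + 1) + real (j + 1) * y ^ j) / fact j" for j
  have T0: "T j \<ge> 0" for j using y by (simp add: T_def)
  define \<phi> where "\<phi> k = nat \<lfloor>real (k + 1) / m\<rfloor>" for k
  have "(\<Sum>k<n. y powr (real (k + 1) / m) / Gamma (real (k + 1) / m)) \<le> (\<Sum>k<n. T (\<phi> k))"
    unfolding T_def \<phi>_def using m y by (intro sum_mono powr_div_Gamma_le) auto
  also have "\<dots> = (\<Sum>j\<in>\<phi> ` {..<n}. \<Sum>k\<in>{k\<in>{..<n}. \<phi> k = j}. T (\<phi> k))"
    by (rule sum.image_gen) simp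
  also have "\<dots> = (\<Sum>j\<in>\<phi> ` {..<n}. real (card {k\<in>{..<n}. \<phi> k = j}) * T j)"
    by (intro sum.cong refl) simp
  also have "\<dots> \<le> (\<Sum>j\<in>\<phi> ` {..<n}. (m + 1) * T j)"
    unfolding \<phi>_def using m T0 by (intro sum_mono mult_right_mono card_floor_fibre_le) auto
  also have "\<dots> = (m + 1) * (\<Sum>j\<in>\<phi> ` {..<n}. T j)" by (simp add: sum_distrib_left)
  also have "(\<Sum>j\<in>\<phi> ` {..<n}. T j) \<le> (1 + 2 * y) * exp y"
  proof -
    have "T sums ((1 + 2 * y) * exp y)" unfolding T_def using y by (intro sums_shifted_exp_series) simp
    then have "summable T" "suminf T = (1 + 2 * y) * exp y" by (auto simp: sums_iff)
    then show ?thesis using sum_le_suminf[of T "\<phi> ` {..<n}"] T0 by simp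
  qed
  finally show ?thesis using m by (auto intro: mult_left_mono)
qed

text \<open>The two-parameter Mittag-Leffler function with both parameters equal to 1/m, restricted
  to the real line, where positivity, monotonicity and logarithms make sense.\<close>

definition ml_real :: "real \<Rightarrow> real \<Rightarrow> real" where
  "ml_real m x = (\<Sum>k. x ^ k / Gamma (real (k + 1) / m))"

lemma summable_ml_real:
  fixes m x :: real
  assumes m: "m \<ge> 1"
  shows "summable (\<lambda>k. x ^ k / Gamma (real (k + 1) / m))"
proof -
  \<comment> \<open>With y = r^m the available sum has terms r^(k+1) instead of r^k; r \<ge> 1
    absorbs the extra power and keeps y positive at x = 0.\<close>
  define r where "r = max 1 \<bar>x\<bar>"
  have r: "r \<ge> 1" "\<bar>x\<bar> \<le> r" by (auto simp: r_def)
  have "summable (\<lambda>k. (r powr m) powr (real (k + 1) / m) / Gamma (real (k + 1) / m))"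
  proof (rule bounded_imp_summable[where B="(m + 1) * ((1 + 2 * r powr m) * exp (r powr m))"])
    show "(\<Sum>k\<le>n. (r powr m) powr (real (k + 1) / m) / Gamma (real (k + 1) / m))
        \<le> (m + 1) * ((1 + 2 * r powr m) * exp (r powr m))" for n
      unfolding lessThan_Suc_atMost[symmetric] using m r by (intro sum_powr_div_Gamma_le) auto
  qed (use m in simp)
  then show ?thesis
  proof (rule summable_comparison_test'[of _ 0])
    fix k
    have "\<bar>x\<bar> ^ k \<le> r ^ k" using r by (intro power_mono) auto
    also have "\<dots> \<le> r ^ (k + 1)" using r by (intro power_increasing) auto
    also have "\<dots> = (r powr m) powr (real (k + 1) / m)"
      using m r by (simp add: powr_powr powr_add powr_realpow)
    finally show "norm (x ^ k / Gamma (real (k + 1) / m)) \<le> (r powr m) powr (real (k + 1) / m) / Gamma (real (k + 1) / m)"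
      using m by (simp add: power_abs divide_right_mono)
  qed
qed

lemma ml_real_mono:
  assumes "m \<ge> 1" "0 \<le> x" "x \<le> y"
  shows "ml_real m x \<le> ml_real m y"
  unfolding ml_real_def using assms
  by (intro suminf_le summable_ml_real) (auto intro!: divide_right_mono power_mono)

lemma ml_real_pos:
  assumes "m \<ge> 1" "0 \<le> x"
  shows "0 < ml_real m x"
proof -
  have "0 < x ^ 0 / Gamma (real (0 + 1) / m)" using assms by simp
  also have "\<dots> \<le> ml_real m x" unfolding ml_real_def
    using sum_le_suminf[OF summable_ml_real[OF assms(1)], of "{0}" x] assms by auto
  finally show ?thesis .
qed

text \<open>The grouped sum at y = x^m carries one power of x too many; dividing it out turns x^m
  into x^(m-1). This exponent is the right one: it will cancel exactly against a Gaussian integral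
  in the Schur test. On [0,1] monotonicity is enough.\<close>

lemma ml_real_upper_bound:
  assumes m: "m \<ge> 1"
  obtains C where "C > 0" "\<And>x. x \<ge> 0 \<Longrightarrow> ml_real m x \<le> C * (1 + x) powr (m - 1) * exp (x powr m)"
proof -
  have big: "ml_real m x \<le> 3 * (m + 1) * x powr (m - 1) * exp (x powr m)" if x: "x \<ge> 1" for x
  proof -
    have "(\<Sum>k. x ^ k / Gamma (real (k + 1) / m)) \<le> 3 * (m + 1) * x powr (m - 1) * exp (x powr m)"
    proof (rule suminf_le_const[OF summable_ml_real[OF m]])
      fix n
      have "x * (\<Sum>k<n. x ^ k / Gamma (real (k + 1) / m)) = (\<Sum>k<n. (x powr m) powr (real (k + 1) / m) / Gamma (real (k + 1) / m))"
        unfolding sum_distrib_left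
        using m x by (intro sum.cong refl) (simp add: powr_powr powr_add powr_realpow[symmetric] add_divide_distrib)
      also have "\<dots> \<le> (m + 1) * ((1 + 2 * x powr m) * exp (x powr m))"
        using m x by (intro sum_powr_div_Gamma_le) auto
      also have "\<dots> \<le> (m + 1) * ((3 * x powr m) * exp (x powr m))"
        using m x by (intro mult_left_mono mult_right_mono) (auto simp: ge_one_powr_ge_zero)
      also have "(m + 1) * ((3 * x powr m) * exp (x powr m)) = x * (3 * (m + 1) * x powr (m - 1) * exp (x powr m))"
        using x by (simp add: powr_diff)
      finally have "x * (\<Sum>k<n. x ^ k / Gamma (real (k + 1) / m)) \<le> x * (3 * (m + 1) * x powr (m - 1) * exp (x powr m))"
        .
      then show "(\<Sum>k<n. x ^ k / Gamma (real (k + 1) / m)) \<le> 3 * (m + 1) * x powr (m - 1) * exp (x powr m)"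
        using x by (subst (asm) mult_le_cancel_left_pos) auto
    qed
    then show ?thesis unfolding ml_real_def .
  qed
  show ?thesis
  proof
    show "3 * (m + 1) * exp 1 > 0" using m by simp
    fix x :: real assume x: "x \<ge> 0"
    show "ml_real m x \<le> 3 * (m + 1) * exp 1 * (1 + x) powr (m - 1) * exp (x powr m)"
    proof (cases "x \<ge> 1")
      case True
      have "3 * (m + 1) * x powr (m - 1) * exp (x powr m) \<le> 3 * (m + 1) * (exp 1 * (1 + x) powr (m - 1)) * exp (x powr m)"
        using m x one_le_exp_iff[of 1]
        by (intro mult_left_mono mult_right_mono order_trans[OF powr_mono2[of "m-1" x "1+x"]]) (auto simp: mult_le_cancel_right1)
      also have "\<dots> = 3 * (m + 1) * exp 1 * (1 + x) powr (m - 1) * exp (x powr m)" by simp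
      finally show ?thesis using big[OF True] by linarith
    next
      case False
      have "ml_real m x \<le> ml_real m 1" using False x m by (intro ml_real_mono) auto
      also have "\<dots> \<le> 3 * (m + 1) * exp 1" using big[of 1] by simp
      also have "\<dots> = 3 * (m + 1) * exp 1 * 1 * 1" by simp
      also have "\<dots> \<le> 3 * (m + 1) * exp 1 * (1 + x) powr (m - 1) * exp (x powr m)"
        using m x by (intro mult_mono) (auto simp: ge_one_powr_ge_zero)
      finally show ?thesis .
    qed
  qed
qed

section \<open>The Mittag-Leffler function off the axis\<close>

definition ml :: "real \<Rightarrow> complex \<Rightarrow> complex" where
  "ml m z = (\<Sum>k. z ^ k / of_real (Gamma (real (k + 1) / m)))"

text \<open>Gauss' product for the Gamma function writes $k!/\Gamma(a(k+1))$ as the limit of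
  $n^{(1-a)(k+1)}\prod_{j\le n}(a(k+1)+j)/(k+1+j)$, which increases with $n$.\<close>

definition gauss_coeff :: "real \<Rightarrow> nat \<Rightarrow> nat \<Rightarrow> real" where
  "gauss_coeff a n k = exp ((1 - a) * real (k + 1) * ln (real n)) *
     pochhammer (a * real (k + 1)) (n + 1) / pochhammer (real (k + 1)) (n + 1) / fact k"

text \<open>Each factor of the two Pochhammer products is one averaging step, applied to the
  exponential series with \<open>b\<close> = n^(1-a). The power b^(k+1) has one \<open>b\<close>
  more than that series, a positive scalar.\<close>

lemma dominated_on_axis_gauss_coeff:
  assumes a: "0 \<le> a" "a \<le> 1" and n: "n \<ge> 1"
  shows "dominated_on_axis (gauss_coeff a n)"
proof -
  define b where "b = exp ((1 - a) * ln (real n))"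
  have *: "dominated_on_axis (\<lambda>k. b ^ k / fact k * (pochhammer (a * real (k + 1)) N / pochhammer (real (k + 1)) N))" for N
  proof (induction N)
    case 0
    then show ?case using dominated_on_axis_exp[of b] by (simp add: b_def)
  next
    case (Suc N)
    from dominated_on_axis_step[OF this a, of N]
    show ?case by (simp add: pochhammer_Suc mult_ac)
  qed
  have "dominated_on_axis (\<lambda>k. b * (b ^ k / fact k * (pochhammer (a * real (k + 1)) (n + 1) / pochhammer (real (k + 1)) (n + 1))))"
    by (rule dominated_on_axis_cmult[OF *]) (simp add: b_def)
  moreover have "b * (b ^ k / fact k * (pochhammer (a * real (k + 1)) (n + 1) / pochhammer (real (k + 1)) (n + 1))) = gauss_coeff a n k" for k
  proof -
    have "exp ((1 - a) * real (k + 1) * ln (real n)) = b ^ (k + 1)"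
      unfolding b_def exp_of_nat_mult[symmetric] by (simp only: mult_ac)
    then show ?thesis by (simp add: gauss_coeff_def mult_ac)
  qed
  ultimately show ?thesis by simp
qed

text \<open>In the quotient of Gauss' approximations to Gamma(k+1) and Gamma(a(k+1)) the factor n!
  cancels, and the limit Gamma(k+1) = k! removes \<open>fact k\<close>.\<close>

lemma gauss_coeff_LIMSEQ:
  assumes a: "0 < a"
  shows "(\<lambda>n. gauss_coeff a n k) \<longlonglongrightarrow> 1 / Gamma (a * real (k + 1))"
proof -
  have G: "Gamma (a * real (k + 1)) > 0" using a by simp
  have "(\<lambda>n. Gamma_series (real (k + 1)) n / Gamma_series (a * real (k + 1)) n / fact k)
     \<longlonglongrightarrow> Gamma (real (k + 1)) / Gamma (a * real (k + 1)) / fact k"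
    using G by (intro tendsto_intros) auto
  moreover have "Gamma (real (k + 1)) = fact k" using Gamma_fact[of k, where 'a = real] by (simp add: add_ac)
  moreover have "Gamma_series (real (k + 1)) n / Gamma_series (a * real (k + 1)) n / fact k = gauss_coeff a n k" for n
  proof -
    have "exp (real (k + 1) * ln (real n)) / exp (a * real (k + 1) * ln (real n)) = exp ((1 - a) * real (k + 1) * ln (real n))"
      unfolding exp_diff[symmetric] by (simp add: algebra_simps)
    then show ?thesis
      by (simp add: Gamma_series_def gauss_coeff_def field_simps del: of_nat_add of_nat_Suc)
  qed
  ultimately show ?thesis by simp
qed

text \<open>Monotonicity in n makes the limit a majorant. With N = n + 1 and x = k + 1 the quotient
  of consecutive terms is (N/n)^((1-a)x) (ax+N)/(x+N). It is at least 1, since (x+N)/(ax+N) \<le> 1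
  + (1-a)x/N and 1/N \<le> log(N/n).\<close>

lemma gauss_coeff_Suc_ge:
  assumes a: "0 < a" "a \<le> 1" and n: "n \<ge> 1"
  shows "gauss_coeff a n k \<le> gauss_coeff a (Suc n) k"
proof -
  define x where "x = real (k + 1)"
  have x: "x > 0" by (simp add: x_def)
  define N where "N = real n + 1"
  have N: "N > 1" using n by (simp add: N_def)
  have ax: "0 < a * x" "a * x \<le> x" using a x by (auto simp: mult_le_cancel_right1)
  have "(x + N) / (a * x + N) = 1 + (1 - a) * x / (a * x + N)" using ax N by (simp add: field_simps)
  also have "\<dots> \<le> 1 + (1 - a) * x / N"
    using a x ax N by (intro add_left_mono divide_left_mono) auto
  also have "\<dots> = 1 + (1 - a) * x * (1 / N)" by simp
  also have "1 / N \<le> ln N - ln (real n)"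
  proof -
    have "ln (real n / N) \<le> real n / N - 1" using n N by (intro ln_le_minus_one) auto
    also have "real n / N - 1 = - 1 / N" using N by (simp add: N_def field_simps)
    finally show ?thesis using n N by (simp add: ln_div)
  qed
  also have "1 + (1 - a) * x * (ln N - ln (real n)) \<le> exp ((1 - a) * x * (ln N - ln (real n)))"
    by (rule exp_ge_add_one_self)
  finally have "(x + N) / (a * x + N) \<le> exp ((1 - a) * x * (ln N - ln (real n)))"
    using a x by (simp add: mult_left_mono)
  then have ratio: "1 \<le> exp ((1 - a) * x * (ln N - ln (real n))) * ((a * x + N) / (x + N))"
    using ax N x by (simp add: field_simps)
  have g0: "gauss_coeff a n k \<ge> 0" unfolding gauss_coeff_def
    using a by (intro divide_nonneg_nonneg mult_nonneg_nonneg) (auto intro!: pochhammer_nonneg)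
  have "gauss_coeff a (Suc n) k = gauss_coeff a n k * (exp ((1 - a) * x * (ln N - ln (real n))) * ((a * x + N) / (x + N)))"
  proof -
    have e: "exp ((1 - a) * x * ln N) = exp ((1 - a) * x * ln (real n)) * exp ((1 - a) * x * (ln N - ln (real n)))"
      unfolding exp_add[symmetric] by (simp add: algebra_simps)
    have "real (Suc n) = N" by (simp add: N_def)
    then show ?thesis unfolding gauss_coeff_def x_def[symmetric]
      by (simp only: e pochhammer_Suc[of _ "Suc n"] Suc_eq_plus1[symmetric]) (simp add: mult_ac)
  qed
  then show ?thesis using mult_left_mono[OF ratio g0] by simp
qed

lemma gauss_coeff_le:
  assumes a: "0 < a" "a \<le> 1" and n: "n \<ge> 1"
  shows "gauss_coeff a n k \<le> 1 / Gamma (a * real (k + 1))"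
proof -
  have "incseq (\<lambda>n. gauss_coeff a (Suc n) k)"
    by (intro incseq_SucI gauss_coeff_Suc_ge a) auto
  from incseq_le[OF this LIMSEQ_Suc[OF gauss_coeff_LIMSEQ[OF a(1)]], of "n - 1"] n
  show ?thesis by simp
qed

lemma suminf_tendsto_dominated:
  fixes f :: "nat \<Rightarrow> nat \<Rightarrow> 'a::{banach,second_countable_topology}"
  assumes "\<And>k. (\<lambda>n. f n k) \<longlonglongrightarrow> g k" "\<And>n k. norm (f n k) \<le> h k" "summable h"
  shows "(\<lambda>n. \<Sum>k. f n k) \<longlonglongrightarrow> (\<Sum>k. g k)"
proof -
  have h0: "h k \<ge> 0" for k using assms(2)[of 0 k] norm_ge_zero order_trans by blast
  have ih: "integrable (count_space UNIV) h"
    using assms(3) h0 by (simp add: integrable_count_space_nat_iff)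
  have meas: "g \<in> borel_measurable (count_space UNIV)" "f n \<in> borel_measurable (count_space UNIV)" for n by auto
  have lim: "AE k in count_space UNIV. (\<lambda>n. f n k) \<longlonglongrightarrow> g k" using assms(1) by (simp add: AE_count_space)
  have bd: "AE k in count_space UNIV. norm (f n k) \<le> h k" for n using assms(2) by (simp add: AE_count_space)
  have "(\<lambda>n. integral\<^sup>L (count_space UNIV) (f n)) \<longlonglongrightarrow> integral\<^sup>L (count_space UNIV) g"
    by (rule integral_dominated_convergence[OF meas ih lim bd])
  moreover have "integrable (count_space UNIV) g" "integrable (count_space UNIV) (f n)" for n
    by (rule integrable_dominated_convergence[OF meas ih lim bd] integrable_dominated_convergence2[OF meas ih lim bd])+
  ultimately show ?thesis by (simp add: integral_count_space_nat)
qed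

lemma norm_summable_ml:
  assumes "m \<ge> 1"
  shows "summable (\<lambda>k. norm (z ^ k / complex_of_real (Gamma (real (k + 1) / m))))"
proof -
  have "\<bar>Gamma (real (k + 1) / m)\<bar> = Gamma (real (k + 1) / m)" for k
    using assms by (simp add: less_imp_le)
  then show ?thesis using summable_ml_real[OF assms, of "norm z"]
    by (simp add: norm_divide norm_power del: of_nat_Suc of_nat_add)
qed

lemma ml_of_real:
  assumes "m \<ge> 1"
  shows "ml m (of_real x) = of_real (ml_real m x)"
  unfolding ml_def ml_real_def suminf_of_real[OF summable_ml_real[OF assms]] by simp

text \<open>The inequality holds for every Gauss approximant and survives the limit by dominated
  convergence of the series. The assumption m \<ge> 1 enters as 1/m \<le> 1, which makes the
  averaging weight 1 - a nonnegative.\<close>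

lemma norm_ml_le:
  assumes m: "m \<ge> 1"
  shows "cmod (ml m z) \<le> ml_real m (max (Re z) 0)"
proof -
  define a where "a = 1 / m"
  have a: "0 < a" "a \<le> 1" using m by (auto simp: a_def)
  have ag: "Gamma (a * real (k + 1)) = Gamma (real (k + 1) / m)" for k by (simp add: a_def)
  have G: "Gamma (real (k + 1) / m) > 0" for k using m by simp
  have g0: "gauss_coeff a (Suc n) k \<ge> 0" for n k
    using dominated_on_axis_gauss_coeff[of a "Suc n"] a by (auto simp: dominated_on_axis_def)
  have gle: "gauss_coeff a (Suc n) k \<le> 1 / Gamma (real (k + 1) / m)" for n k
    using gauss_coeff_le[OF a, of "Suc n" k] ag by simp
  have lim: "(\<lambda>n. gauss_coeff a (Suc n) k) \<longlonglongrightarrow> 1 / Gamma (real (k + 1) / m)" for k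
    using LIMSEQ_Suc[OF gauss_coeff_LIMSEQ[OF a(1), of k]] ag by simp
  have 1: "(\<lambda>n. \<Sum>k. of_real (gauss_coeff a (Suc n) k) * z ^ k) \<longlonglongrightarrow> (\<Sum>k. of_real (1 / Gamma (real (k + 1) / m)) * z ^ k)"
  proof (rule suminf_tendsto_dominated)
    show "summable (\<lambda>k. norm z ^ k / Gamma (real (k + 1) / m))" by (rule summable_ml_real[OF m])
    show "norm (of_real (gauss_coeff a (Suc n) k) * z ^ k) \<le> norm z ^ k / Gamma (real (k + 1) / m)" for n k
      using mult_right_mono[OF gle[of n k], of "norm z ^ k"] g0[of n k] by (simp add: norm_mult norm_power)
  qed (intro tendsto_intros lim)
  have 2: "(\<lambda>n. \<Sum>k. gauss_coeff a (Suc n) k * x ^ k) \<longlonglongrightarrow> (\<Sum>k. 1 / Gamma (real (k + 1) / m) * x ^ k)" for x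
  proof (rule suminf_tendsto_dominated)
    show "summable (\<lambda>k. norm x ^ k / Gamma (real (k + 1) / m))" by (rule summable_ml_real[OF m])
    show "norm (gauss_coeff a (Suc n) k * x ^ k) \<le> norm x ^ k / Gamma (real (k + 1) / m)" for n k
      using mult_right_mono[OF gle[of n k], of "norm x ^ k"] g0[of n k] by (simp add: norm_mult norm_power abs_mult power_abs)
  qed (intro tendsto_intros lim)
  have "cmod (\<Sum>k. of_real (1 / Gamma (real (k + 1) / m)) * z ^ k) \<le> (\<Sum>k. 1 / Gamma (real (k + 1) / m) * max (Re z) 0 ^ k)"
    using dominated_on_axis_gauss_coeff[of a "Suc n" for n] a
    by (intro tendsto_le[OF _ 2 tendsto_norm[OF 1]] always_eventually allI) (auto simp: dominated_on_axis_def)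
  then show ?thesis by (simp add: ml_def ml_real_def)
qed

section \<open>Area measure: rotations, moments, Gaussians\<close>

lemma borel_measurable_Complex: "(\<lambda>(x, y). Complex x y) \<in> borel_measurable (lborel \<Otimes>\<^sub>M lborel)"
proof -
  have "(\<lambda>p. Complex (fst p) (snd p)) \<in> borel_measurable (borel :: (real \<times> real) measure)"
    by (intro borel_measurable_continuous_onI) (auto simp: Complex_eq intro!: continuous_intros)
  then show ?thesis unfolding lborel_prod by (simp add: case_prod_unfold)
qed

text \<open>Opens the plane to Tonelli in real and imaginary parts; Lebesgue measure is determined
  by its values on boxes.\<close>

lemma lborel_complex_eq_distr: "(lborel :: complex measure) = distr (lborel \<Otimes>\<^sub>M lborel) borel (\<lambda>(x, y). Complex x y)"
proof (rule lborel_eqI)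
  have meas: "(\<lambda>(x, y). Complex x y) \<in> borel_measurable (lborel \<Otimes>\<^sub>M lborel)"
    by (rule borel_measurable_Complex)
  fix l u :: complex
  assume "\<And>b. b \<in> Basis \<Longrightarrow> l \<bullet> b \<le> u \<bullet> b"
  from this[of 1] this[of \<i>] have lu: "Re l \<le> Re u" "Im l \<le> Im u" by (auto simp: Basis_complex_def)
  have "emeasure (distr (lborel \<Otimes>\<^sub>M lborel) borel (\<lambda>(x, y). Complex x y)) (box l u) =
     emeasure (lborel \<Otimes>\<^sub>M lborel) ({Re l<..<Re u} \<times> {Im l<..<Im u})"
    by (subst emeasure_distr[OF meas]) (auto simp: box_def Basis_complex_def space_pair_measure intro!: arg_cong[where f="emeasure _"])
  also have "\<dots> = ennreal (Re u - Re l) * ennreal (Im u - Im l)"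
    using lu by (subst lborel.emeasure_pair_measure_Times) auto
  finally show "emeasure (distr (lborel \<Otimes>\<^sub>M lborel) borel (\<lambda>(x, y). Complex x y)) (box l u) = ennreal (prod ((\<bullet>) (u - l)) Basis)"
    using lu by (simp add: Basis_complex_def ennreal_mult complex_eq_iff)
qed simp

lemma nn_integral_complex_iterated:
  assumes [measurable]: "f \<in> borel_measurable borel"
  shows "(\<integral>\<^sup>+z. f z \<partial>lborel) = (\<integral>\<^sup>+x. \<integral>\<^sup>+y. f (Complex x y) \<partial>lborel \<partial>lborel)" (is ?A)
    and "(\<integral>\<^sup>+z. f z \<partial>lborel) = (\<integral>\<^sup>+y. \<integral>\<^sup>+x. f (Complex x y) \<partial>lborel \<partial>lborel)" (is ?B)
proof -
  have meas[measurable]: "(\<lambda>(x, y). Complex x y) \<in> borel_measurable (lborel \<Otimes>\<^sub>M lborel)"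
    by (rule borel_measurable_Complex)
  have m2: "(\<lambda>(x, y). f (Complex x y)) \<in> borel_measurable (lborel \<Otimes>\<^sub>M lborel)"
    using measurable_compose[OF meas, of f borel] by (simp add: case_prod_unfold)
  have "(\<integral>\<^sup>+z. f z \<partial>lborel) = (\<integral>\<^sup>+p. (\<lambda>(x, y). f (Complex x y)) p \<partial>(lborel \<Otimes>\<^sub>M lborel))"
    by (subst lborel_complex_eq_distr, subst nn_integral_distr) (auto simp: case_prod_unfold)
  also have "\<dots> = (\<integral>\<^sup>+x. \<integral>\<^sup>+y. f (Complex x y) \<partial>lborel \<partial>lborel)"
    using lborel.nn_integral_fst[OF m2] by simp
  finally show ?A .
  also have "\<dots> = (\<integral>\<^sup>+y. \<integral>\<^sup>+x. f (Complex x y) \<partial>lborel \<partial>lborel)"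
    using lborel_pair.Fubini'[OF m2] by simp
  finally show ?B .
qed

text \<open>With one coordinate frozen, a shear translates the other one, so Tonelli reduces the
  claim to translation invariance on the line.\<close>

lemma nn_integral_complex_shear:
  assumes f[measurable]: "f \<in> borel_measurable borel"
  shows "(\<integral>\<^sup>+z. f (z + of_real (q * Im z)) \<partial>lborel) = (\<integral>\<^sup>+z. f z \<partial>lborel)"
    and "(\<integral>\<^sup>+z. f (z + \<i> * of_real (q * Re z)) \<partial>lborel) = (\<integral>\<^sup>+z. f z \<partial>lborel)"
proof -
  have mc: "continuous_on UNIV (\<lambda>z. z + of_real (q * Im z))" "continuous_on UNIV (\<lambda>z. z + \<i> * of_real (q * Re z))"
    "continuous_on UNIV (\<lambda>x. Complex x y)" "continuous_on UNIV (\<lambda>y. Complex x y)" for x y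
    by (auto simp: Complex_eq intro!: continuous_intros)
  have m1: "(\<lambda>z. f (z + of_real (q * Im z))) \<in> borel_measurable borel"
    using measurable_compose[OF borel_measurable_continuous_onI[OF mc(1)] f] .
  have m2: "(\<lambda>z. f (z + \<i> * of_real (q * Re z))) \<in> borel_measurable borel"
    using measurable_compose[OF borel_measurable_continuous_onI[OF mc(2)] f] .
  have m3: "(\<lambda>x. f (Complex x y)) \<in> borel_measurable borel" for y
    using measurable_compose[OF borel_measurable_continuous_onI[OF mc(3)] f] .
  have m4: "(\<lambda>y. f (Complex x y)) \<in> borel_measurable borel" for x
    using measurable_compose[OF borel_measurable_continuous_onI[OF mc(4)] f] .
  have e1: "Complex x y + of_real (q * Im (Complex x y)) = Complex (q * y + 1 * x) y" for x y by (simp add: complex_eq_iff)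
  have e2: "Complex x y + \<i> * of_real (q * Re (Complex x y)) = Complex x (q * x + 1 * y)" for x y by (simp add: complex_eq_iff)
  have "(\<integral>\<^sup>+z. f (z + of_real (q * Im z)) \<partial>lborel) = (\<integral>\<^sup>+y. \<integral>\<^sup>+x. f (Complex (q * y + 1 * x) y) \<partial>lborel \<partial>lborel)"
    by (simp only: nn_integral_complex_iterated(2)[OF m1] e1)
  also have "\<dots> = (\<integral>\<^sup>+y. \<integral>\<^sup>+x. f (Complex x y) \<partial>lborel \<partial>lborel)"
    using nn_integral_real_affine[OF m3, of 1] by simp
  also have "\<dots> = (\<integral>\<^sup>+z. f z \<partial>lborel)" by (rule nn_integral_complex_iterated(2)[OF f, symmetric])
  finally show "(\<integral>\<^sup>+z. f (z + of_real (q * Im z)) \<partial>lborel) = (\<integral>\<^sup>+z. f z \<partial>lborel)" .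
  have "(\<integral>\<^sup>+z. f (z + \<i> * of_real (q * Re z)) \<partial>lborel) = (\<integral>\<^sup>+x. \<integral>\<^sup>+y. f (Complex x (q * x + 1 * y)) \<partial>lborel \<partial>lborel)"
    by (simp only: nn_integral_complex_iterated(1)[OF m2] e2)
  also have "\<dots> = (\<integral>\<^sup>+x. \<integral>\<^sup>+y. f (Complex x y) \<partial>lborel \<partial>lborel)"
    using nn_integral_real_affine[OF m4, of 1] by simp
  also have "\<dots> = (\<integral>\<^sup>+z. f z \<partial>lborel)" by (rule nn_integral_complex_iterated(1)[OF f, symmetric])
  finally show "(\<integral>\<^sup>+z. f (z + \<i> * of_real (q * Re z)) \<partial>lborel) = (\<integral>\<^sup>+z. f z \<partial>lborel)" .
qed

text \<open>A rotation by an angle that is not a multiple of $\pi$ is a product of three shears.\<close>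

lemma nn_integral_complex_rotate:
  assumes f[measurable]: "f \<in> borel_measurable borel" and t: "sin t \<noteq> 0"
  shows "(\<integral>\<^sup>+z. f (cis t * z) \<partial>lborel) = (\<integral>\<^sup>+z. f z \<partial>lborel)"
proof -
  \<comment> \<open>\<open>q\<close> equals -tan(t/2). Shearing horizontally by q, vertically by sin
    t and horizontally by q again composes to the rotation by t.\<close>
  define q where "q = (cos t - 1) / sin t"
  define s where "s = sin t"
  have q1: "1 + q * s = cos t" using t by (simp add: q_def s_def)
  have "q * (1 + cos t) = - s"
  proof -
    have "(cos t - 1) * (1 + cos t) = - (s * s)"
      using sin_cos_squared_add[of t] by (simp add: s_def power2_eq_square algebra_simps)
    then show ?thesis using t by (simp add: q_def s_def field_simps)
  qed
  then have q2: "q + q * cos t = - s" by (simp add: algebra_simps)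
  define A where "A z = z + of_real (q * Im z)" for z
  define B where "B z = z + \<i> * of_real (s * Re z)" for z
  have mA[measurable]: "A \<in> borel_measurable borel" and mB[measurable]: "B \<in> borel_measurable borel"
    unfolding A_def[abs_def] B_def[abs_def]
    by (auto intro!: borel_measurable_continuous_onI continuous_intros)
  have eq: "A (B (A z)) = cis t * z" for z
  proof -
    have s: "sin t = s" by (simp add: s_def)
    have "Re (A (B (A z))) = (1 + q * s) * Re z + (q + q * (1 + q * s)) * Im z"
      by (simp add: A_def B_def algebra_simps)
    moreover have "Im (A (B (A z))) = s * Re z + (1 + q * s) * Im z"
      by (simp add: A_def B_def algebra_simps)
    ultimately show ?thesis unfolding q1 q2 by (simp add: complex_eq_iff s)
  qed
  have fB: "(\<lambda>z. f (A (B z))) \<in> borel_measurable borel" "(\<lambda>z. f (A z)) \<in> borel_measurable borel" by measurable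
  have "(\<integral>\<^sup>+z. f (A (B (A z))) \<partial>lborel) = (\<integral>\<^sup>+z. f (A (B z)) \<partial>lborel)"
    using nn_integral_complex_shear(1)[OF fB(1), of q] by (simp add: A_def)
  also have "\<dots> = (\<integral>\<^sup>+z. f (A z) \<partial>lborel)"
    using nn_integral_complex_shear(2)[OF fB(2), of s] by (simp add: B_def)
  also have "\<dots> = (\<integral>\<^sup>+z. f z \<partial>lborel)"
    using nn_integral_complex_shear(1)[OF f, of q] by (simp add: A_def)
  finally show ?thesis by (simp only: eq)
qed

lemma distr_complex_rotate:
  assumes "sin t \<noteq> 0"
  shows "distr lborel borel (\<lambda>z. cis t * z) = (lborel :: complex measure)"
proof (rule measure_eqI)
  fix A :: "complex set" assume "A \<in> sets (distr lborel borel (\<lambda>z. cis t * z))"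
  then have A[measurable]: "A \<in> sets borel" by simp
  have m[measurable]: "(\<lambda>z. cis t * z) \<in> borel_measurable borel" by (auto intro!: borel_measurable_continuous_onI continuous_intros)
  have "emeasure (distr lborel borel (\<lambda>z. cis t * z)) A = (\<integral>\<^sup>+z. indicator A z \<partial>distr lborel borel (\<lambda>z. cis t * z))" by simp
  also have "\<dots> = (\<integral>\<^sup>+z. indicator A (cis t * z) \<partial>lborel)" by (subst nn_integral_distr) auto
  also have "\<dots> = (\<integral>\<^sup>+z. indicator A z \<partial>lborel)" by (rule nn_integral_complex_rotate[OF _ assms]) auto
  finally show "emeasure (distr lborel borel (\<lambda>z. cis t * z)) A = emeasure lborel A" by simp
qed simp

lemma integral_complex_rotate:
  fixes f :: "complex \<Rightarrow> 'a::{banach,second_countable_topology}"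
  assumes "f \<in> borel_measurable borel" "sin t \<noteq> 0"
  shows "(\<integral>z. f (cis t * z) \<partial>lborel) = (\<integral>z. f z \<partial>lborel)"
proof -
  have "(\<lambda>z. cis t * z) \<in> borel_measurable lborel" by (auto intro!: borel_measurable_continuous_onI continuous_intros)
  from integral_distr[OF this assms(1)] show ?thesis by (simp add: distr_complex_rotate assms)
qed

section \<open>Radial integrals: moments of the weight and Gaussians\<close>

text \<open>Stands in for polar coordinates. The sublevel set of |z|^(2p) at t \<ge> 0 is a disc of
  area \<pi> t^(1/p); the density is the derivative of this area, and closed half-lines determine a
  measure on the line.\<close>

lemma distr_cmod_powr:
  fixes p :: real
  assumes p: "p > 0"
  shows "distr lborel borel (\<lambda>z::complex. cmod z powr (2 * p)) =
    density lborel (\<lambda>t. ennreal (pi / p * t powr (1 / p - 1)) * indicator {0..} t)" (is "?M = ?N")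
proof (rule measure_eqI_generator_eq[where E = "range atMost" and \<Omega> = UNIV and A = "\<lambda>i. {..real i}"])
  have m: "(\<lambda>z::complex. cmod z powr (2 * p)) \<in> borel_measurable lborel" by measurable
  have eM: "emeasure ?M {..t} = (if t < 0 then 0 else ennreal (pi * t powr (1 / p)))" for t
  proof (cases "t < 0")
    case True
    have "\<not> cmod z powr (2 * p) \<le> t" for z :: complex
      using True powr_ge_zero[of "cmod z" "2 * p"] by linarith
    then have "(\<lambda>z::complex. cmod z powr (2 * p)) -` {..t} = {}" by auto
    then show ?thesis using True by (subst emeasure_distr[OF m]) auto
  next
    case False
    then have t: "t \<ge> 0" by simp
    have "cmod z powr (2 * p) \<le> t \<longleftrightarrow> cmod z \<le> t powr (1 / (2 * p))" for z
    proof
      assume "cmod z powr (2 * p) \<le> t"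
      then have "(cmod z powr (2 * p)) powr (1 / (2 * p)) \<le> t powr (1 / (2 * p))"
        using p by (intro powr_mono2) auto
      then show "cmod z \<le> t powr (1 / (2 * p))" using p by (simp add: powr_powr)
    next
      assume "cmod z \<le> t powr (1 / (2 * p))"
      then have "cmod z powr (2 * p) \<le> (t powr (1 / (2 * p))) powr (2 * p)"
        using p by (intro powr_mono2) auto
      then show "cmod z powr (2 * p) \<le> t" using p t by (simp add: powr_powr)
    qed
    then have "(\<lambda>z::complex. cmod z powr (2 * p)) -` {..t} = cball 0 (t powr (1 / (2 * p)))" by (auto simp: dist_norm)
    then have "emeasure ?M {..t} = emeasure lborel (cball (0::complex) (t powr (1 / (2 * p))))"
      by (subst emeasure_distr[OF m]) auto
    also have "\<dots> = ennreal (pi * (t powr (1 / (2 * p)))\<^sup>2)"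
      by (subst emeasure_cball) (auto simp: unit_ball_vol_2)
    also have "(t powr (1 / (2 * p)))\<^sup>2 = t powr (1 / p)"
      using p by (simp add: power2_eq_square powr_add[symmetric])
    finally show ?thesis using False by simp
  qed
  have eN: "emeasure ?N {..t} = (if t < 0 then 0 else ennreal (pi * t powr (1 / p)))" for t
  proof (cases "t < 0")
    case True
    have "emeasure ?N {..t} = (\<integral>\<^sup>+s. ennreal (pi / p * s powr (1 / p - 1)) * indicator {0..} s * indicator {..t} s \<partial>lborel)"
      by (rule emeasure_density) auto
    also have "\<dots> = (\<integral>\<^sup>+s. 0 \<partial>(lborel :: real measure))"
      by (intro nn_integral_cong) (use True in \<open>auto split: split_indicator\<close>)
    finally show ?thesis using True by simp
  next
    case False
    then have t: "t \<ge> 0" by simp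
    have "((\<lambda>s. s powr (1 / p - 1)) has_integral (t powr (1 / p - 1 + 1) / (1 / p - 1 + 1))) {0..t}"
      using p t by (intro has_integral_powr_from_0) auto
    from has_integral_mult_right[OF this, of "pi / p"]
    have hi: "((\<lambda>s. pi / p * s powr (1 / p - 1)) has_integral (pi * t powr (1 / p))) {0..t}"
      using p by simp
    have "emeasure ?N {..t} = (\<integral>\<^sup>+s. ennreal (pi / p * s powr (1 / p - 1)) * indicator {0..t} s \<partial>lborel)"
      by (subst emeasure_density) (auto intro!: nn_integral_cong split: split_indicator)
    also have "\<dots> = ennreal (pi * t powr (1 / p))"
      using p by (intro nn_integral_has_integral_lebesgue'[OF _ hi]) auto
    finally show ?thesis using False by simp
  qed
  show "emeasure ?M X = emeasure ?N X" if "X \<in> range atMost" for X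
    using that eM eN by auto
  show "emeasure ?M {..real i} \<noteq> \<infinity>" for i by (simp add: eM)
  show "Int_stable (range (atMost :: real \<Rightarrow> _))" by (auto simp: Int_stable_def)
  show "sets ?M = sigma_sets UNIV (range atMost)" "sets ?N = sigma_sets UNIV (range atMost)"
    by (simp_all add: borel_eq_atMost)
  show "(\<Union>i. {..real i}) = UNIV"
    using real_arch_simple by auto
qed auto

text \<open>Pushed forward along |z|^(2p) this is the Gamma integral. For p = m the values are the
  reciprocals of the Taylor coefficients of the kernel, which is why the kernel reproduces.\<close>

lemma nn_integral_moment:
  fixes p :: real
  assumes p: "p > 0"
  shows "(\<integral>\<^sup>+z. ennreal ((cmod z ^ k)\<^sup>2 * exp (- (cmod z powr (2 * p)))) \<partial>lborel) = ennreal (pi / p * Gamma (real (k + 1) / p))"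
proof -
  have m: "(\<lambda>z::complex. cmod z powr (2 * p)) \<in> borel_measurable lborel" by measurable
  \<comment> \<open>The case k = 0 is split off because \<open>0 powr 0\<close> is 0 whereas
    \<open>0 ^ 0\<close> is 1.\<close>
  have "(cmod z ^ k)\<^sup>2 = (if k = 0 then 1 else (cmod z powr (2 * p)) powr (k / p))" for z
    using p by (cases "cmod z = 0") (auto simp: powr_powr powr_realpow[symmetric] power2_eq_square powr_add[symmetric])
  then have "(\<integral>\<^sup>+z. ennreal ((cmod z ^ k)\<^sup>2 * exp (- (cmod z powr (2 * p)))) \<partial>lborel) =
     (\<integral>\<^sup>+z. (\<lambda>t. ennreal ((if k = 0 then 1 else t powr (k / p)) * exp (- t))) (cmod z powr (2 * p)) \<partial>lborel)"
    by simp
  also have "\<dots> = (\<integral>\<^sup>+t. ennreal ((if k = 0 then 1 else t powr (k / p)) * exp (- t)) \<partial>distr lborel borel (\<lambda>z::complex. cmod z powr (2 * p)))"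
    by (rule nn_integral_distr[OF m, symmetric]) measurable
  also have "\<dots> = (\<integral>\<^sup>+t. ennreal (pi / p * t powr (1 / p - 1)) * indicator {0..} t * ennreal ((if k = 0 then 1 else t powr (k / p)) * exp (- t)) \<partial>lborel)"
    unfolding distr_cmod_powr[OF p] by (rule nn_integral_density) auto
  also have "\<dots> = (\<integral>\<^sup>+t. ennreal (pi / p * (t powr (real (k + 1) / p - 1) / exp t)) * indicator {0..} t \<partial>lborel)"
  proof (intro nn_integral_cong)
    fix t :: real
    have "pi / p * t powr (1 / p - 1) * ((if k = 0 then 1 else t powr (k / p)) * exp (- t)) = pi / p * (t powr (real (k + 1) / p - 1) / exp t)" if "t \<ge> 0"
    proof -
      have "t powr (1 / p - 1) * (if k = 0 then 1 else t powr (k / p)) = t powr (real (k + 1) / p - 1)"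
        using that by (auto simp: powr_add[symmetric] add_divide_distrib algebra_simps)
      then show ?thesis by (simp add: exp_minus field_simps)
    qed
    then show "ennreal (pi / p * t powr (1 / p - 1)) * indicator {0..} t * ennreal ((if k = 0 then 1 else t powr (k / p)) * exp (- t)) =
      ennreal (pi / p * (t powr (real (k + 1) / p - 1) / exp t)) * indicator {0..} t"
      using p by (auto simp: ennreal_mult[symmetric] split: split_indicator)
  qed
  also have "\<dots> = ennreal (pi / p * Gamma (real (k + 1) / p))"
    using p by (intro nn_integral_has_integral_lebesgue' has_integral_mult_right Gamma_integral_real) auto
  finally show ?thesis .
qed

text \<open>After translation and scaling by 1/sqrt \<tau> the mass is the moment with p = 1 and k =
  0.\<close>

lemma nn_integral_gaussian:
  assumes t: "\<tau> > 0"
  shows "(\<integral>\<^sup>+w. ennreal (exp (- (\<tau> * (cmod (z - w))\<^sup>2))) \<partial>lborel) = ennreal (pi / \<tau>)"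
proof -
  define c where "c = 1 / sqrt \<tau>"
  have c: "c \<noteq> 0" and c2: "c\<^sup>2 = 1 / \<tau>" using t by (auto simp: c_def power_divide)
  have "(\<integral>\<^sup>+w. ennreal (exp (- (\<tau> * (cmod (z - w))\<^sup>2))) \<partial>lborel) =
    (\<integral>\<^sup>+w. ennreal (1 / \<tau>) * ennreal (exp (- (\<tau> * (cmod (z - (z + c *\<^sub>R w)))\<^sup>2))) \<partial>lborel)"
    by (subst lborel_affine[OF c, of z], subst nn_integral_density, simp, simp, subst nn_integral_distr)
       (use t in \<open>auto simp: c2 power_abs[symmetric]\<close>)
  also have "\<dots> = (\<integral>\<^sup>+w. ennreal (1 / \<tau>) * ennreal (exp (- (cmod w)\<^sup>2)) \<partial>lborel)"
    using t by (intro nn_integral_cong) (simp add: power_mult_distrib c2)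
  also have "\<dots> = ennreal (1 / \<tau>) * (\<integral>\<^sup>+w. ennreal (exp (- (cmod w)\<^sup>2)) \<partial>(lborel :: complex measure))"
    by (rule nn_integral_cmult) auto
  also have "(\<integral>\<^sup>+w. ennreal (exp (- (cmod w)\<^sup>2)) \<partial>(lborel :: complex measure)) = ennreal pi"
    using nn_integral_moment[of 1 0] Gamma_fact[of 0, where 'a=real] by simp
  finally show ?thesis using t by (simp add: ennreal_mult[symmetric])
qed

section \<open>The reproducing formula\<close>

lemma continuous_on_fock_weight:
  assumes "m > 0"
  shows "continuous_on A (fock_weight m)"
  unfolding fock_weight_def[abs_def] using assms by (intro continuous_intros continuous_on_powr') auto

lemma borel_measurable_fock_weight [measurable]: "fock_weight m \<in> borel_measurable borel"
  unfolding fock_weight_def[abs_def] by measurable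

lemma fock_weight_pos [simp]: "fock_weight m z > 0" and fock_weight_nonneg [simp]: "fock_weight m z \<ge> 0"
  by (auto simp: fock_weight_def)

lemma fock_kernel_eq_ml: "fock_kernel m z w = of_real (m / pi) * ml m (z * cnj w)"
  by (simp add: fock_kernel_def ml_def)

lemma ml_sums:
  assumes "m \<ge> 1"
  shows "(\<lambda>k. (1 / of_real (Gamma (real (k + 1) / m))) * z ^ k) sums ml m z"
  using summable_sums[OF summable_norm_cancel[OF norm_summable_ml[OF assms, of z]]] by (simp add: ml_def)

lemma ml_holomorphic_on:
  assumes "m \<ge> 1"
  shows "ml m holomorphic_on A"
proof -
  have "ml m holomorphic_on ball 0 r" for r
    by (rule power_series_holomorphic[where a = "\<lambda>k. 1 / of_real (Gamma (real (k + 1) / m))"])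
       (use ml_sums[OF assms] in simp)
  then have "ml m field_differentiable at z" for z
    using holomorphic_on_imp_differentiable_at[of "ml m" "ball 0 (norm z + 1)" z] by auto
  then show ?thesis by (simp add: holomorphic_on_def field_differentiable_at_within)
qed

lemma cnj_ml:
  assumes "m \<ge> 1"
  shows "cnj (ml m z) = ml m (cnj z)"
proof -
  have "(\<lambda>k. cnj ((1 / of_real (Gamma (real (k + 1) / m))) * z ^ k)) sums cnj (ml m z)"
    using ml_sums[OF assms, of z] by (rule sums_cnj[THEN iffD2])
  then have "(\<lambda>k. (1 / of_real (Gamma (real (k + 1) / m))) * cnj z ^ k) sums cnj (ml m z)" by simp
  then show ?thesis using ml_sums[OF assms, of "cnj z"] sums_unique2 by blast
qed

lemma cnj_fock_kernel:
  assumes "m \<ge> 1"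
  shows "cnj (fock_kernel m z w) = fock_kernel m w z"
  unfolding fock_kernel_eq_ml complex_cnj_mult cnj_ml[OF assms] complex_cnj_complex_of_real complex_cnj_cnj
  by (simp only: mult.commute)

lemma fock_kernel_holomorphic_on [holomorphic_intros]:
  assumes "m \<ge> 1"
  shows "(\<lambda>z. fock_kernel m z w) holomorphic_on A"
proof -
  have "(ml m \<circ> (\<lambda>z. z * cnj w)) holomorphic_on A"
    by (intro holomorphic_on_compose ml_holomorphic_on assms holomorphic_intros)
  then show ?thesis unfolding fock_kernel_eq_ml by (auto simp: o_def intro!: holomorphic_intros)
qed

lemma continuous_on_fock_kernel:
  assumes "m \<ge> 1"
  shows "continuous_on A (\<lambda>z. fock_kernel m z w)" "continuous_on A (\<lambda>w. fock_kernel m z w)"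
    "continuous_on B (\<lambda>p. fock_kernel m (fst p) (snd p))"
proof -
  have c: "continuous_on UNIV (ml m)"
    by (rule holomorphic_on_imp_continuous_on[OF ml_holomorphic_on[OF assms]])
  show "continuous_on A (\<lambda>z. fock_kernel m z w)" "continuous_on A (\<lambda>w. fock_kernel m z w)"
    "continuous_on B (\<lambda>p. fock_kernel m (fst p) (snd p))"
    unfolding fock_kernel_eq_ml
    by (intro continuous_intros continuous_on_compose2[OF c] | simp)+
qed

text \<open>On a bounded disc the terms are dominated by a convergent numerical series, which need
  not be so on the whole plane. The map \<open>p\<close> will be the identity for a Taylor series
  and conjugation for the kernel.\<close>

lemma integral_disc_power_series:
  fixes c :: "nat \<Rightarrow> complex"
  assumes c: "\<And>w. (\<lambda>k. c k * w ^ k) sums F w"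
    and p: "continuous_on UNIV p" "\<And>w. cmod (p w) = cmod w" and G: "continuous_on UNIV G"
  shows "(\<lambda>k. c k * (\<integral>w. indicator (cball 0 R) w *\<^sub>R (p w ^ k * G w) \<partial>lborel)) sums
     (\<integral>w. indicator (cball 0 R) w *\<^sub>R (F (p w) * G w) \<partial>lborel)"
proof (cases "R \<ge> 0")
  case False
  then have "indicator (cball 0 R) = (\<lambda>w::complex. 0 :: real)" by (auto simp: indicator_def)
  then show ?thesis by simp
next
  case R: True
  obtain B where B: "\<And>w. w \<in> cball 0 R \<Longrightarrow> norm (G w) \<le> B"
    using compact_imp_bounded[OF compact_continuous_image[OF continuous_on_subset[OF G subset_UNIV] compact_cball]]
    unfolding bounded_iff by blast
  have B0: "B \<ge> 0" using B[of 0] R order_trans[OF norm_ge_zero[of "G 0"]] by simp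
  let ?f = "\<lambda>k w. indicator (cball 0 R) w *\<^sub>R (c k * (p w ^ k * G w))"
  have s: "summable (\<lambda>k. norm (c k) * R ^ k)"
  proof -
    \<comment> \<open>Convergence at R + 1 forces absolute convergence at the smaller radius
      R.\<close>
    have "summable (\<lambda>k. c k * of_real (R + 1) ^ k)" using c by (auto simp: sums_iff)
    from powser_insidea[OF this, of "of_real R"] R show ?thesis by (simp add: norm_mult norm_power)
  qed
  have I: "integrable lborel (?f k)" for k
  proof (rule borel_integrable_compact[THEN Bochner_Integration.integrable_cong[THEN iffD1, rotated -1]])
    show "continuous_on (cball 0 R) (\<lambda>w. c k * (p w ^ k * G w))"
      by (intro continuous_intros continuous_on_subset[OF G] continuous_on_subset[OF p(1)]) auto
  qed (auto simp: indicator_def)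
  have fb: "norm (?f k w) \<le> norm (c k) * R ^ k * (B * indicator (cball 0 R) w)" for k w
  proof (cases "w \<in> cball 0 R")
    case True
    then have "norm (c k) * (norm (p w) ^ k * norm (G w)) \<le> norm (c k) * (R ^ k * B)"
      using B[OF True] p(2)[of w] by (intro mult_left_mono mult_mono power_mono) (auto simp: R)
    then show ?thesis using True by (simp add: norm_mult norm_power mult_ac)
  qed simp
  have Ib: "integrable lborel (\<lambda>w::complex. B * indicator (cball 0 R) w)"
    by (intro integrable_mult_right integrable_real_indicator) (use emeasure_lborel_cball_finite in \<open>auto simp: less_top\<close>)
  have A: "AE w in lborel. summable (\<lambda>k. norm (?f k w))"
  proof (rule AE_I2)
    fix w :: complex
    show "summable (\<lambda>k. norm (?f k w))"
      by (rule summable_comparison_test'[OF summable_mult2[OF s, of "B * indicator (cball 0 R) w"], of 0]) (use fb in simp)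
  qed
  have S: "summable (\<lambda>k. \<integral>w. norm (?f k w) \<partial>lborel)"
  proof (rule summable_comparison_test'[OF summable_mult2[OF s, of "\<integral>w. B * indicator (cball (0::complex) R) w \<partial>lborel"], of 0])
    fix k
    have "(\<integral>w. norm (?f k w) \<partial>lborel) \<le> (\<integral>w. norm (c k) * R ^ k * (B * indicator (cball (0::complex) R) w) \<partial>lborel)"
      by (rule Bochner_Integration.integral_mono[OF integrable_norm[OF I] integrable_mult_right[OF Ib] fb])
    also have "\<dots> = norm (c k) * R ^ k * (\<integral>w. B * indicator (cball (0::complex) R) w \<partial>lborel)"
      by (rule integral_mult_right_zero)
    finally show "norm (\<integral>w. norm (?f k w) \<partial>lborel) \<le> norm (c k) * R ^ k * (\<integral>w. B * indicator (cball (0::complex) R) w \<partial>lborel)"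
      unfolding real_norm_def by (subst abs_of_nonneg) (auto intro!: integral_nonneg_AE)
  qed
  have "(\<lambda>k. integral\<^sup>L lborel (?f k)) sums (\<integral>w. (\<Sum>k. ?f k w) \<partial>lborel)"
    by (rule sums_integral[OF I A S])
  moreover have "(\<Sum>k. ?f k w) = indicator (cball 0 R) w *\<^sub>R (F (p w) * G w)" for w
  proof -
    have "(\<lambda>k. (c k * p w ^ k) * (indicator (cball 0 R) w *\<^sub>R G w)) sums (F (p w) * (indicator (cball 0 R) w *\<^sub>R G w))"
      by (rule sums_mult2[OF c])
    then show ?thesis by (simp add: sums_iff mult_ac)
  qed
  moreover have "integral\<^sup>L lborel (?f k) = c k * (\<integral>w. indicator (cball 0 R) w *\<^sub>R (p w ^ k * G w) \<partial>lborel)" for k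
  proof -
    have "?f k = (\<lambda>w. c k * (indicator (cball 0 R) w *\<^sub>R (p w ^ k * G w)))"
      by (rule ext) (rule mult_scaleR_right[symmetric])
    then show ?thesis by (simp only: integral_mult_right_zero)
  qed
  ultimately show ?thesis by simp
qed

text \<open>Disc and weight are rotation invariant, and rotating by t multiplies the integral by
  cis((j-k)t). If this number is not 1, the integral vanishes.\<close>

lemma integral_disc_monomials:
  assumes m: "m > 0"
  shows "(\<integral>w. indicator (cball 0 R) w *\<^sub>R (w ^ j * (cnj w ^ k * of_real (fock_weight m w))) \<partial>lborel) =
    (if j = k then of_real (\<integral>w. indicator (cball 0 R) w * ((cmod w ^ k)\<^sup>2 * fock_weight m w) \<partial>lborel) else 0)"
proof (cases "j = k")
  case True
  have e: "w ^ k * (cnj w ^ k * of_real (fock_weight m w)) = of_real ((cmod w ^ k)\<^sup>2 * fock_weight m w)" for w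
    by (simp add: mult.assoc[symmetric] power_mult_distrib[symmetric] complex_norm_square[symmetric] power_mult[symmetric] mult.commute)
  have "(\<integral>w. indicator (cball 0 R) w *\<^sub>R (w ^ k * (cnj w ^ k * of_real (fock_weight m w))) \<partial>lborel) =
     (\<integral>w. of_real (indicator (cball 0 R) w * ((cmod w ^ k)\<^sup>2 * fock_weight m w)) \<partial>(lborel :: complex measure))"
    unfolding e by (simp only: of_real_mult scaleR_conv_of_real)
  also have "\<dots> = of_real (\<integral>w. indicator (cball 0 R) w * ((cmod w ^ k)\<^sup>2 * fock_weight m w) \<partial>(lborel :: complex measure))"
    by (rule integral_complex_of_real)
  finally show ?thesis unfolding True by (simp only: if_True simp_thms)
next
  case False
  let ?F = "\<lambda>w. indicator (cball 0 R) w *\<^sub>R (w ^ j * (cnj w ^ k * of_real (fock_weight m w)))"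
  have F[measurable]: "?F \<in> borel_measurable borel"
  proof -
    have "(\<lambda>w. w ^ j * (cnj w ^ k * of_real (fock_weight m w))) \<in> borel_measurable borel"
      using m by (intro borel_measurable_continuous_onI continuous_intros continuous_on_fock_weight)
    then show ?thesis by (intro borel_measurable_scaleR borel_measurable_indicator) auto
  qed
  \<comment> \<open>Small enough for |(j-k)t| < 1, so that cis((j-k)t) = 1 would force j = k; also 0
    < t \<le> 1, so sin t is nonzero as the rotation lemma demands.\<close>
  define t where "t = 1 / (1 + \<bar>real j - real k\<bar>)"
  define c where "c = cis t"
  have t: "0 < t" "t \<le> 1" by (auto simp: t_def)
  have s1: "sin t \<noteq> 0" using sin_gt_zero[of t] t pi_gt3 by auto
  have rot: "?F (c * w) = c ^ j * cnj c ^ k * ?F w" for w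
  proof -
    have "cmod (c * w) = cmod w" by (simp add: c_def norm_mult)
    then have "fock_weight m (c * w) = fock_weight m w" "indicator (cball 0 R) (c * w) = (indicator (cball 0 R) w :: real)"
      by (auto simp: fock_weight_def indicator_def dist_norm)
    then show ?thesis by (simp only: power_mult_distrib complex_cnj_mult) (simp only: mult_scaleR_right mult_ac)
  qed
  have "integral\<^sup>L lborel ?F = (\<integral>w. ?F (c * w) \<partial>lborel)"
    unfolding c_def by (rule integral_complex_rotate[OF F s1, symmetric])
  also have "\<dots> = c ^ j * cnj c ^ k * integral\<^sup>L lborel ?F"
    unfolding rot by (rule integral_mult_right_zero)
  finally have "integral\<^sup>L lborel ?F * (1 - c ^ j * cnj c ^ k) = 0" by (simp add: algebra_simps)
  moreover have "c ^ j * cnj c ^ k \<noteq> 1"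
  proof
    assume "c ^ j * cnj c ^ k = 1"
    moreover have "c ^ j * cnj c ^ k = cis ((real j - real k) * t)"
      unfolding c_def cis_cnj Complex.DeMoivre cis_mult by (simp add: algebra_simps)
    ultimately have "cos ((real j - real k) * t) = 1" by (simp add: complex_eq_iff)
    then obtain n :: int where n: "(real j - real k) * t = of_int n * 2 * pi"
      using cos_one_2pi_int by auto
    have "\<bar>(real j - real k) * t\<bar> < 1" by (simp add: t_def abs_mult)
    then have "\<bar>of_int n\<bar> * (2 * pi) < 1" unfolding n by (simp add: abs_mult)
    moreover have "\<bar>of_int n :: real\<bar> \<ge> 1" if "n \<noteq> 0" using that by linarith
    ultimately have "n = 0" using pi_gt3 mult_mono[of 1 "\<bar>of_int n :: real\<bar>" 1 "2 * pi"] by force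
    then show False using n t False by simp
  qed
  ultimately show ?thesis using False by auto
qed

lemma fock_reproducing:
  assumes m: "m \<ge> 1" and h: "h holomorphic_on UNIV"
    and int: "integrable lborel (\<lambda>w. h w * fock_kernel m a w * of_real (fock_weight m w))"
  shows "(\<integral>w. h w * fock_kernel m a w * of_real (fock_weight m w) \<partial>lborel) = h a"
proof -
  have m0: "m > 0" using m by simp
  define hc where "hc j = (deriv ^^ j) h 0 / fact j" for j
  have hs: "(\<lambda>j. hc j * w ^ j) sums h w" for w
    using holomorphic_power_series[OF holomorphic_on_subset[OF h], of 0 "norm w + 1" w] by (simp add: hc_def)
  have hcont: "continuous_on UNIV h" using h by (rule holomorphic_on_imp_continuous_on)
  have wcont: "continuous_on UNIV (fock_weight m)" by (rule continuous_on_fock_weight[OF m0])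
  define M where "M R k = (\<integral>w. indicator (cball 0 R) w * ((cmod w ^ k)\<^sup>2 * fock_weight m w) \<partial>lborel)" for R k
  define G where "G k = Gamma (real (k + 1) / m)" for k
  have G0: "G k > 0" for k using m by (simp add: G_def)
  \<comment> \<open>Orthogonality of monomials on the disc leaves only the k-th Taylor
    coefficient.\<close>
  have step1: "(\<integral>w. indicator (cball 0 R) w *\<^sub>R (cnj w ^ k * (h w * of_real (fock_weight m w))) \<partial>lborel) = hc k * of_real (M R k)" for R k
  proof -
    have "(\<lambda>j. hc j * (\<integral>w. indicator (cball 0 R) w *\<^sub>R (w ^ j * (cnj w ^ k * of_real (fock_weight m w))) \<partial>lborel)) sums
       (\<integral>w. indicator (cball 0 R) w *\<^sub>R (h w * (cnj w ^ k * of_real (fock_weight m w))) \<partial>lborel)"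
      by (rule integral_disc_power_series[OF hs]) (auto intro!: continuous_intros wcont)
    then have "(\<lambda>j. if j = k then hc j * of_real (M R k) else 0) sums
       (\<integral>w. indicator (cball 0 R) w *\<^sub>R (h w * (cnj w ^ k * of_real (fock_weight m w))) \<partial>lborel)"
      unfolding integral_disc_monomials[OF m0] M_def by (simp add: if_distrib[of "\<lambda>x. _ * x"] cong: if_cong)
    from sums_unique2[OF sums_single this] show ?thesis by (simp add: mult_ac)
  qed
  have step2: "(\<lambda>k. hc k * a ^ k * of_real (m / pi * M R k / G k)) sums
      (\<integral>w. indicator (cball 0 R) w *\<^sub>R (h w * fock_kernel m a w * of_real (fock_weight m w)) \<partial>lborel)" for R
  proof -
    have ks: "(\<lambda>k. (of_real (m / pi) * a ^ k / of_real (G k)) * w ^ k) sums (of_real (m / pi) * ml m (a * w))" for w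
      using sums_mult[OF ml_sums[OF m, of "a * w"], of "of_real (m / pi)"]
      by (simp add: G_def power_mult_distrib mult_ac)
    have "(\<lambda>k. (of_real (m / pi) * a ^ k / of_real (G k)) * (\<integral>w. indicator (cball 0 R) w *\<^sub>R (cnj w ^ k * (h w * of_real (fock_weight m w))) \<partial>lborel)) sums
       (\<integral>w. indicator (cball 0 R) w *\<^sub>R (of_real (m / pi) * ml m (a * cnj w) * (h w * of_real (fock_weight m w))) \<partial>lborel)"
      by (rule integral_disc_power_series[OF ks]) (auto intro!: continuous_intros wcont hcont)
    then show ?thesis unfolding step1 by (simp add: fock_kernel_eq_ml mult_ac)
  qed
  define I where "I = (\<integral>w. h w * fock_kernel m a w * of_real (fock_weight m w) \<partial>lborel)"
  have ev: "\<forall>\<^sub>F n in sequentially. w \<in> cball 0 (real n)" for w :: complex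
    using eventually_ge_at_top[of "nat \<lceil>norm w\<rceil>"] by eventually_elim (simp add: nat_le_iff ceiling_le_iff)
  have ind_lim: "(\<lambda>n. indicator (cball 0 (real n)) w *\<^sub>R X) \<longlonglongrightarrow> X" for w X :: complex
    using ev[of w] by (intro tendsto_eventually, elim eventually_mono) simp
  have ind_lim_real: "(\<lambda>n. indicator (cball 0 (real n)) w *\<^sub>R X) \<longlonglongrightarrow> X" for w :: complex and X :: real
    using ev[of w] by (intro tendsto_eventually, elim eventually_mono) simp
  have lim1: "(\<lambda>n. (\<integral>w. indicator (cball 0 (real n)) w *\<^sub>R (h w * fock_kernel m a w * of_real (fock_weight m w)) \<partial>lborel)) \<longlonglongrightarrow> I"
    unfolding I_def
  proof (rule integral_dominated_convergence[OF _ _ integrable_norm[OF int]])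
    show "(\<lambda>w. h w * fock_kernel m a w * of_real (fock_weight m w)) \<in> borel_measurable lborel"
      using int by auto
    then show "(\<lambda>w. indicator (cball 0 (real n)) w *\<^sub>R (h w * fock_kernel m a w * of_real (fock_weight m w))) \<in> borel_measurable lborel" for n
      by (intro borel_measurable_scaleR borel_measurable_indicator) auto
  qed (auto intro!: ind_lim split: split_indicator)
  have mom: "(\<integral>\<^sup>+w. ennreal ((cmod w ^ k)\<^sup>2 * fock_weight m w) \<partial>lborel) = ennreal (pi / m * G k)" for k
    using nn_integral_moment[OF m0, of k] by (simp add: fock_weight_def G_def)
  have Mi: "has_bochner_integral lborel (\<lambda>w. (cmod w ^ k)\<^sup>2 * fock_weight m w) (pi / m * G k)" for k
    using mom[of k] G0[of k] m by (intro has_bochner_integral_nn_integral) (auto intro: less_imp_le)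
  have Mle: "M R k \<le> pi / m * G k" and M0: "0 \<le> M R k" for R k
  proof -
    have "integrable lborel (\<lambda>w. (cmod w ^ k)\<^sup>2 * fock_weight m w)" using Mi[of k] by (simp add: has_bochner_integral_iff)
    from integral_mono[OF integrable_mult_indicator[OF _ this, of "cball 0 R"] this] Mi[of k]
    show "M R k \<le> pi / m * G k" unfolding M_def has_bochner_integral_iff by (simp add: indicator_def)
    show "0 \<le> M R k" unfolding M_def by (intro integral_nonneg_AE AE_I2) simp
  qed
  have Mlim: "(\<lambda>n. M (real n) k) \<longlonglongrightarrow> pi / m * G k" for k
  proof -
    have int: "integrable lborel (\<lambda>w. (cmod w ^ k)\<^sup>2 * fock_weight m w)" using Mi[of k] by (simp add: has_bochner_integral_iff)
    have "(\<lambda>n. (\<integral>w. indicator (cball 0 (real n)) w *\<^sub>R ((cmod w ^ k)\<^sup>2 * fock_weight m w) \<partial>lborel)) \<longlonglongrightarrow> (\<integral>w. (cmod w ^ k)\<^sup>2 * fock_weight m w \<partial>lborel)"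
    proof (rule integral_dominated_convergence[OF _ _ int])
      show "(\<lambda>w. (cmod w ^ k)\<^sup>2 * fock_weight m w) \<in> borel_measurable lborel" using int by auto
      then show "(\<lambda>w. indicator (cball 0 (real n)) w *\<^sub>R ((cmod w ^ k)\<^sup>2 * fock_weight m w)) \<in> borel_measurable lborel" for n
        by (intro borel_measurable_scaleR borel_measurable_indicator) auto
    qed (use ind_lim_real in \<open>auto split: split_indicator\<close>)
    then show ?thesis using Mi[of k] by (simp add: M_def has_bochner_integral_iff)
  qed
  have lim2: "(\<lambda>n. \<Sum>k. hc k * a ^ k * of_real (m / pi * M (real n) k / G k)) \<longlonglongrightarrow> (\<Sum>k. hc k * a ^ k * of_real (m / pi * (pi / m * G k) / G k))"
  proof (rule suminf_tendsto_dominated)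
    show "(\<lambda>n. hc k * a ^ k * of_real (m / pi * M (real n) k / G k)) \<longlonglongrightarrow> hc k * a ^ k * of_real (m / pi * (pi / m * G k) / G k)" for k
      by (intro tendsto_mult tendsto_const tendsto_of_real tendsto_divide Mlim) (use G0[of k] in simp)
    show "norm (hc k * a ^ k * of_real (m / pi * M (real n) k / G k)) \<le> norm (hc k * a ^ k)" for n k
    proof -
      have "m / pi * M (real n) k / G k \<le> 1"
        using Mle[of "real n" k] G0[of k] m by (simp add: field_simps)
      moreover have "m / pi * M (real n) k / G k \<ge> 0"
        using M0[of "real n" k] G0[of k] m by (intro divide_nonneg_nonneg mult_nonneg_nonneg) (auto intro: less_imp_le)
      ultimately show ?thesis unfolding norm_mult[of "hc k * a ^ k"] norm_of_real by (intro mult_left_le) auto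
    qed
    have "summable (\<lambda>k. hc k * of_real (norm a + 1) ^ k)" using hs[of "of_real (norm a + 1)"] by (simp add: sums_iff)
    then show "summable (\<lambda>k. norm (hc k * a ^ k))" by (rule powser_insidea) simp
  qed
  have "(\<Sum>k. hc k * a ^ k * of_real (m / pi * M (real n) k / G k)) =
     (\<integral>w. indicator (cball 0 (real n)) w *\<^sub>R (h w * fock_kernel m a w * of_real (fock_weight m w)) \<partial>lborel)" for n
    using step2[of "real n"] by (simp add: sums_iff)
  then have "I = (\<Sum>k. hc k * a ^ k * of_real (m / pi * (pi / m * G k) / G k))"
    using LIMSEQ_unique[OF lim1] lim2 by simp
  also have "\<dots> = (\<Sum>k. hc k * a ^ k)"
  proof -
    have "m / pi * (pi / m * G k) / G k = 1" for k using G0[of k] m by (simp add: field_simps)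
    then show ?thesis by simp
  qed
  also have "\<dots> = h a" using hs[of a] by (simp add: sums_iff)
  finally show ?thesis by (simp add: I_def)
qed

section \<open>Fock norms and Toeplitz operators on the kernel span\<close>

text \<open>The value \<open>\<infinity>\<close> is allowed, so that the estimates below need no integrability side conditions.\<close>

definition fock_norm_sq :: "real \<Rightarrow> (complex \<Rightarrow> complex) \<Rightarrow> ennreal" where
  "fock_norm_sq m f = (\<integral>\<^sup>+ z. ennreal ((cmod (f z))\<^sup>2 * fock_weight m z) \<partial>lborel)"

lemma fock_iff: "f \<in> fock m \<longleftrightarrow> f holomorphic_on UNIV \<and> fock_norm_sq m f < \<infinity>"
  by (simp add: fock_def fock_norm_sq_def)

lemma borel_measurable_holomorphic:
  "f holomorphic_on UNIV \<Longrightarrow> f \<in> borel_measurable borel"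
  by (intro borel_measurable_continuous_onI holomorphic_on_imp_continuous_on)

lemma borel_measurable_fock_kernel [measurable]:
  assumes "m \<ge> 1"
  shows "(\<lambda>z. fock_kernel m z w) \<in> borel_measurable borel" "(\<lambda>w. fock_kernel m z w) \<in> borel_measurable borel"
  by (intro borel_measurable_continuous_onI continuous_on_fock_kernel[OF assms])+

lemma fock_norm_sq_cmult:
  assumes [measurable]: "f \<in> borel_measurable borel"
  shows "fock_norm_sq m (\<lambda>z. c * f z) = ennreal ((cmod c)\<^sup>2) * fock_norm_sq m f"
proof -
  have "fock_norm_sq m (\<lambda>z. c * f z) = (\<integral>\<^sup>+ z. ennreal ((cmod c)\<^sup>2) * ennreal ((cmod (f z))\<^sup>2 * fock_weight m z) \<partial>lborel)"
    unfolding fock_norm_sq_def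
    by (intro nn_integral_cong) (simp add: norm_mult power_mult_distrib ennreal_mult[symmetric] mult_ac)
  also have "\<dots> = ennreal ((cmod c)\<^sup>2) * fock_norm_sq m f"
    unfolding fock_norm_sq_def by (rule nn_integral_cmult) measurable
  finally show ?thesis .
qed

lemma fock_norm_sq_eq:
  assumes "f \<in> borel_measurable borel" "fock_norm_sq m f < \<infinity>"
  shows "fock_norm_sq m f = ennreal ((fock_norm m f)\<^sup>2)"
proof -
  have "fock_norm_sq m f = ennreal (\<integral> z. (cmod (f z))\<^sup>2 * fock_weight m z \<partial>lborel)"
    unfolding fock_norm_sq_def
    by (rule nn_integral_eq_integral, rule integrableI_nonneg)
       (use assms in \<open>auto simp: fock_norm_sq_def\<close>)
  also have "(\<integral> z. (cmod (f z))\<^sup>2 * fock_weight m z \<partial>lborel) = (fock_norm m f)\<^sup>2"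
    unfolding fock_norm_def by (subst real_sqrt_pow2) (auto intro!: integral_nonneg_AE)
  finally show ?thesis .
qed

lemma fock_norm_nonneg: "fock_norm m f \<ge> 0"
  unfolding fock_norm_def by (auto intro!: integral_nonneg_AE)

lemma fock_norm_le_iff:
  assumes "f \<in> borel_measurable borel" "fock_norm_sq m f < \<infinity>" "c \<ge> 0"
  shows "fock_norm m f \<le> c \<longleftrightarrow> fock_norm_sq m f \<le> ennreal (c\<^sup>2)"
  unfolding fock_norm_sq_eq[OF assms(1,2)] using assms(3) fock_norm_nonneg[of m f]
  by (simp add: ennreal_le_iff abs_le_square_iff[symmetric])

lemma fock_integrable_mult:
  fixes f g :: "complex \<Rightarrow> complex"
  assumes [measurable]: "f \<in> borel_measurable borel" "g \<in> borel_measurable borel"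
    and fin: "fock_norm_sq m f < \<infinity>" "fock_norm_sq m g < \<infinity>"
  shows "integrable lborel (\<lambda>w. f w * g w * of_real (fock_weight m w))"
proof (rule integrableI_bounded)
  have "(\<integral>\<^sup>+w. ennreal (norm (f w * g w * of_real (fock_weight m w))) \<partial>lborel) \<le>
    (\<integral>\<^sup>+w. (ennreal ((cmod (f w))\<^sup>2 * fock_weight m w) + ennreal ((cmod (g w))\<^sup>2 * fock_weight m w)) \<partial>lborel)"
  proof (intro nn_integral_mono)
    fix w
    have "cmod (f w) * cmod (g w) \<le> (cmod (f w))\<^sup>2 + (cmod (g w))\<^sup>2"
      using sum_squares_bound[of "cmod (f w)" "cmod (g w)"] zero_le_power2[of "cmod (f w)"] zero_le_power2[of "cmod (g w)"]
      by linarith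
    then have "cmod (f w) * cmod (g w) * fock_weight m w \<le> ((cmod (f w))\<^sup>2 + (cmod (g w))\<^sup>2) * fock_weight m w"
      by (rule mult_right_mono) simp
    also have "\<dots> = (cmod (f w))\<^sup>2 * fock_weight m w + (cmod (g w))\<^sup>2 * fock_weight m w"
      by (rule distrib_right)
    also have "cmod (f w) * cmod (g w) * fock_weight m w = norm (f w * g w * of_real (fock_weight m w))"
      by (simp add: norm_mult)
    finally show "ennreal (norm (f w * g w * of_real (fock_weight m w))) \<le>
       ennreal ((cmod (f w))\<^sup>2 * fock_weight m w) + ennreal ((cmod (g w))\<^sup>2 * fock_weight m w)"
      by (simp only: ennreal_plus[symmetric] ennreal_leI mult_nonneg_nonneg zero_le_power2 fock_weight_nonneg)
  qed
  also have "\<dots> = fock_norm_sq m f + fock_norm_sq m g"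
    unfolding fock_norm_sq_def by (intro nn_integral_add) measurable
  also have "\<dots> < \<infinity>" using fin by simp
  finally show "(\<integral>\<^sup>+w. ennreal (norm (f w * g w * of_real (fock_weight m w))) \<partial>lborel) < \<infinity>" .
qed measurable

section \<open>Square integrability from growth bounds\<close>

text \<open>With t = |w|^m the weight is exp(-t^2). Half of its exponent absorbs exp(2 A t), and the
  other half is dominated by an ordinary Gaussian because |w|^2 \<le> t^2 + 1.\<close>

lemma fock_norm_sq_finite_of_growth:
  assumes m: "m \<ge> 1" and f: "\<And>w. cmod (f w) \<le> C * exp (A * cmod w powr m)" and A: "A \<ge> 0"
  shows "fock_norm_sq m f < \<infinity>"
proof -
  have C: "C \<ge> 0"
    using f[of 0] order_trans[OF norm_ge_zero] m by fastforce
  have "fock_norm_sq m f \<le> (\<integral>\<^sup>+w. ennreal (C\<^sup>2 * exp (2 * A\<^sup>2 + 1/2)) * ennreal (exp (- (1/2 * (cmod (0 - w))\<^sup>2))) \<partial>lborel)"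
    unfolding fock_norm_sq_def
  proof (intro nn_integral_mono)
    fix w :: complex
    define t where "t = cmod w powr m"
    have t: "cmod w powr (2 * m) = t\<^sup>2" by (simp add: t_def power2_eq_square powr_add[symmetric])
    have w: "(cmod w)\<^sup>2 \<le> t\<^sup>2 + 1"
    proof (cases "cmod w \<ge> 1")
      case True
      then have "cmod w powr 1 \<le> t" unfolding t_def using m by (intro powr_mono) auto
      then have "(cmod w)\<^sup>2 \<le> t\<^sup>2" using True by (intro power_mono) auto
      then show ?thesis by simp
    next
      case False
      then have "(cmod w)\<^sup>2 \<le> 1" by (simp add: power_le_one)
      then show ?thesis by (simp add: add_increasing)
    qed
    have "(cmod (f w))\<^sup>2 \<le> (C * exp (A * t))\<^sup>2" unfolding t_def by (intro power_mono f) auto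
    also have "\<dots> = C\<^sup>2 * exp (2 * A * t)" by (simp add: power_mult_distrib exp_double[symmetric] mult.assoc)
    finally have "(cmod (f w))\<^sup>2 * fock_weight m w \<le> C\<^sup>2 * exp (2 * A * t) * exp (- t\<^sup>2)"
      unfolding fock_weight_def t by (intro mult_right_mono) auto
    also have "\<dots> = C\<^sup>2 * exp (2 * A * t - t\<^sup>2)" by (simp add: exp_diff exp_minus field_simps)
    also have "\<dots> \<le> C\<^sup>2 * exp (2 * A\<^sup>2 + 1/2 - 1/2 * (cmod w)\<^sup>2)"
    proof -
      have "0 \<le> (t - 2 * A)\<^sup>2" by simp
      then have "2 * A * t - t\<^sup>2 \<le> 2 * A\<^sup>2 - t\<^sup>2 / 2" by (simp add: power2_eq_square algebra_simps)
      then have "2 * A * t - t\<^sup>2 \<le> 2 * A\<^sup>2 + 1/2 - 1/2 * (cmod w)\<^sup>2" using w by simp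
      then show ?thesis by (intro mult_left_mono) auto
    qed
    also have "\<dots> = C\<^sup>2 * exp (2 * A\<^sup>2 + 1/2) * exp (- (1/2 * (cmod (0 - w))\<^sup>2))"
      by (simp add: exp_add[symmetric])
    finally show "ennreal ((cmod (f w))\<^sup>2 * fock_weight m w) \<le>
        ennreal (C\<^sup>2 * exp (2 * A\<^sup>2 + 1/2)) * ennreal (exp (- (1/2 * (cmod (0 - w))\<^sup>2)))"
      by (subst ennreal_mult[symmetric]) (auto intro!: ennreal_leI)
  qed
  also have "\<dots> = ennreal (C\<^sup>2 * exp (2 * A\<^sup>2 + 1/2)) * (\<integral>\<^sup>+w. ennreal (exp (- (1/2 * (cmod (0 - w))\<^sup>2))) \<partial>lborel)"
    by (rule nn_integral_cmult) measurable
  also have "\<dots> < \<infinity>" by (subst nn_integral_gaussian) (auto simp: ennreal_mult[symmetric])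
  finally show ?thesis .
qed

lemma le_one_plus_powr:
  fixes x :: real
  assumes "m \<ge> 1" "x \<ge> 0"
  shows "x \<le> 1 + x powr m"
proof (cases "x \<ge> 1")
  case True
  then have "x powr 1 \<le> x powr m" using assms by (intro powr_mono) auto
  then show ?thesis using True by simp
qed (use assms in \<open>auto simp: add_increasing2\<close>)

text \<open>A cruder bound without polynomial factor, for the places where only the order x^m of log
  E counts.\<close>

lemma ml_real_growth:
  assumes m: "m \<ge> 1"
  obtains C where "C > 0" "\<And>x. x \<ge> 0 \<Longrightarrow> ml_real m x \<le> C * exp (m * x powr m)"
proof -
  obtain C where C: "C > 0" "\<And>x. x \<ge> 0 \<Longrightarrow> ml_real m x \<le> C * (1 + x) powr (m - 1) * exp (x powr m)"
    using ml_real_upper_bound[OF m] by blast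
  show ?thesis
  proof
    show "C * exp (m - 1) > 0" using C by simp
    fix x :: real assume x: "x \<ge> 0"
    have "(1 + x) powr (m - 1) \<le> exp x powr (m - 1)"
      using m x by (intro powr_mono2) auto
    also have "\<dots> = exp ((m - 1) * x)" by (simp add: powr_def)
    also have "\<dots> \<le> exp ((m - 1) * (1 + x powr m))"
      using le_one_plus_powr[OF m x] m by (auto intro!: mult_left_mono)
    finally have "C * (1 + x) powr (m - 1) * exp (x powr m) \<le> C * exp ((m - 1) * (1 + x powr m)) * exp (x powr m)"
      using C by (intro mult_right_mono mult_left_mono) auto
    also have "\<dots> = C * exp (m - 1) * exp (m * x powr m)"
      by (simp add: exp_add[symmetric] algebra_simps)
    finally show "ml_real m x \<le> C * exp (m - 1) * exp (m * x powr m)"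
      using C(2)[OF x] by linarith
  qed
qed

lemma norm_fock_kernel_le:
  assumes m: "m \<ge> 1"
  shows "cmod (fock_kernel m z w) \<le> m / pi * ml_real m (max (Re (z * cnj w)) 0)"
  unfolding fock_kernel_eq_ml norm_mult norm_of_real using m
  by (intro mult_mono norm_ml_le) auto

lemma norm_fock_kernel_growth:
  assumes m: "m \<ge> 1"
  obtains C where "C > 0" "\<And>z w. cmod (fock_kernel m z w) \<le> C * exp (m * cmod w powr m * cmod z powr m)"
proof -
  obtain C where C: "C > 0" "\<And>x. x \<ge> 0 \<Longrightarrow> ml_real m x \<le> C * exp (m * x powr m)"
    using ml_real_growth[OF m] by blast
  show ?thesis
  proof
    show "m / pi * C > 0" using m C by simp
    fix z w
    have "max (Re (z * cnj w)) 0 \<le> cmod z * cmod w"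
      using complex_Re_le_cmod[of "z * cnj w"] by (simp add: norm_mult)
    then have "ml_real m (max (Re (z * cnj w)) 0) \<le> ml_real m (cmod z * cmod w)"
      by (intro ml_real_mono m) auto
    also have "\<dots> \<le> C * exp (m * (cmod z * cmod w) powr m)" by (intro C) auto
    also have "m * (cmod z * cmod w) powr m = m * cmod w powr m * cmod z powr m" by (simp add: powr_mult)
    finally have "m / pi * ml_real m (max (Re (z * cnj w)) 0) \<le> m / pi * (C * exp (m * cmod w powr m * cmod z powr m))"
      using m by (intro mult_left_mono) auto
    with norm_fock_kernel_le[OF m, of z w]
    show "cmod (fock_kernel m z w) \<le> m / pi * C * exp (m * cmod w powr m * cmod z powr m)" by simp
  qed
qed

text \<open>Products of two kernels occur because in the integral for T_u K_a the square integrable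
  symbol u has to be paired with K_a times the conjugate of K_b.\<close>

lemma fock_norm_sq_kernel_mult_finite:
  assumes m: "m \<ge> 1"
  shows "fock_norm_sq m (\<lambda>z. fock_kernel m z a * fock_kernel m z b) < \<infinity>" "fock_norm_sq m (\<lambda>z. fock_kernel m z a) < \<infinity>"
proof -
  obtain C where C: "C > 0" "\<And>z w. cmod (fock_kernel m z w) \<le> C * exp (m * cmod w powr m * cmod z powr m)"
    using norm_fock_kernel_growth[OF m] by blast
  show "fock_norm_sq m (\<lambda>z. fock_kernel m z a) < \<infinity>"
    by (rule fock_norm_sq_finite_of_growth[OF m C(2)]) (use m in auto)
  show "fock_norm_sq m (\<lambda>z. fock_kernel m z a * fock_kernel m z b) < \<infinity>"
  proof (rule fock_norm_sq_finite_of_growth[OF m, where C = "C * C" and A = "m * cmod a powr m + m * cmod b powr m"])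
    fix z
    have "cmod (fock_kernel m z a * fock_kernel m z b) \<le> (C * exp (m * cmod a powr m * cmod z powr m)) * (C * exp (m * cmod b powr m * cmod z powr m))"
      unfolding norm_mult using C by (intro mult_mono) (auto intro: less_imp_le)
    also have "\<dots> = C * C * exp ((m * cmod a powr m + m * cmod b powr m) * cmod z powr m)"
      by (simp add: exp_add algebra_simps)
    finally show "cmod (fock_kernel m z a * fock_kernel m z b) \<le> C * C * exp ((m * cmod a powr m + m * cmod b powr m) * cmod z powr m)" .
  qed (use m in auto)
qed

section \<open>Point evaluations and the norm of the kernel\<close>

lemma fock_kernel_diag:
  assumes m: "m \<ge> 1"
  shows "fock_kernel m a a = of_real (m / pi * ml_real m ((cmod a)\<^sup>2))" "Re (fock_kernel m a a) > 0"
proof -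
  show *: "fock_kernel m a a = of_real (m / pi * ml_real m ((cmod a)\<^sup>2))"
    unfolding fock_kernel_eq_ml complex_norm_square[symmetric] of_real_power[symmetric] ml_of_real[OF m] by simp
  show "Re (fock_kernel m a a) > 0" unfolding * using m ml_real_pos[OF m, of "(cmod a)\<^sup>2"] by simp
qed

text \<open>The reproducing formula for K_a at the point a itself, where its integrand becomes
  |K_a|^2 times the weight.\<close>

lemma fock_norm_sq_kernel:
  assumes m: "m \<ge> 1"
  shows "fock_norm_sq m (\<lambda>z. fock_kernel m z a) = ennreal (Re (fock_kernel m a a))"
proof -
  let ?K = "\<lambda>z. fock_kernel m z a"
  have e: "?K w * fock_kernel m a w * of_real (fock_weight m w) = of_real ((cmod (?K w))\<^sup>2 * fock_weight m w)" for w
    unfolding cnj_fock_kernel[OF m, of w a, symmetric] by (simp only: of_real_mult complex_norm_square)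
  have fin: "fock_norm_sq m ?K < \<infinity>" by (rule fock_norm_sq_kernel_mult_finite[OF m])
  have int: "integrable lborel (\<lambda>w. (cmod (?K w))\<^sup>2 * fock_weight m w)"
    using fin m unfolding fock_norm_sq_def by (intro integrableI_nonneg) auto
  have "integrable lborel (\<lambda>w. ?K w * fock_kernel m a w * of_real (fock_weight m w))"
    unfolding e by (rule integrable_of_real[OF int])
  from fock_reproducing[OF m _ this]
  have "complex_of_real (\<integral>w. (cmod (?K w))\<^sup>2 * fock_weight m w \<partial>lborel) = fock_kernel m a a"
    unfolding e by (simp add: fock_kernel_holomorphic_on[OF m] del: of_real_mult of_real_power)
  then have "(\<integral>w. (cmod (?K w))\<^sup>2 * fock_weight m w \<partial>lborel) = Re (fock_kernel m a a)"
    by (metis Re_complex_of_real)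
  then show ?thesis
    unfolding fock_norm_sq_def using nn_integral_eq_integral[OF int] by simp
qed

text \<open>Cauchy-Schwarz in the reproducing formula. When the norm is infinite, so is the
  right-hand side, because K(b,b) > 0.\<close>

lemma fock_pointwise_bound:
  assumes m: "m \<ge> 1" and h: "h holomorphic_on UNIV"
  shows "ennreal ((cmod (h b))\<^sup>2) \<le> ennreal (Re (fock_kernel m b b)) * fock_norm_sq m h"
proof (cases "fock_norm_sq m h < \<infinity>")
  case False
  then have "fock_norm_sq m h = \<infinity>" by (simp add: not_less top_unique)
  then show ?thesis using fock_kernel_diag(2)[OF m, of b] by (simp add: ennreal_mult_top)
next
  case True
  have [measurable]: "h \<in> borel_measurable borel" by (rule borel_measurable_holomorphic[OF h])
  note [measurable] = borel_measurable_fock_kernel[OF m]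
  let ?K = "\<lambda>w. fock_kernel m b w"
  have nK: "cmod (fock_kernel m b w) = cmod (fock_kernel m w b)" for w
    using cnj_fock_kernel[OF m, of w b] complex_mod_cnj by metis
  have fK: "fock_norm_sq m ?K = ennreal (Re (fock_kernel m b b))"
    using fock_norm_sq_kernel[OF m, of b] unfolding fock_norm_sq_def nK .
  have int: "integrable lborel (\<lambda>w. h w * ?K w * of_real (fock_weight m w))"
    using True fK by (intro fock_integrable_mult) (auto simp: less_top)
  have "ennreal (cmod (h b)) \<le> (\<integral>\<^sup>+w. norm (h w * ?K w * of_real (fock_weight m w)) \<partial>lborel)"
    using integral_norm_bound_ennreal[OF int] fock_reproducing[OF m h int] by simp
  also have "\<dots> = (\<integral>\<^sup>+w. ennreal (cmod (?K w) * sqrt (fock_weight m w)) * ennreal (cmod (h w) * sqrt (fock_weight m w)) \<partial>lborel)"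
    by (intro nn_integral_cong) (simp add: ennreal_mult[symmetric] norm_mult mult_ac)
  finally have "(ennreal (cmod (h b)))\<^sup>2 \<le> (\<integral>\<^sup>+w. ennreal (cmod (?K w) * sqrt (fock_weight m w)) * ennreal (cmod (h w) * sqrt (fock_weight m w)) \<partial>lborel)\<^sup>2"
    by (rule power_mono) simp
  also have "\<dots> \<le> (\<integral>\<^sup>+w. (ennreal (cmod (?K w) * sqrt (fock_weight m w)))\<^sup>2 \<partial>lborel) * (\<integral>\<^sup>+w. (ennreal (cmod (h w) * sqrt (fock_weight m w)))\<^sup>2 \<partial>lborel)"
    by (rule Cauchy_Schwarz_nn_integral) measurable
  also have "\<dots> = fock_norm_sq m ?K * fock_norm_sq m h"
    unfolding fock_norm_sq_def by (simp add: ennreal_power power_mult_distrib)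
  finally show ?thesis unfolding fK by (simp add: ennreal_power)
qed

text \<open>The pointwise bound for h = K_b; restricted to a ray it becomes the convexity of
  \<open>log_ml\<close>.\<close>

lemma norm_fock_kernel_sq_le:
  assumes m: "m \<ge> 1"
  shows "(cmod (fock_kernel m a b))\<^sup>2 \<le> Re (fock_kernel m a a) * Re (fock_kernel m b b)"
proof -
  have "ennreal ((cmod (fock_kernel m a b))\<^sup>2) \<le> ennreal (Re (fock_kernel m a a) * Re (fock_kernel m b b))"
    using fock_pointwise_bound[OF m fock_kernel_holomorphic_on[OF m], of a b] fock_kernel_diag(2)[OF m]
    unfolding fock_norm_sq_kernel[OF m] by (simp add: ennreal_mult[symmetric] less_imp_le)
  then show ?thesis using fock_kernel_diag(2)[OF m] by (subst (asm) ennreal_le_iff) (auto intro: less_imp_le)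
qed

section \<open>Toeplitz operators on the span of the kernel functions\<close>

lemma kernel_span_induct [consumes 1, case_names zero add]:
  assumes "f \<in> kernel_span m" "P (\<lambda>_. 0)"
    and "\<And>f a w. f \<in> kernel_span m \<Longrightarrow> P f \<Longrightarrow> P (\<lambda>z. f z + a * fock_kernel m z w)"
  shows "P f"
proof -
  from assms(1) obtain n a w where f: "f = (\<lambda>z. \<Sum>i<(n::nat). a i * fock_kernel m z (w i))"
    by (auto simp: kernel_span_def)
  have "P (\<lambda>z. \<Sum>i<n. a i * fock_kernel m z (w i))"
  proof (induction n)
    case (Suc n)
    have "(\<lambda>z. \<Sum>i<n. a i * fock_kernel m z (w i)) \<in> kernel_span m" by (auto simp: kernel_span_def)
    from assms(3)[OF this Suc] show ?case by simp
  qed (use assms(2) in simp)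
  then show ?thesis by (simp add: f)
qed

lemma kernel_in_kernel_span: "(\<lambda>z. fock_kernel m z a) \<in> kernel_span m"
  unfolding kernel_span_def by (rule CollectI) (rule exI[of _ 1], rule exI[of _ "\<lambda>_. 1"], rule exI[of _ "\<lambda>_. a"], simp)

lemma kernel_span_holomorphic:
  assumes "m \<ge> 1" "f \<in> kernel_span m"
  shows "f holomorphic_on UNIV"
  using assms(2) by (induction rule: kernel_span_induct) (auto intro!: holomorphic_intros assms(1))

lemma fock_norm_sq_add:
  assumes [measurable]: "f \<in> borel_measurable borel" "g \<in> borel_measurable borel"
  shows "fock_norm_sq m (\<lambda>z. f z + g z) \<le> 2 * fock_norm_sq m f + 2 * fock_norm_sq m g"
proof -
  have "fock_norm_sq m (\<lambda>z. f z + g z) \<le> (\<integral>\<^sup>+ z. 2 * ennreal ((cmod (f z))\<^sup>2 * fock_weight m z) + 2 * ennreal ((cmod (g z))\<^sup>2 * fock_weight m z) \<partial>lborel)"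
    unfolding fock_norm_sq_def
  proof (intro nn_integral_mono)
    fix z
    have "(cmod (f z + g z))\<^sup>2 \<le> (cmod (f z) + cmod (g z))\<^sup>2" by (intro power_mono norm_triangle_ineq) auto
    also have "\<dots> \<le> 2 * (cmod (f z))\<^sup>2 + 2 * (cmod (g z))\<^sup>2"
      using sum_squares_bound[of "cmod (f z)" "cmod (g z)"] by (simp add: power2_sum)
    finally have "(cmod (f z + g z))\<^sup>2 * fock_weight m z \<le> (2 * (cmod (f z))\<^sup>2 + 2 * (cmod (g z))\<^sup>2) * fock_weight m z"
      by (rule mult_right_mono) simp
    also have "\<dots> = 2 * ((cmod (f z))\<^sup>2 * fock_weight m z) + 2 * ((cmod (g z))\<^sup>2 * fock_weight m z)" by (simp add: algebra_simps)
    finally have "ennreal ((cmod (f z + g z))\<^sup>2 * fock_weight m z) \<le> ennreal (2 * ((cmod (f z))\<^sup>2 * fock_weight m z) + 2 * ((cmod (g z))\<^sup>2 * fock_weight m z))"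
      by (rule ennreal_leI)
    also have "\<dots> = 2 * ennreal ((cmod (f z))\<^sup>2 * fock_weight m z) + 2 * ennreal ((cmod (g z))\<^sup>2 * fock_weight m z)"
      by (simp add: ennreal_plus ennreal_mult)
    finally show "ennreal ((cmod (f z + g z))\<^sup>2 * fock_weight m z) \<le> 2 * ennreal ((cmod (f z))\<^sup>2 * fock_weight m z) + 2 * ennreal ((cmod (g z))\<^sup>2 * fock_weight m z)" .
  qed
  also have "\<dots> = 2 * fock_norm_sq m f + 2 * fock_norm_sq m g"
    unfolding fock_norm_sq_def by (subst nn_integral_add) (auto simp: nn_integral_cmult)
  finally show ?thesis .
qed

lemma kernel_span_norm_finite:
  assumes m: "m \<ge> 1" and "f \<in> kernel_span m"
  shows "fock_norm_sq m f < \<infinity>" "fock_norm_sq m (\<lambda>w. f w * fock_kernel m w b) < \<infinity>"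
proof -
  \<comment> \<open>One induction serves both claims: \<open>c\<close> is the constant 1 or the
    kernel at b.\<close>
  have "fock_norm_sq m (\<lambda>w. f w * c w) < \<infinity>" if c: "c \<in> borel_measurable borel"
    "\<And>a. fock_norm_sq m (\<lambda>w. fock_kernel m w a * c w) < \<infinity>" for c
    using assms(2)
  proof (induction rule: kernel_span_induct)
    case zero
    then show ?case by (simp add: fock_norm_sq_def)
  next
    case (add f a w)
    have [measurable]: "f \<in> borel_measurable borel" "c \<in> borel_measurable borel"
      using kernel_span_holomorphic[OF m add.hyps] c(1) by (auto intro: borel_measurable_holomorphic)
    note [measurable] = borel_measurable_fock_kernel[OF m]
    have "fock_norm_sq m (\<lambda>z. (f z + a * fock_kernel m z w) * c z) = fock_norm_sq m (\<lambda>z. f z * c z + a * (fock_kernel m z w * c z))"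
      by (simp add: algebra_simps)
    also have "\<dots> \<le> 2 * fock_norm_sq m (\<lambda>z. f z * c z) + 2 * fock_norm_sq m (\<lambda>z. a * (fock_kernel m z w * c z))"
      by (rule fock_norm_sq_add) measurable
    also have "fock_norm_sq m (\<lambda>z. a * (fock_kernel m z w * c z)) = ennreal ((cmod a)\<^sup>2) * fock_norm_sq m (\<lambda>z. fock_kernel m z w * c z)"
      by (rule fock_norm_sq_cmult) measurable
    also have "2 * fock_norm_sq m (\<lambda>z. f z * c z) + 2 * \<dots> < \<infinity>"
      using add.IH c(2)[of w] by (auto simp: ennreal_mult_less_top ennreal_numeral_less_top)
    finally show ?case .
  qed
  from this[of "\<lambda>_. 1"] this[of "\<lambda>w. fock_kernel m w b"]
  show "fock_norm_sq m f < \<infinity>" "fock_norm_sq m (\<lambda>w. f w * fock_kernel m w b) < \<infinity>"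
    using fock_norm_sq_kernel_mult_finite[OF m] borel_measurable_fock_kernel[OF m] by auto
qed

text \<open>$u K_z$ need not be square integrable, but $u K_z \overline{K_a}$ is integrable, which is all
  that the reproducing formula asks for.\<close>

lemma toeplitz_analytic_symbol:
  assumes m: "m \<ge> 1" and u: "u \<in> fock m" and f: "f \<in> kernel_span m"
  shows "toeplitz m u f = (\<lambda>z. u z * f z)"
    and "integrable lborel (\<lambda>w. u w * f w * fock_kernel m z w * of_real (fock_weight m w))"
proof -
  have hu: "u holomorphic_on UNIV" and nu: "fock_norm_sq m u < \<infinity>" using u by (auto simp: fock_iff)
  have hf: "f holomorphic_on UNIV" by (rule kernel_span_holomorphic[OF m f])
  have [measurable]: "u \<in> borel_measurable borel" "f \<in> borel_measurable borel" using hu hf by (auto intro: borel_measurable_holomorphic)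
  note [measurable] = borel_measurable_fock_kernel[OF m]
  have nK: "cmod (fock_kernel m b w) = cmod (fock_kernel m w b)" for w b
    using cnj_fock_kernel[OF m, of w b] complex_mod_cnj by metis
  have int: "integrable lborel (\<lambda>w. u w * f w * fock_kernel m z w * of_real (fock_weight m w))" for z
  proof -
    have "fock_norm_sq m (\<lambda>w. f w * fock_kernel m z w) = fock_norm_sq m (\<lambda>w. f w * fock_kernel m w z)"
      unfolding fock_norm_sq_def norm_mult nK[of z] ..
    then have "integrable lborel (\<lambda>w. u w * (f w * fock_kernel m z w) * of_real (fock_weight m w))"
      using kernel_span_norm_finite(2)[OF m f, of z] nu by (intro fock_integrable_mult) auto
    then show ?thesis by (simp add: mult.assoc)
  qed
  then show "integrable lborel (\<lambda>w. u w * f w * fock_kernel m z w * of_real (fock_weight m w))" .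
  show "toeplitz m u f = (\<lambda>z. u z * f z)"
  proof
    fix z
    have "(\<integral>w. (u w * f w) * fock_kernel m z w * of_real (fock_weight m w) \<partial>lborel) = u z * f z"
      by (rule fock_reproducing[OF m _ int]) (intro holomorphic_intros hu hf)
    then show "toeplitz m u f z = u z * f z" by (simp add: toeplitz_def mult_ac)
  qed
qed

text \<open>Conjugating the integrand exchanges the roles of z and a and produces T_v K_z evaluated
  at a, which the analytic case gives as v(a) K(a,z). Hence kernels are eigenvectors and their span
  is invariant.\<close>

lemma toeplitz_conj_symbol:
  assumes m: "m \<ge> 1" and v: "v \<in> fock m" and f: "f \<in> kernel_span m"
  shows "toeplitz m (\<lambda>w. cnj (v w)) f \<in> kernel_span m"
    and "integrable lborel (\<lambda>w. fock_kernel m z w * cnj (v w) * f w * of_real (fock_weight m w))"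
    and "toeplitz m (\<lambda>w. cnj (v w)) (\<lambda>z. fock_kernel m z a) = (\<lambda>z. cnj (v a) * fock_kernel m z a)"
proof -
  have int1: "integrable lborel (\<lambda>w. fock_kernel m z w * cnj (v w) * fock_kernel m w a * of_real (fock_weight m w))"
    and val1: "(\<integral>w. fock_kernel m z w * cnj (v w) * fock_kernel m w a * of_real (fock_weight m w) \<partial>lborel) = cnj (v a) * fock_kernel m z a" for z a
  proof -
    have e: "fock_kernel m z w * cnj (v w) * fock_kernel m w a * of_real (fock_weight m w) =
      cnj (v w * fock_kernel m w z * fock_kernel m a w * of_real (fock_weight m w))" for w
      by (simp add: cnj_fock_kernel[OF m] mult_ac)
    have "integrable lborel (\<lambda>w. v w * fock_kernel m w z * fock_kernel m a w * of_real (fock_weight m w))"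
      by (rule toeplitz_analytic_symbol(2)[OF m v kernel_in_kernel_span])
    then show "integrable lborel (\<lambda>w. fock_kernel m z w * cnj (v w) * fock_kernel m w a * of_real (fock_weight m w))"
      unfolding e by (rule integrable_cnj)
    have "toeplitz m v (\<lambda>w. fock_kernel m w z) a = v a * fock_kernel m a z"
      using toeplitz_analytic_symbol(1)[OF m v kernel_in_kernel_span, of z] by (rule fun_cong)
    then have "(\<integral>w. v w * fock_kernel m w z * fock_kernel m a w * of_real (fock_weight m w) \<partial>lborel) = v a * fock_kernel m a z"
      by (simp add: toeplitz_def mult_ac)
    then have "cnj (\<integral>w. v w * fock_kernel m w z * fock_kernel m a w * of_real (fock_weight m w) \<partial>lborel) = cnj (v a) * fock_kernel m z a"
      by (simp add: cnj_fock_kernel[OF m])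
    then show "(\<integral>w. fock_kernel m z w * cnj (v w) * fock_kernel m w a * of_real (fock_weight m w) \<partial>lborel) = cnj (v a) * fock_kernel m z a"
      unfolding e Bochner_Integration.integral_cnj .
  qed
  from f obtain n c b where f: "f = (\<lambda>z. \<Sum>i<(n::nat). c i * fock_kernel m z (b i))" by (auto simp: kernel_span_def)
  have e: "fock_kernel m z w * cnj (v w) * f w * of_real (fock_weight m w) =
    (\<Sum>i<n. c i * (fock_kernel m z w * cnj (v w) * fock_kernel m w (b i) * of_real (fock_weight m w)))" for z w
    by (simp add: f sum_distrib_left sum_distrib_right mult_ac)
  show "integrable lborel (\<lambda>w. fock_kernel m z w * cnj (v w) * f w * of_real (fock_weight m w))"
    unfolding e by (intro Bochner_Integration.integrable_sum integrable_mult_right int1)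
  have "toeplitz m (\<lambda>w. cnj (v w)) f = (\<lambda>z. \<Sum>i<n. (c i * cnj (v (b i))) * fock_kernel m z (b i))"
  proof
    fix z
    have "toeplitz m (\<lambda>w. cnj (v w)) f z = (\<Sum>i<n. c i * (cnj (v (b i)) * fock_kernel m z (b i)))"
      unfolding toeplitz_def e
      by (subst Bochner_Integration.integral_sum) (auto intro!: int1 sum.cong simp: val1)
    then show "toeplitz m (\<lambda>w. cnj (v w)) f z = (\<Sum>i<n. (c i * cnj (v (b i))) * fock_kernel m z (b i))"
      by (simp add: mult.assoc)
  qed
  then show "toeplitz m (\<lambda>w. cnj (v w)) f \<in> kernel_span m"
    unfolding kernel_span_def by (intro CollectI exI)
  show "toeplitz m (\<lambda>w. cnj (v w)) (\<lambda>z. fock_kernel m z a) = (\<lambda>z. cnj (v a) * fock_kernel m z a)"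
    unfolding toeplitz_def using val1 by (intro ext)
qed

lemma toeplitz_prod_eq:
  assumes "m \<ge> 1" "u \<in> fock m" "v \<in> fock m" "f \<in> kernel_span m"
  shows "toeplitz_prod m u v f = (\<lambda>z. u z * toeplitz m (\<lambda>w. cnj (v w)) f z)"
  unfolding toeplitz_prod_def
  by (rule toeplitz_analytic_symbol(1)[OF assms(1,2) toeplitz_conj_symbol(1)[OF assms(1,3,4)]])

section \<open>Gaussian decay of the twisted kernel\<close>

lemma powr_mean_le:
  fixes x y m :: real
  assumes "m \<ge> 1" "x \<ge> 0" "y \<ge> 0"
  shows "((x + y) / 2) powr m \<le> (x powr m + y powr m) / 2"
proof (cases "x = 0 \<or> y = 0")
  case True
  have h: "(t / 2) powr m \<le> t powr m / 2" if "t \<ge> 0" for t :: real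
  proof -
    have "(1/2) powr m \<le> (1/2::real) powr 1" using assms by (intro powr_mono') auto
    then have "t powr m * (1/2) powr m \<le> t powr m * (1/2)" by (intro mult_left_mono) auto
    then show ?thesis by (simp add: powr_mult[symmetric])
  qed
  show ?thesis using True h[OF assms(2)] h[OF assms(3)] assms by auto
next
  case False
  then have "x > 0" "y > 0" using assms by auto
  then show ?thesis
    using convex_onD[OF powr_convex[OF assms(1)], of "1/2" x y] by (simp add: field_simps)
qed

text \<open>Re(z cnj w) = S - \<delta>^2/2 with \<delta> = |z - w|. Weakening 1/2 to 1/4 pays for
  the positive part, as the parallelogram law gives \<delta>^2 \<le> 4 S. Then p^m \<le> p S^(m-1)
  \<le> S^m - S^(m-1) \<delta>^2/4, and convexity of the m-th power bounds S^m by the mean of the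
  two weight exponents.\<close>

lemma gaussian_exponent_le:
  fixes m :: real and z w :: complex
  defines "S \<equiv> ((cmod z)\<^sup>2 + (cmod w)\<^sup>2) / 2"
  defines "p \<equiv> max (Re (z * cnj w)) 0"
  assumes m: "m \<ge> 1"
  shows "p powr m - (cmod z powr (2 * m) + cmod w powr (2 * m)) / 2 \<le> - (S powr (m - 1) * (cmod (z - w))\<^sup>2 / 4)"
    and "p \<le> S" and "(cmod (z - w))\<^sup>2 \<le> 4 * S" and "S \<ge> 0"
proof -
  define \<delta> where "\<delta> = cmod (z - w)"
  show S0: "S \<ge> 0" by (simp add: S_def)
  have re: "Re (z * cnj w) = S - \<delta>\<^sup>2 / 2"
    unfolding S_def \<delta>_def cmod_power2 by (simp add: power2_eq_square field_simps)
  have d: "\<delta>\<^sup>2 \<le> 4 * S"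
  proof -
    have "(cmod (z + w))\<^sup>2 + \<delta>\<^sup>2 = 4 * S"
      unfolding S_def \<delta>_def cmod_power2 by (simp add: power2_eq_square field_simps)
    then show ?thesis using zero_le_power2[of "cmod (z + w)"] by linarith
  qed
  then show "(cmod (z - w))\<^sup>2 \<le> 4 * S" by (simp add: \<delta>_def)
  have pd: "p \<le> S - \<delta>\<^sup>2 / 4" using d re zero_le_power2[of \<delta>] by (simp add: p_def)
  then show pS: "p \<le> S" using zero_le_power2[of \<delta>] by linarith
  have p0: "p \<ge> 0" by (simp add: p_def)
  have split: "x powr m = x * x powr (m - 1)" if "x \<ge> 0" for x :: real
    using that by (cases "x = 0") (simp_all add: powr_diff)
  have "p powr m \<le> p * S powr (m - 1)"
    unfolding split[OF p0] using p0 pS m by (intro mult_left_mono powr_mono2) auto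
  also have "\<dots> \<le> (S - \<delta>\<^sup>2 / 4) * S powr (m - 1)" using pd by (intro mult_right_mono) auto
  also have "\<dots> = S powr m - S powr (m - 1) * \<delta>\<^sup>2 / 4" unfolding split[OF S0] by (simp add: algebra_simps)
  also have "S powr m \<le> (((cmod z)\<^sup>2) powr m + ((cmod w)\<^sup>2) powr m) / 2"
    unfolding S_def by (intro powr_mean_le m) auto
  also have "\<dots> = (cmod z powr (2 * m) + cmod w powr (2 * m)) / 2"
  proof -
    have "(x\<^sup>2) powr m = x powr (2 * m)" if "x \<ge> 0" for x :: real
    proof -
      have "x\<^sup>2 = x powr 2" using that by simp
      then show ?thesis by (simp only: powr_powr)
    qed
    from this[OF norm_ge_zero[of z]] this[OF norm_ge_zero[of w]] show ?thesis by (simp only:)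
  qed
  finally show "p powr m - (cmod z powr (2 * m) + cmod w powr (2 * m)) / 2 \<le> - (S powr (m - 1) * (cmod (z - w))\<^sup>2 / 4)"
    by (simp add: \<delta>_def)
qed

lemma norm_power_diff_le:
  fixes z w :: complex
  assumes "cmod z \<le> M" "cmod w \<le> M"
  shows "cmod (z ^ Suc k - w ^ Suc k) \<le> real (Suc k) * M ^ k * cmod (z - w)"
proof (induction k)
  case (Suc k)
  have M: "M \<ge> 0" using assms(1) norm_ge_zero order_trans by blast
  have "z ^ Suc (Suc k) - w ^ Suc (Suc k) = z * (z ^ Suc k - w ^ Suc k) + w ^ Suc k * (z - w)"
    by (simp add: algebra_simps)
  then have "cmod (z ^ Suc (Suc k) - w ^ Suc (Suc k)) \<le> cmod z * cmod (z ^ Suc k - w ^ Suc k) + cmod w ^ Suc k * cmod (z - w)"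
    by (metis norm_mult norm_power norm_triangle_ineq)
  also have "\<dots> \<le> M * (real (Suc k) * M ^ k * cmod (z - w)) + M ^ Suc k * cmod (z - w)"
    using assms M Suc by (intro add_mono mult_mono power_mono) auto
  also have "\<dots> = real (Suc (Suc k)) * M ^ Suc k * cmod (z - w)" by (simp add: algebra_simps)
  finally show ?case .
qed simp

lemma H2_norm_sq_nonneg: "H2_norm_sq g \<ge> 0"
  by (simp add: H2_norm_sq_def sum_nonneg)

lemma norm_coeff_le_H2_norm: "cmod (coeff g k) \<le> sqrt (H2_norm_sq g)"
proof (cases "k \<le> degree g")
  case True
  then have "(cmod (coeff g k))\<^sup>2 \<le> H2_norm_sq g"
    unfolding H2_norm_sq_def by (intro member_le_sum) auto
  then show ?thesis by (simp add: real_le_rsqrt)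
qed (simp add: coeff_eq_0 H2_norm_sq_nonneg)

text \<open>The degree condition matters here: for 1 \<le> k \<le> m the monomial z^k has difference
  at most k M^(k-1) |z - w|, with M the larger modulus, and M^(k-1) is at most the square root of (1
  + 2S)^(m-1). That is the scale of the Gaussian decay. There are at most m + 1 monomials.\<close>

lemma norm_poly_diff_le:
  fixes g :: "complex poly" and m :: real
  defines "S \<equiv> \<lambda>z w. ((cmod z)\<^sup>2 + (cmod w)\<^sup>2) / 2"
  assumes m: "m \<ge> 1" and g: "real (degree g) \<le> m"
  shows "cmod (poly g z - poly g w) \<le> (m + 1) * m * sqrt (H2_norm_sq g) * cmod (z - w) * sqrt ((1 + 2 * S z w) powr (m - 1))"
proof -
  define s where "s = sqrt (H2_norm_sq g)"
  define Q where "Q = sqrt ((1 + 2 * S z w) powr (m - 1))"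
  define M where "M = max (cmod z) (cmod w)"
  have s0: "s \<ge> 0" by (simp add: s_def H2_norm_sq_nonneg)
  have Q0: "Q \<ge> 0" by (simp add: Q_def)
  have M0: "M \<ge> 0" by (simp add: M_def max.coboundedI1)
  have M2: "M\<^sup>2 \<le> 2 * S z w"
    by (auto simp: M_def S_def max_def)
  have one: "1 \<le> 1 + 2 * S z w" by (simp add: S_def)
  have MQ: "M ^ k \<le> Q" if "real (Suc k) \<le> m" for k
  proof -
    have "(M ^ k)\<^sup>2 = (M\<^sup>2) ^ k" by (simp add: power_mult[symmetric] mult.commute)
    also have "\<dots> \<le> (1 + 2 * S z w) ^ k" using M2 by (intro power_mono) auto
    also have "\<dots> = (1 + 2 * S z w) powr real k" using one by (simp add: powr_realpow)
    also have "\<dots> \<le> (1 + 2 * S z w) powr (m - 1)" using one that by (intro powr_mono) auto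
    finally show ?thesis unfolding Q_def by (rule real_le_rsqrt)
  qed
  have "poly g z - poly g w = (\<Sum>k\<le>degree g. coeff g k * (z ^ k - w ^ k))"
    by (simp add: poly_altdef sum_subtractf algebra_simps)
  also have "cmod \<dots> \<le> (\<Sum>k\<le>degree g. s * (m * Q * cmod (z - w)))"
  proof (intro sum_norm_le)
    fix k assume k: "k \<in> {..degree g}"
    have "cmod (z ^ k - w ^ k) \<le> m * Q * cmod (z - w)"
    proof (cases k)
      case 0
      then show ?thesis using Q0 m by simp
    next
      case (Suc l)
      have l: "real (Suc l) \<le> m" using k g Suc by simp
      have "cmod (z ^ k - w ^ k) \<le> real (Suc l) * M ^ l * cmod (z - w)"
        unfolding Suc by (rule norm_power_diff_le) (auto simp: M_def)
      also have "\<dots> \<le> m * Q * cmod (z - w)"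
        using l MQ[OF l] M0 m by (intro mult_right_mono mult_mono) auto
      finally show ?thesis .
    qed
    then show "cmod (coeff g k * (z ^ k - w ^ k)) \<le> s * (m * Q * cmod (z - w))"
      unfolding norm_mult using norm_coeff_le_H2_norm[of g k] s0 by (intro mult_mono) (auto simp: s_def)
  qed
  also have "\<dots> = real (degree g + 1) * (s * (m * Q * cmod (z - w)))" by simp
  also have "\<dots> \<le> (m + 1) * (s * (m * Q * cmod (z - w)))"
    using g s0 Q0 m by (intro mult_right_mono mult_nonneg_nonneg) auto
  finally show ?thesis by (simp add: s_def Q_def mult_ac)
qed

lemma powr_le_exp_linear:
  fixes q \<kappa> :: real
  assumes "q \<ge> 0" "\<kappa> > 0"
  obtains C where "C > 0" "\<And>x. x \<ge> 0 \<Longrightarrow> (1 + x) powr q \<le> C * exp (\<kappa> * x)"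
proof -
  \<comment> \<open>t \<le> 1 gives t(1 + x) \<le> 1 + t x, and t q \<le> \<kappa> keeps the final
    exponent small; q + 1 in the denominator covers q = 0.\<close>
  define t where "t = min 1 (\<kappa> / (q + 1))"
  have t: "t > 0" "t \<le> 1" using assms by (auto simp: t_def)
  have "t \<le> \<kappa> / (q + 1)" by (simp add: t_def)
  then have "t * (q + 1) \<le> \<kappa>" using assms by (simp add: pos_le_divide_eq)
  then have tq: "t * q \<le> \<kappa>" using t by (simp add: distrib_left)
  show ?thesis
  proof
    show "(1 / t) powr q > 0" using t by simp
    fix x :: real assume x: "x \<ge> 0"
    have "t * (1 + x) \<le> 1 + t * x" using t x by (simp add: distrib_left)
    also have "\<dots> \<le> exp (t * x)" by simp
    finally have "1 + x \<le> (1 / t) * exp (t * x)" using t by (simp add: field_simps)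
    then have "(1 + x) powr q \<le> ((1 / t) * exp (t * x)) powr q" using x assms by (intro powr_mono2) auto
    also have "\<dots> = (1 / t) powr q * exp (t * q * x)"
      by (subst powr_mult) (simp add: exp_powr_real mult_ac)
    also have "\<dots> \<le> (1 / t) powr q * exp (\<kappa> * x)"
      using mult_right_mono[OF tq x] by (intro mult_left_mono) auto
    finally show "(1 + x) powr q \<le> (1 / t) powr q * exp (\<kappa> * x)" .
  qed
qed

text \<open>Locally near $z$ the weight looks like a Gaussian of width $|z|^{1-m}$; the bound trades the
  $w$-dependent width for one depending on $z$ alone, at the price of a constant.\<close>

definition local_scale :: "real \<Rightarrow> complex \<Rightarrow> real" where
  "local_scale m z = ((max 1 (cmod z))\<^sup>2 / 2) powr (m - 1)"

lemma local_gaussian_bound: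
  fixes m :: real
  assumes m: "m \<ge> 1"
  obtains C where "C > 0" "\<And>z w. (1 + ((cmod z)\<^sup>2 + (cmod w)\<^sup>2) / 2) powr (m - 1) *
      exp (- ((((cmod z)\<^sup>2 + (cmod w)\<^sup>2) / 2) powr (m - 1) * (cmod (z - w))\<^sup>2 / 8))
      \<le> C * (local_scale m z * exp (- (local_scale m z / 16 * (cmod (z - w))\<^sup>2)))"
proof -
  \<comment> \<open>\<open>\<tau>0\<close> is the least possible local scale. The constant
    \<open>C0\<close> is chosen so that a polynomial factor in |z - w|^2 costs only exp(\<tau>0 |z -
    w|^2 / 16), half of the decay at hand.\<close>
  define \<tau>0 where "\<tau>0 = (1/2::real) powr (m - 1)"
  have t0: "\<tau>0 > 0" by (simp add: \<tau>0_def)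
  obtain C0 where C0: "C0 > 0" "\<And>x. x \<ge> 0 \<Longrightarrow> (1 + x) powr (m - 1) \<le> C0 * exp (\<tau>0 / 16 * x)"
    using powr_le_exp_linear[of "m - 1" "\<tau>0 / 16"] m t0 by auto
  \<comment> \<open>One summand for each of the cases S < 1/2 and S \<ge> 1/2.\<close>
  define C where "C = 3 powr (m - 1) * exp 1 + 5 powr (m - 1) * C0"
  show ?thesis
  proof
    show "C > 0" using C0 by (auto simp: C_def intro!: add_pos_pos)
    fix z w
    define S where "S = ((cmod z)\<^sup>2 + (cmod w)\<^sup>2) / 2"
    define \<delta> where "\<delta> = cmod (z - w)"
    define R where "R = max 1 (cmod z)"
    define \<tau> where "\<tau> = local_scale m z"
    have \<tau>: "\<tau> = (R\<^sup>2 / 2) powr (m - 1)" by (simp add: \<tau>_def R_def local_scale_def)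
    have R1: "R \<ge> 1" "R\<^sup>2 \<ge> 1" by (auto simp: R_def one_le_power)
    have S0: "S \<ge> 0" by (simp add: S_def)
    have d4: "\<delta>\<^sup>2 \<le> 4 * S" using gaussian_exponent_le(3)[OF m, of z w] by (simp add: S_def \<delta>_def)
    have \<tau>ge: "\<tau> \<ge> \<tau>0" unfolding \<tau> \<tau>0_def using R1 m by (intro powr_mono2) auto
    have goal: "(1 + S) powr (m - 1) * exp (- (S powr (m - 1) * \<delta>\<^sup>2 / 8)) \<le> C * (\<tau> * exp (- (\<tau> / 16 * \<delta>\<^sup>2)))"
    proof (cases "S < 1/2")
      case True
      \<comment> \<open>Near the origin the scale takes its least value and \<delta>^2 \<le> 4 S <
        2, so everything is comparable to a constant.\<close>
      have "(cmod z)\<^sup>2 \<le> 2 * S" by (simp add: S_def)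
      then have "(cmod z)\<^sup>2 \<le> 1\<^sup>2" using True by simp
      then have "cmod z \<le> 1" by (rule power2_le_imp_le) simp
      then have "\<tau> = \<tau>0" by (simp add: \<tau> \<tau>0_def R_def)
      have \<tau>1: "\<tau>0 \<le> 1" unfolding \<tau>0_def using m by (intro powr_le1) auto
      have "(1 + S) powr (m - 1) * exp (- (S powr (m - 1) * \<delta>\<^sup>2 / 8)) \<le> (3 / 2) powr (m - 1) * 1"
        using True S0 m by (intro mult_mono powr_mono2) auto
      also have "\<dots> = 3 powr (m - 1) * \<tau>0" by (simp add: \<tau>0_def powr_mult[symmetric])
      also have "\<dots> \<le> 3 powr (m - 1) * \<tau>0 * (exp 1 * exp (- (\<tau> / 16 * \<delta>\<^sup>2)))"
      proof -
        have "\<tau> / 16 * \<delta>\<^sup>2 \<le> 1 * 2 / 16" using \<tau>1 t0 d4 True unfolding \<open>\<tau> = \<tau>0\<close>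
          using mult_mono[of \<tau>0 1 "\<delta>\<^sup>2" 2] by simp
        then have "1 \<le> exp 1 * exp (- (\<tau> / 16 * \<delta>\<^sup>2))" unfolding exp_add[symmetric] by simp
        then show ?thesis using t0 mult_left_mono[of 1 _ "3 powr (m - 1) * \<tau>0"] by simp
      qed
      also have "\<dots> = 3 powr (m - 1) * exp 1 * (\<tau> * exp (- (\<tau> / 16 * \<delta>\<^sup>2)))" using \<open>\<tau> = \<tau>0\<close> by simp
      also have "\<dots> \<le> C * (\<tau> * exp (- (\<tau> / 16 * \<delta>\<^sup>2)))"
        unfolding C_def using C0(1) t0 \<tau>ge by (intro mult_right_mono) auto
      finally show ?thesis .
    next
      case False
      \<comment> \<open>Decay at the scale S is at least as fast as at the scale \<tau>, while 1 + S
        exceeds R^2 by at most a constant times 1 + \<delta>^2.\<close>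
      have "R\<^sup>2 / 2 \<le> S" using False by (auto simp: R_def S_def max_def)
      then have \<tau>S: "\<tau> \<le> S powr (m - 1)" unfolding \<tau> using m by (intro powr_mono2) auto
      have "cmod w \<le> cmod z + \<delta>" unfolding \<delta>_def using norm_triangle_ineq4[of z "z - w"] by simp
      then have "cmod w \<le> R + \<delta>" by (simp add: R_def)
      then have "(cmod w)\<^sup>2 \<le> (R + \<delta>)\<^sup>2" by (intro power_mono) auto
      also have "\<dots> \<le> 2 * R\<^sup>2 + 2 * \<delta>\<^sup>2" using sum_squares_bound[of R \<delta>] by (simp add: power2_sum)
      finally have wR: "(cmod w)\<^sup>2 \<le> 2 * R\<^sup>2 + 2 * \<delta>\<^sup>2" .
      have "(cmod z)\<^sup>2 \<le> R\<^sup>2" by (intro power_mono) (auto simp: R_def)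
      with wR have "1 + S \<le> 5 / 2 * R\<^sup>2 + \<delta>\<^sup>2"
      proof -
        have "1 + (x + y) / 2 \<le> 5 / 2 * r + d" if "y \<le> 2 * r + 2 * d" "x \<le> r" "1 \<le> r" for x y r d :: real
          using that by (simp add: field_simps)
        then show "(cmod w)\<^sup>2 \<le> 2 * R\<^sup>2 + 2 * \<delta>\<^sup>2 \<Longrightarrow> (cmod z)\<^sup>2 \<le> R\<^sup>2 \<Longrightarrow> 1 + S \<le> 5 / 2 * R\<^sup>2 + \<delta>\<^sup>2"
          using R1(2) unfolding S_def by blast
      qed
      also have "\<dots> \<le> 5 * (R\<^sup>2 / 2) * (1 + \<delta>\<^sup>2)"
      proof -
        have "1 * \<delta>\<^sup>2 \<le> R\<^sup>2 * \<delta>\<^sup>2" using R1 by (intro mult_right_mono) auto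
        moreover have "5 / 2 * r + d \<le> 5 * (r / 2) * (1 + d)" if "1 * d \<le> r * d" "0 \<le> r * d" for r d :: real
          using that by (simp add: algebra_simps)
        ultimately show ?thesis by simp
      qed
      finally have "(1 + S) powr (m - 1) \<le> (5 * (R\<^sup>2 / 2) * (1 + \<delta>\<^sup>2)) powr (m - 1)"
        using S0 m by (intro powr_mono2) auto
      also have "\<dots> = 5 powr (m - 1) * \<tau> * (1 + \<delta>\<^sup>2) powr (m - 1)" unfolding \<tau> powr_mult ..
      also have "\<dots> \<le> 5 powr (m - 1) * \<tau> * (C0 * exp (\<tau>0 / 16 * \<delta>\<^sup>2))"
        using t0 \<tau>ge by (intro mult_left_mono C0) auto
      finally have "(1 + S) powr (m - 1) * exp (- (S powr (m - 1) * \<delta>\<^sup>2 / 8)) \<le>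
          5 powr (m - 1) * \<tau> * (C0 * exp (\<tau>0 / 16 * \<delta>\<^sup>2)) * exp (- (\<tau> * \<delta>\<^sup>2 / 8))"
        using \<tau>S C0(1) t0 \<tau>ge by (intro mult_mono) (auto intro!: mult_right_mono)
      also have "\<dots> = 5 powr (m - 1) * C0 * (\<tau> * exp (\<tau>0 / 16 * \<delta>\<^sup>2 - \<tau> * \<delta>\<^sup>2 / 8))"
        by (simp add: diff_conv_add_uminus exp_add del: add_uminus_conv_diff)
      also have "\<dots> \<le> 5 powr (m - 1) * C0 * (\<tau> * exp (- (\<tau> / 16 * \<delta>\<^sup>2)))"
        using C0 t0 \<tau>ge mult_right_mono[OF \<tau>ge, of "\<delta>\<^sup>2"]
        by (intro mult_left_mono) auto
      also have "\<dots> \<le> C * (\<tau> * exp (- (\<tau> / 16 * \<delta>\<^sup>2)))"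
        unfolding C_def using C0(1) t0 \<tau>ge by (intro mult_right_mono) auto
      finally show ?thesis .
    qed
    then show "(1 + ((cmod z)\<^sup>2 + (cmod w)\<^sup>2) / 2) powr (m - 1) *
      exp (- ((((cmod z)\<^sup>2 + (cmod w)\<^sup>2) / 2) powr (m - 1) * (cmod (z - w))\<^sup>2 / 8))
      \<le> C * (local_scale m z * exp (- (local_scale m z / 16 * (cmod (z - w))\<^sup>2)))"
      by (simp add: S_def \<delta>_def \<tau>_def)
  qed
qed

text \<open>Up to |c|, the modulus of the integral kernel of T after the isometry f -> f
  sqrt(weight) into unweighted L^2.\<close>

definition twisted_kernel :: "real \<Rightarrow> complex poly \<Rightarrow> complex \<Rightarrow> complex \<Rightarrow> real" where
  "twisted_kernel m g z w = exp (Re (poly g z) - Re (poly g w)) * cmod (fock_kernel m z w) *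
     (sqrt (fock_weight m z) * sqrt (fock_weight m w))"

text \<open>The twist costs an exponent linear in |z - w|, the kernel decays like a Gaussian with
  exponent 1/4 in the same scale. Half of that decay absorbs the twist at the price of a constant
  times the squared Hardy norm, the other half remains for integration.\<close>

lemma twisted_kernel_bound:
  assumes m: "m \<ge> 1"
  obtains C1 C2 where "C1 > 0" "C2 > 0"
    "\<And>g z w. real (degree g) \<le> m \<Longrightarrow> twisted_kernel m g z w \<le>
       C1 * exp (C2 * H2_norm_sq g) * (local_scale m z * exp (- (local_scale m z / 16 * (cmod (z - w))\<^sup>2)))"
proof -
  obtain C0 where C0: "C0 > 0" "\<And>x. x \<ge> 0 \<Longrightarrow> ml_real m x \<le> C0 * (1 + x) powr (m - 1) * exp (x powr m)"
    using ml_real_upper_bound[OF m] by blast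
  obtain C3 where C3: "C3 > 0" "\<And>z w. (1 + ((cmod z)\<^sup>2 + (cmod w)\<^sup>2) / 2) powr (m - 1) *
      exp (- ((((cmod z)\<^sup>2 + (cmod w)\<^sup>2) / 2) powr (m - 1) * (cmod (z - w))\<^sup>2 / 8))
      \<le> C3 * (local_scale m z * exp (- (local_scale m z / 16 * (cmod (z - w))\<^sup>2)))"
    using local_gaussian_bound[OF m] by blast
  define L where "L = (m + 1) * m"
  \<comment> \<open>(1 + 2S)/4 \<le> S for S \<ge> 1/2, so \<open>\<eta>\<close> converts (1 +
    2S)^(m-1) into S^(m-1).\<close>
  define \<eta> where "\<eta> = (1/4::real) powr (m - 1)"
  have \<eta>: "0 < \<eta>" "\<eta> \<le> 1" using m by (auto simp: \<eta>_def powr_le1)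
  have L: "L > 0" using m by (simp add: L_def)
  show ?thesis
  proof
    show "m / pi * C0 * exp 1 * C3 > 0" using m C0 C3 by simp
    show "2 / \<eta> * L\<^sup>2 > 0" using \<eta> L by simp
    fix g :: "complex poly" and z w :: complex
    assume g: "real (degree g) \<le> m"
    define s where "s = sqrt (H2_norm_sq g)"
    have s: "s \<ge> 0" "s\<^sup>2 = H2_norm_sq g" by (auto simp: s_def H2_norm_sq_nonneg)
    define S where "S = ((cmod z)\<^sup>2 + (cmod w)\<^sup>2) / 2"
    define \<delta> where "\<delta> = cmod (z - w)"
    define p where "p = max (Re (z * cnj w)) 0"
    define Q where "Q = sqrt ((1 + 2 * S) powr (m - 1))"
    note ge = gaussian_exponent_le[OF m, of z w, folded S_def \<delta>_def p_def]
    have "Re (poly g z) - Re (poly g w) \<le> cmod (poly g z - poly g w)"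
      using complex_Re_le_cmod[of "poly g z - poly g w"] by simp
    also have "\<dots> \<le> L * s * \<delta> * Q"
      using norm_poly_diff_le[OF m g, of z w] by (simp add: L_def s_def \<delta>_def Q_def S_def)
    also have "\<dots> \<le> 1/8 * (\<eta> * (\<delta> * Q)\<^sup>2) + 2 / \<eta> * L\<^sup>2 * s\<^sup>2"
    proof -
      \<comment> \<open>The weight 4 is chosen so that the quadratic term has coefficient 1/8, half
        of the 1/4 in the kernel's decay.\<close>
      have "0 \<le> (\<eta> * (\<delta> * Q) - 4 * (L * s))\<^sup>2" by simp
      then have "8 * \<eta> * (L * s * (\<delta> * Q)) \<le> \<eta> * (\<eta> * (\<delta> * Q)\<^sup>2) + 16 * (L * s)\<^sup>2"
        by (simp add: power2_eq_square algebra_simps)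
      then have "8 * \<eta> * (L * s * (\<delta> * Q)) \<le> (8 * \<eta>) * (1/8 * (\<eta> * (\<delta> * Q)\<^sup>2) + 2 / \<eta> * L\<^sup>2 * s\<^sup>2)"
      proof -
        have "(8 * \<eta>) * (1/8 * X + 2 / \<eta> * L\<^sup>2 * s\<^sup>2) = \<eta> * X + 16 * (L * s)\<^sup>2" for X
          using \<eta> by (simp add: distrib_left power_mult_distrib)
        then show "8 * \<eta> * (L * s * (\<delta> * Q)) \<le> (8 * \<eta>) * (1/8 * (\<eta> * (\<delta> * Q)\<^sup>2) + 2 / \<eta> * L\<^sup>2 * s\<^sup>2)"
          if "8 * \<eta> * (L * s * (\<delta> * Q)) \<le> \<eta> * (\<eta> * (\<delta> * Q)\<^sup>2) + 16 * (L * s)\<^sup>2"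
          using that by (simp only:)
      qed
      then show ?thesis using \<eta> by (subst (asm) mult_le_cancel_left_pos) (auto simp: mult_ac)
    qed
    also have "1/8 * (\<eta> * (\<delta> * Q)\<^sup>2) \<le> S powr (m - 1) * \<delta>\<^sup>2 / 8 + 1"
    proof -
      have Q2: "Q\<^sup>2 = (1 + 2 * S) powr (m - 1)" by (simp add: Q_def)
      have "\<eta> * (\<delta> * Q)\<^sup>2 = \<delta>\<^sup>2 * ((1/4) * (1 + 2 * S)) powr (m - 1)"
        unfolding power_mult_distrib Q2 \<eta>_def powr_mult by simp
      \<comment> \<open>The summand 8 covers S < 1/2, where \<delta>^2 \<le> 4 S < 2; after division
        by 8 it becomes the factor exp 1 of the constant.\<close>
      also have "\<dots> \<le> \<delta>\<^sup>2 * S powr (m - 1) + 8"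
      proof (cases "S \<ge> 1/2")
        case True
        then have "((1/4) * (1 + 2 * S)) powr (m - 1) \<le> S powr (m - 1)" using m by (intro powr_mono2) auto
        then have "\<delta>\<^sup>2 * ((1/4) * (1 + 2 * S)) powr (m - 1) \<le> \<delta>\<^sup>2 * S powr (m - 1)" by (intro mult_left_mono) auto
        then show ?thesis by simp
      next
        case False
        then have "((1/4) * (1 + 2 * S)) powr (m - 1) \<le> 1" using m ge(4) by (intro powr_le1) auto
        then have "\<delta>\<^sup>2 * ((1/4) * (1 + 2 * S)) powr (m - 1) \<le> \<delta>\<^sup>2 * 1" by (intro mult_left_mono) auto
        also have "\<dots> \<le> 8" using ge(3) False by simp
        finally show ?thesis by (simp add: add_increasing)
      qed
      finally show ?thesis by (simp add: mult_ac)
    qed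
    finally have e1: "Re (poly g z) - Re (poly g w) \<le> S powr (m - 1) * \<delta>\<^sup>2 / 8 + 1 + 2 / \<eta> * L\<^sup>2 * H2_norm_sq g"
      by (simp add: s)
    have "cmod (fock_kernel m z w) \<le> m / pi * ml_real m p"
      unfolding p_def by (rule norm_fock_kernel_le[OF m])
    also have "\<dots> \<le> m / pi * (C0 * (1 + p) powr (m - 1) * exp (p powr m))"
      using m by (intro mult_left_mono C0) (auto simp: p_def)
    also have "\<dots> \<le> m / pi * (C0 * (1 + S) powr (m - 1) * exp (p powr m))"
      using m C0(1) ge(2) by (intro mult_left_mono mult_right_mono powr_mono2) (auto simp: p_def)
    finally have e2: "cmod (fock_kernel m z w) \<le> m / pi * C0 * (1 + S) powr (m - 1) * exp (p powr m)" by simp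
    have e3: "sqrt (fock_weight m z) * sqrt (fock_weight m w) = exp (- ((cmod z powr (2 * m) + cmod w powr (2 * m)) / 2))"
    proof -
      have sq: "sqrt (exp x) = exp (x / 2)" for x :: real
        by (rule real_sqrt_unique) (auto simp: exp_double[symmetric])
      show ?thesis unfolding fock_weight_def sq exp_add[symmetric] by (simp add: field_simps)
    qed
    have "twisted_kernel m g z w \<le> exp (S powr (m - 1) * \<delta>\<^sup>2 / 8 + 1 + 2 / \<eta> * L\<^sup>2 * H2_norm_sq g) *
       (m / pi * C0 * (1 + S) powr (m - 1) * exp (p powr m)) * exp (- ((cmod z powr (2 * m) + cmod w powr (2 * m)) / 2))"
      unfolding twisted_kernel_def e3 using e1 e2 by (intro mult_right_mono mult_mono) auto
    also have "\<dots> = m / pi * C0 * exp (2 / \<eta> * L\<^sup>2 * H2_norm_sq g) * (1 + S) powr (m - 1) *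
       exp (S powr (m - 1) * \<delta>\<^sup>2 / 8 + 1 + (p powr m - (cmod z powr (2 * m) + cmod w powr (2 * m)) / 2))"
      by (simp add: diff_conv_add_uminus exp_add mult_ac del: add_uminus_conv_diff)
    also have "\<dots> \<le> m / pi * C0 * exp (2 / \<eta> * L\<^sup>2 * H2_norm_sq g) * (1 + S) powr (m - 1) *
       exp (1 - S powr (m - 1) * \<delta>\<^sup>2 / 8)"
    proof -
      have "X / 8 + 1 + E \<le> 1 - X / 8" if "E \<le> - (X / 4)" for X E :: real using that by simp
      from this[OF ge(1)] show ?thesis using m C0(1) by (intro mult_left_mono) auto
    qed
    also have "\<dots> = m / pi * C0 * exp 1 * exp (2 / \<eta> * L\<^sup>2 * H2_norm_sq g) *
       ((1 + S) powr (m - 1) * exp (- (S powr (m - 1) * \<delta>\<^sup>2 / 8)))"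
      by (simp add: diff_conv_add_uminus exp_add mult_ac del: add_uminus_conv_diff)
    also have "\<dots> \<le> m / pi * C0 * exp 1 * exp (2 / \<eta> * L\<^sup>2 * H2_norm_sq g) *
       (C3 * (local_scale m z * exp (- (local_scale m z / 16 * \<delta>\<^sup>2))))"
      using C3(2)[of z w] m C0 unfolding S_def \<delta>_def by (intro mult_left_mono) auto
    finally show "twisted_kernel m g z w \<le> m / pi * C0 * exp 1 * C3 * exp (2 / \<eta> * L\<^sup>2 * H2_norm_sq g) *
       (local_scale m z * exp (- (local_scale m z / 16 * (cmod (z - w))\<^sup>2)))"
      by (simp add: \<delta>_def mult_ac)
  qed
qed

section \<open>Sufficiency by the Schur test\<close>

lemma twisted_kernel_measurable:
  assumes m: "m \<ge> 1"
  shows "(\<lambda>p. twisted_kernel m g (fst p) (snd p)) \<in> borel_measurable (lborel \<Otimes>\<^sub>M lborel)"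
proof -
  have "continuous_on UNIV (\<lambda>p. twisted_kernel m g (fst p) (snd p))"
    unfolding twisted_kernel_def using m
    by (intro continuous_intros continuous_on_fock_kernel continuous_on_compose2[OF continuous_on_fock_weight[of m UNIV]]) auto
  then show ?thesis unfolding lborel_prod by (simp add: borel_measurable_continuous_onI)
qed

lemma local_scale_pos: "local_scale m z > 0"
  by (simp add: local_scale_def)

lemma twisted_kernel_nonneg: "twisted_kernel m g z w \<ge> 0"
  by (simp add: twisted_kernel_def)

text \<open>Although the local scale depends on z alone, both marginals can be bounded: exchanging
  the variables amounts to passing to -g, with the same degree and Hardy norm.\<close>

lemma twisted_kernel_swap:
  assumes "m \<ge> 1"
  shows "twisted_kernel m g z w = twisted_kernel m (- g) w z"
proof -
  have "cmod (fock_kernel m z w) = cmod (fock_kernel m w z)"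
    using cnj_fock_kernel[OF assms, of z w] complex_mod_cnj by metis
  then show ?thesis by (simp add: twisted_kernel_def mult_ac)
qed

lemma H2_norm_sq_minus: "H2_norm_sq (- g) = H2_norm_sq g"
  by (simp add: H2_norm_sq_def)

text \<open>The Gaussian integrates to 16 \<pi>/\<tau>, cancelling the prefactor \<tau> =
  \<open>local_scale m z\<close>; this makes the bound uniform in z.\<close>

lemma nn_integral_twisted_kernel:
  assumes m: "m \<ge> 1"
  obtains C1 C2 where "C1 > 0" "C2 > 0"
    "\<And>g z. real (degree g) \<le> m \<Longrightarrow> (\<integral>\<^sup>+w. ennreal (twisted_kernel m g z w) \<partial>lborel) \<le> ennreal (C1 * exp (C2 * H2_norm_sq g))"
    "\<And>g w. real (degree g) \<le> m \<Longrightarrow> (\<integral>\<^sup>+z. ennreal (twisted_kernel m g z w) \<partial>lborel) \<le> ennreal (C1 * exp (C2 * H2_norm_sq g))"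
proof -
  obtain C1 C2 where C: "C1 > 0" "C2 > 0"
    "\<And>g z w. real (degree g) \<le> m \<Longrightarrow> twisted_kernel m g z w \<le>
       C1 * exp (C2 * H2_norm_sq g) * (local_scale m z * exp (- (local_scale m z / 16 * (cmod (z - w))\<^sup>2)))"
    using twisted_kernel_bound[OF m] by blast
  have 1: "(\<integral>\<^sup>+w. ennreal (twisted_kernel m g z w) \<partial>lborel) \<le> ennreal (C1 * 16 * pi * exp (C2 * H2_norm_sq g))"
    if g: "real (degree g) \<le> m" for g z
  proof -
    define \<tau> where "\<tau> = local_scale m z"
    have \<tau>: "\<tau> > 0" by (simp add: \<tau>_def local_scale_pos)
    have "(\<integral>\<^sup>+w. ennreal (twisted_kernel m g z w) \<partial>lborel) \<le>
       (\<integral>\<^sup>+w. ennreal (C1 * exp (C2 * H2_norm_sq g) * \<tau>) * ennreal (exp (- (\<tau> / 16 * (cmod (z - w))\<^sup>2))) \<partial>lborel)"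
      using C(3)[OF g, of z] C(1) \<tau>
      by (intro nn_integral_mono) (auto simp: \<tau>_def ennreal_mult[symmetric] mult_ac intro!: ennreal_leI)
    also have "\<dots> = ennreal (C1 * exp (C2 * H2_norm_sq g) * \<tau>) * (\<integral>\<^sup>+w. ennreal (exp (- (\<tau> / 16 * (cmod (z - w))\<^sup>2))) \<partial>lborel)"
      by (rule nn_integral_cmult) measurable
    also have "\<dots> = ennreal (C1 * exp (C2 * H2_norm_sq g) * \<tau>) * ennreal (pi / (\<tau> / 16))"
      using \<tau> by (subst nn_integral_gaussian) auto
    also have "\<dots> = ennreal (C1 * 16 * pi * exp (C2 * H2_norm_sq g))"
      using \<tau> C(1) by (subst ennreal_mult[symmetric]) (auto simp: mult_ac)
    finally show ?thesis .
  qed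
  show ?thesis
  proof
    show "C1 * 16 * pi > 0" "C2 > 0" using C by auto
    show "(\<integral>\<^sup>+w. ennreal (twisted_kernel m g z w) \<partial>lborel) \<le> ennreal (C1 * 16 * pi * exp (C2 * H2_norm_sq g))"
      if "real (degree g) \<le> m" for g z using 1[OF that] .
    show "(\<integral>\<^sup>+z. ennreal (twisted_kernel m g z w) \<partial>lborel) \<le> ennreal (C1 * 16 * pi * exp (C2 * H2_norm_sq g))"
      if "real (degree g) \<le> m" for g w
      using 1[of "- g" w] that unfolding twisted_kernel_swap[OF m, of g _ w] by (simp add: H2_norm_sq_minus)
  qed
qed

text \<open>Cauchy-Schwarz for the measure k(z,w) dw, then Tonelli. Row and column integrals share
  the bound M, so the constant test function suffices.\<close>

lemma schur_test:
  fixes k :: "'a::euclidean_space \<Rightarrow> 'a \<Rightarrow> ennreal" and F :: "'a \<Rightarrow> ennreal"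
  assumes k: "(\<lambda>p. k (fst p) (snd p)) \<in> borel_measurable (lborel \<Otimes>\<^sub>M lborel)"
    and F: "F \<in> borel_measurable borel"
    and M1: "\<And>z. (\<integral>\<^sup>+w. k z w \<partial>lborel) \<le> ennreal M" and M2: "\<And>w. (\<integral>\<^sup>+z. k z w \<partial>lborel) \<le> ennreal M"
    and M0: "M \<ge> 0" and fin: "\<And>z w. k z w < \<infinity>"
  shows "(\<integral>\<^sup>+z. (\<integral>\<^sup>+w. k z w * F w \<partial>lborel)\<^sup>2 \<partial>lborel) \<le> ennreal (M\<^sup>2) * (\<integral>\<^sup>+w. (F w)\<^sup>2 \<partial>lborel)"
proof -
  have k': "case_prod k \<in> borel_measurable (lborel \<Otimes>\<^sub>M lborel)" using k by (simp add: case_prod_unfold)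
  have mk[measurable]: "k z \<in> borel_measurable borel" for z
    using measurable_Pair2[OF k', of z] by simp
  have mkF: "(\<lambda>(z, w). k z w * (F w)\<^sup>2) \<in> borel_measurable (lborel \<Otimes>\<^sub>M lborel)"
    unfolding case_prod_unfold using k F by measurable
  \<comment> \<open>A square root on extended reals; it squares back to its argument only at finite
    values, hence \<open>fin\<close>.\<close>
  define s where "s x = ennreal (sqrt (enn2real x))" for x
  have s: "(s x)\<^sup>2 = x" if "x < \<infinity>" for x using that by (cases x) (auto simp: s_def ennreal_power)
  have ms[measurable]: "s \<in> borel_measurable borel" unfolding s_def[abs_def] by measurable
  note [measurable] = F
  have "(\<integral>\<^sup>+w. k z w * F w \<partial>lborel)\<^sup>2 \<le> ennreal M * (\<integral>\<^sup>+w. k z w * (F w)\<^sup>2 \<partial>lborel)" for z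
  proof -
    have ss: "s (k z w) * s (k z w) = k z w" for w using s[OF fin[of z w]] by (simp add: power2_eq_square)
    have "(\<integral>\<^sup>+w. k z w * F w \<partial>lborel)\<^sup>2 = (\<integral>\<^sup>+w. s (k z w) * (s (k z w) * F w) \<partial>lborel)\<^sup>2"
      by (simp add: mult.assoc[symmetric] ss)
    also have "\<dots> \<le> (\<integral>\<^sup>+w. (s (k z w))\<^sup>2 \<partial>lborel) * (\<integral>\<^sup>+w. (s (k z w) * F w)\<^sup>2 \<partial>lborel)"
      by (rule Cauchy_Schwarz_nn_integral) measurable
    also have "\<dots> = (\<integral>\<^sup>+w. k z w \<partial>lborel) * (\<integral>\<^sup>+w. k z w * (F w)\<^sup>2 \<partial>lborel)"
      by (simp add: power_mult_distrib s[OF fin])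
    also have "\<dots> \<le> ennreal M * (\<integral>\<^sup>+w. k z w * (F w)\<^sup>2 \<partial>lborel)"
      by (intro mult_right_mono M1) auto
    finally show ?thesis .
  qed
  then have "(\<integral>\<^sup>+z. (\<integral>\<^sup>+w. k z w * F w \<partial>lborel)\<^sup>2 \<partial>lborel) \<le> (\<integral>\<^sup>+z. ennreal M * (\<integral>\<^sup>+w. k z w * (F w)\<^sup>2 \<partial>lborel) \<partial>lborel)"
    by (intro nn_integral_mono)
  also have "\<dots> = ennreal M * (\<integral>\<^sup>+z. \<integral>\<^sup>+w. k z w * (F w)\<^sup>2 \<partial>lborel \<partial>lborel)"
    by (rule nn_integral_cmult) (use lborel.borel_measurable_nn_integral[OF mkF] in simp)
  also have "(\<integral>\<^sup>+z. \<integral>\<^sup>+w. k z w * (F w)\<^sup>2 \<partial>lborel \<partial>lborel) = (\<integral>\<^sup>+w. \<integral>\<^sup>+z. k z w * (F w)\<^sup>2 \<partial>lborel \<partial>lborel)"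
    using lborel_pair.Fubini'[OF mkF] by simp
  also have "\<dots> = (\<integral>\<^sup>+w. (\<integral>\<^sup>+z. k z w \<partial>lborel) * (F w)\<^sup>2 \<partial>lborel)"
  proof (intro nn_integral_cong nn_integral_multc)
    show "(\<lambda>z. k z w) \<in> borel_measurable lborel" for w using measurable_Pair1[OF k', of w] by simp
  qed
  also have "\<dots> \<le> (\<integral>\<^sup>+w. ennreal M * (F w)\<^sup>2 \<partial>lborel)"
    by (intro nn_integral_mono mult_right_mono M2) auto
  also have "\<dots> = ennreal M * (\<integral>\<^sup>+w. (F w)\<^sup>2 \<partial>lborel)" by (rule nn_integral_cmult) measurable
  also have "ennreal M * (ennreal M * (\<integral>\<^sup>+w. (F w)\<^sup>2 \<partial>lborel)) = ennreal (M\<^sup>2) * (\<integral>\<^sup>+w. (F w)\<^sup>2 \<partial>lborel)"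
    using M0 by (simp add: mult.assoc[symmetric] ennreal_mult[symmetric] power2_eq_square)
  finally show ?thesis by (simp add: mult_left_mono)
qed

text \<open>The exponent grows at most like |w|^m, against |w|^(2m) in the weight.\<close>

lemma exp_poly_in_fock:
  assumes m: "m \<ge> 1" and g: "real (degree g) \<le> m"
  shows "(\<lambda>z. c * exp (poly g z)) \<in> fock m"
proof -
  define A where "A = (\<Sum>k\<le>degree g. cmod (coeff g k))"
  have A: "A \<ge> 0" by (simp add: A_def sum_nonneg)
  have "cmod (c * exp (poly g w)) \<le> cmod c * exp A * exp (A * cmod w powr m)" for w
  proof -
    have "cmod (poly g w) \<le> (\<Sum>k\<le>degree g. cmod (coeff g k) * (1 + cmod w powr m))"
      unfolding poly_altdef
    proof (intro sum_norm_le)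
      fix k assume k: "k \<in> {..degree g}"
      have "cmod w ^ k \<le> 1 + cmod w powr m"
      proof (cases "cmod w \<le> 1")
        case True
        then have "cmod w ^ k \<le> 1" by (intro power_le_one) auto
        then show ?thesis by (simp add: add_increasing2)
      next
        case False
        then have "cmod w ^ k = cmod w powr real k" by (subst powr_realpow) auto
        also have "\<dots> \<le> cmod w powr m" using False k g by (intro powr_mono) auto
        finally show ?thesis by simp
      qed
      then show "cmod (coeff g k * w ^ k) \<le> cmod (coeff g k) * (1 + cmod w powr m)"
        by (simp add: norm_mult norm_power mult_left_mono)
    qed
    also have "\<dots> = A + A * cmod w powr m"
      unfolding sum_distrib_right[symmetric] A_def[symmetric] by (simp add: algebra_simps)
    finally have "Re (poly g w) \<le> A + A * cmod w powr m" using complex_Re_le_cmod order_trans by blast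
    then show ?thesis by (simp add: norm_mult mult.assoc exp_add[symmetric] mult_left_mono)
  qed
  then have "fock_norm_sq m (\<lambda>z. c * exp (poly g z)) < \<infinity>"
    by (rule fock_norm_sq_finite_of_growth[OF m]) (rule A)
  moreover have "(\<lambda>z. c * exp (poly g z)) holomorphic_on UNIV" by (intro holomorphic_intros)
  ultimately show ?thesis by (simp add: fock_iff)
qed

text \<open>Moduli are taken inside the integral, since the Schur test needs no cancellation. The
  factor |c| is kept outside so that C1 and C2 depend on m only.\<close>

theorem toeplitz_prod_exp_bound:
  assumes m: "m \<ge> 1"
  obtains C1 C2 where "C1 > 0" "C2 > 0"
    "\<And>g c f. real (degree g) \<le> m \<Longrightarrow> f \<in> kernel_span m \<Longrightarrow>
       toeplitz_prod m (\<lambda>z. exp (poly g z)) (\<lambda>z. c * exp (- poly g z)) f \<in> fock m \<and>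
       fock_norm m (toeplitz_prod m (\<lambda>z. exp (poly g z)) (\<lambda>z. c * exp (- poly g z)) f) \<le>
         cmod c * (C1 * exp (C2 * H2_norm_sq g)) * fock_norm m f"
proof -
  obtain C1 C2 where C: "C1 > 0" "C2 > 0"
    "\<And>g z. real (degree g) \<le> m \<Longrightarrow> (\<integral>\<^sup>+w. ennreal (twisted_kernel m g z w) \<partial>lborel) \<le> ennreal (C1 * exp (C2 * H2_norm_sq g))"
    "\<And>g w. real (degree g) \<le> m \<Longrightarrow> (\<integral>\<^sup>+z. ennreal (twisted_kernel m g z w) \<partial>lborel) \<le> ennreal (C1 * exp (C2 * H2_norm_sq g))"
    using nn_integral_twisted_kernel[OF m] by blast
  show ?thesis
  proof
    fix g :: "complex poly" and c :: complex and f
    assume g: "real (degree g) \<le> m" and f: "f \<in> kernel_span m"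
    define u where "u = (\<lambda>z. exp (poly g z))"
    define v where "v = (\<lambda>z. c * exp (- poly g z))"
    define M where "M = C1 * exp (C2 * H2_norm_sq g)"
    have M0: "M \<ge> 0" using C by (simp add: M_def)
    have u: "u \<in> fock m" using exp_poly_in_fock[OF m g, of 1] by (simp add: u_def)
    have v: "v \<in> fock m" using exp_poly_in_fock[OF m, of "- g" c] g by (simp add: v_def)
    define h where "h = toeplitz m (\<lambda>w. cnj (v w)) f"
    have T: "toeplitz_prod m u v f = (\<lambda>z. u z * h z)" unfolding h_def by (rule toeplitz_prod_eq[OF m u v f])
    have hol: "(\<lambda>z. u z * h z) holomorphic_on UNIV"
      using u kernel_span_holomorphic[OF m toeplitz_conj_symbol(1)[OF m v f]] by (auto simp: fock_iff h_def intro!: holomorphic_intros)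
    have hf: "f holomorphic_on UNIV" by (rule kernel_span_holomorphic[OF m f])
    have [measurable]: "f \<in> borel_measurable borel" by (rule borel_measurable_holomorphic[OF hf])
    have nf: "fock_norm_sq m f < \<infinity>" by (rule kernel_span_norm_finite(1)[OF m f])
    define F where "F w = ennreal (cmod c * cmod (f w) * sqrt (fock_weight m w))" for w
    have mF: "F \<in> borel_measurable borel" unfolding F_def[abs_def] by measurable
    have "fock_norm_sq m (\<lambda>z. u z * h z) \<le> (\<integral>\<^sup>+z. (\<integral>\<^sup>+w. ennreal (twisted_kernel m g z w) * F w \<partial>lborel)\<^sup>2 \<partial>lborel)"
      unfolding fock_norm_sq_def
    proof (intro nn_integral_mono)
      fix z
      have int: "integrable lborel (\<lambda>w. fock_kernel m z w * cnj (v w) * f w * of_real (fock_weight m w))"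
        by (rule toeplitz_conj_symbol(2)[OF m v f])
      have "ennreal (cmod (u z * h z) * sqrt (fock_weight m z)) = ennreal (cmod (u z) * sqrt (fock_weight m z)) * ennreal (cmod (h z))"
        by (simp add: ennreal_mult[symmetric] norm_mult mult_ac)
      also have "ennreal (cmod (h z)) \<le> (\<integral>\<^sup>+w. norm (fock_kernel m z w * cnj (v w) * f w * of_real (fock_weight m w)) \<partial>lborel)"
        unfolding h_def toeplitz_def by (rule integral_norm_bound_ennreal[OF int])
      also have "ennreal (cmod (u z) * sqrt (fock_weight m z)) * \<dots> =
         (\<integral>\<^sup>+w. ennreal (cmod (u z) * sqrt (fock_weight m z)) * ennreal (norm (fock_kernel m z w * cnj (v w) * f w * of_real (fock_weight m w))) \<partial>lborel)"
        by (intro nn_integral_cmult[symmetric] measurable_compose[OF measurable_compose[OF borel_measurable_integrable[OF int] borel_measurable_norm] measurable_ennreal])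
      also have "\<dots> = (\<integral>\<^sup>+w. ennreal (twisted_kernel m g z w) * F w \<partial>lborel)"
      proof (intro nn_integral_cong)
        fix w
        have uv: "cmod (u z) * cmod (v w) = cmod c * exp (Re (poly g z) - Re (poly g w))"
          unfolding u_def v_def norm_mult norm_exp_eq_Re diff_conv_add_uminus exp_add by simp
        \<comment> \<open>One root of the weight at w goes into the twisted kernel, the other into
          \<open>F\<close>.\<close>
        have sw: "fock_weight m w = sqrt (fock_weight m w) * sqrt (fock_weight m w)" by simp
        have "cmod (u z) * sqrt (fock_weight m z) * norm (fock_kernel m z w * cnj (v w) * f w * of_real (fock_weight m w)) =
          (cmod (u z) * cmod (v w)) * cmod (fock_kernel m z w) * sqrt (fock_weight m z) * cmod (f w) * fock_weight m w"
          by (simp add: norm_mult mult_ac)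
        also have "\<dots> = twisted_kernel m g z w * (cmod c * cmod (f w) * sqrt (fock_weight m w))"
          unfolding uv twisted_kernel_def by (subst sw) (simp only: mult_ac)
        finally show "ennreal (cmod (u z) * sqrt (fock_weight m z)) * ennreal (norm (fock_kernel m z w * cnj (v w) * f w * of_real (fock_weight m w))) =
          ennreal (twisted_kernel m g z w) * F w"
          unfolding F_def by (simp add: ennreal_mult[symmetric] twisted_kernel_nonneg)
      qed
      finally have "(ennreal (cmod (u z * h z) * sqrt (fock_weight m z)))\<^sup>2 \<le> (\<integral>\<^sup>+w. ennreal (twisted_kernel m g z w) * F w \<partial>lborel)\<^sup>2"
        by (intro power_mono) (auto simp: mult_left_mono)
      then show "ennreal ((cmod (u z * h z))\<^sup>2 * fock_weight m z) \<le> (\<integral>\<^sup>+w. ennreal (twisted_kernel m g z w) * F w \<partial>lborel)\<^sup>2"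
        by (simp add: ennreal_power power_mult_distrib)
    qed
    also have "\<dots> \<le> ennreal (M\<^sup>2) * (\<integral>\<^sup>+w. (F w)\<^sup>2 \<partial>lborel)"
      by (rule schur_test) (use twisted_kernel_measurable[OF m, of g] mF C(3,4)[OF g] M0 in \<open>auto simp: M_def\<close>)
    also have "(\<integral>\<^sup>+w. (F w)\<^sup>2 \<partial>lborel) = fock_norm_sq m (\<lambda>w. c * f w)"
      unfolding fock_norm_sq_def F_def by (simp add: ennreal_power power_mult_distrib norm_mult)
    also have "\<dots> = ennreal ((cmod c)\<^sup>2) * ennreal ((fock_norm m f)\<^sup>2)"
      using nf by (subst fock_norm_sq_cmult) (auto simp: fock_norm_sq_eq)
    finally have le: "fock_norm_sq m (\<lambda>z. u z * h z) \<le> ennreal ((cmod c * M * fock_norm m f)\<^sup>2)"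
      by (simp add: ennreal_mult[symmetric] power_mult_distrib mult_ac)
    then have fin: "fock_norm_sq m (\<lambda>z. u z * h z) < \<infinity>" by (rule order.strict_trans1) simp
    have "fock_norm m (\<lambda>z. u z * h z) \<le> cmod c * M * fock_norm m f"
      using le fin M0 by (subst fock_norm_le_iff) (auto intro: borel_measurable_holomorphic[OF hol] simp: fock_norm_nonneg)
    then show "toeplitz_prod m (\<lambda>z. exp (poly g z)) (\<lambda>z. c * exp (- poly g z)) f \<in> fock m \<and>
       fock_norm m (toeplitz_prod m (\<lambda>z. exp (poly g z)) (\<lambda>z. c * exp (- poly g z)) f) \<le>
         cmod c * (C1 * exp (C2 * H2_norm_sq g)) * fock_norm m f"
      using hol fin unfolding u_def[symmetric] v_def[symmetric] T M_def by (simp add: fock_iff)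
  qed (use C in auto)
qed

section \<open>Necessity\<close>

text \<open>The Moebius map X -> X/(2A - X) takes the half-plane Re X < A into the unit disc and
  fixes 0. Schwarz's lemma at half the radius then gives 2|f| \<le> |2A - f|.\<close>

lemma borel_caratheodory_half:
  assumes f: "f holomorphic_on UNIV" and f0: "f 0 = 0" and R: "R > 0" and A: "A > 0"
    and re: "\<And>z. cmod z < R \<Longrightarrow> Re (f z) < A" and z: "cmod z \<le> R / 2"
  shows "cmod (f z) \<le> 2 * A"
proof -
  define F where "F w = f (of_real R * w) / (of_real (2 * A) - f (of_real R * w))" for w
  have small: "cmod (of_real R * w) < R" if "cmod w < 1" for w
    using that R mult_strict_left_mono[of "cmod w" 1 R] by (simp add: norm_mult)
  have nz: "of_real (2 * A) - f (of_real R * w) \<noteq> 0" if "cmod w < 1" for w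
  proof
    assume "of_real (2 * A) - f (of_real R * w) = 0"
    then have "f (of_real R * w) = of_real (2 * A)" by simp
    then have "Re (f (of_real R * w)) = 2 * A" by simp
    with re[OF small[OF that]] A show False by simp
  qed
  have lt: "cmod X < cmod (of_real (2 * A) - X)" if "Re X < A" for X
  proof -
    have "(cmod X)\<^sup>2 < (cmod (of_real (2 * A) - X))\<^sup>2"
      using that A mult_strict_left_mono[of "Re X" A "4 * A"]
      unfolding cmod_power2 by (simp add: power2_eq_square algebra_simps)
    then show ?thesis by (rule power2_less_imp_less) simp
  qed
  have holF: "F holomorphic_on ball 0 1"
    unfolding F_def using nz
    by (intro holomorphic_intros holomorphic_on_compose_gen[OF _ f, of "\<lambda>w. of_real R * w", unfolded o_def]) auto
  have "cmod (F w) < 1" if "cmod w < 1" for w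
    using lt[OF re[OF small[OF that]]] nz[OF that] by (simp add: F_def norm_divide)
  moreover have zR: "cmod (z / of_real R) \<le> 1 / 2" using z R by (simp add: norm_divide field_simps)
  ultimately have "cmod (F (z / of_real R)) \<le> cmod (z / of_real R)"
    using f0 by (intro Schwarz_Lemma(1)[OF holF]) (auto simp: F_def)
  then have "cmod (F (z / of_real R)) \<le> 1 / 2" using zR by linarith
  then have "cmod (f z) / cmod (of_real (2 * A) - f z) \<le> 1 / 2"
    using R by (simp add: F_def norm_divide)
  moreover have "cmod (of_real (2 * A) - f z) > 0"
    using nz[of "z / of_real R"] zR R by simp
  ultimately have "2 * cmod (f z) \<le> cmod (of_real (2 * A) - f z)" by (simp add: field_simps)
  also have "\<dots> \<le> 2 * A + cmod (f z)"
    using norm_triangle_ineq4[of "of_real (2 * A)" "f z"] A by (simp add: norm_mult)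
  finally show ?thesis by simp
qed

text \<open>Circles of radius exp(n/2) suffice, as the maximum principle for Re g fills the discs.
  In Cauchy's estimate for k > m the factor exp((m-k)n/2) beats n + 1.\<close>

lemma entire_eq_poly_of_Re_growth:
  fixes m C :: real
  assumes g: "g holomorphic_on UNIV" and m: "m \<ge> 1"
    and re: "\<And>n z. cmod z = exp (real n / 2) \<Longrightarrow> Re (g z) \<le> C * (real n + 1) * exp (m * real n / 2)"
  obtains p :: "complex poly" where "real (degree p) \<le> m" "\<And>z. g z = poly p z"
proof -
  define f where "f z = g z - g 0" for z
  have f: "f holomorphic_on UNIV" unfolding f_def[abs_def] by (intro holomorphic_intros g)
  \<comment> \<open>The modulus allows a negative \<open>C\<close>; \<open>cmod (g 0)\<close> pays
    for normalising f 0 = 0, and the 1 makes the bound strict and positive.\<close>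
  define C' where "C' = \<bar>C\<bar> + cmod (g 0) + 1"
  have C': "C' > 0" by (simp add: C'_def add_nonneg_pos)
  define A where "A n = C' * (real n + 1) * exp (m * real n / 2)" for n
  have A: "A n > 0" for n using C' by (simp add: A_def)
  have E1: "1 \<le> (real n + 1) * exp (m * real n / 2)" for n
    using mult_mono[of 1 "real n + 1" 1 "exp (m * real n / 2)"] m by simp
  have ref: "Re (f z) < A n" if "cmod z < exp (real n / 2)" for n z
  proof -
    have "Re (g z) \<le> C * (real n + 1) * exp (m * real n / 2)"
    proof (rule maximum_real_frontier[where S = "cball 0 (exp (real n / 2))" and f = g and \<xi> = z])
      show "continuous_on (closure (cball 0 (exp (real n / 2)))) g"
        by (intro holomorphic_on_imp_continuous_on holomorphic_on_subset[OF g]) auto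
    qed (use re that in \<open>auto intro: holomorphic_on_subset[OF g]\<close>)
    then have "Re (g z) \<le> C * ((real n + 1) * exp (m * real n / 2))" by (simp add: mult.assoc)
    also have "\<dots> \<le> \<bar>C\<bar> * ((real n + 1) * exp (m * real n / 2))" by (intro mult_right_mono) auto
    finally have "Re (g z) - Re (g 0) < \<bar>C\<bar> * ((real n + 1) * exp (m * real n / 2)) + (cmod (g 0) + 1) * 1"
    proof -
      have "a - b < c + (d + 1) * 1" if "a \<le> c" "\<bar>b\<bar> \<le> d" for a b c d :: real using that by simp
      then show "Re (g z) \<le> \<bar>C\<bar> * ((real n + 1) * exp (m * real n / 2)) \<Longrightarrow>
        Re (g z) - Re (g 0) < \<bar>C\<bar> * ((real n + 1) * exp (m * real n / 2)) + (cmod (g 0) + 1) * 1"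
        using abs_Re_le_cmod[of "g 0"] by blast
    qed
    also have "\<dots> \<le> \<bar>C\<bar> * ((real n + 1) * exp (m * real n / 2)) + (cmod (g 0) + 1) * ((real n + 1) * exp (m * real n / 2))"
      by (intro add_left_mono mult_left_mono E1) auto
    also have "\<dots> = A n" by (simp add: A_def C'_def algebra_simps)
    finally show ?thesis by (simp add: f_def)
  qed
  have bnd: "cmod (f z) \<le> 2 * A n" if "cmod z \<le> exp (real n / 2) / 2" for n z
    by (rule borel_caratheodory_half[OF f _ _ A[of n] ref that]) (auto simp: f_def)
  have zero: "(deriv ^^ k) f 0 = 0" if k: "real k > m" for k
  proof -
    \<comment> \<open>The halving reflects the radius exp(n/2).\<close>
    define \<epsilon> where "\<epsilon> = (real k - m) / 2"
    have \<epsilon>: "\<epsilon> > 0" using k by (simp add: \<epsilon>_def)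
    have "cmod ((deriv ^^ k) f 0) \<le> fact k * 2 * C' * 2 ^ k * ((real n + 1) * exp (- \<epsilon> * real n))" for n
    proof -
      have "cmod ((deriv ^^ k) f 0) \<le> fact k * (2 * A n) / (exp (real n / 2) / 2) ^ k"
        by (rule Cauchy_inequality)
           (auto intro!: holomorphic_on_subset[OF f] holomorphic_on_imp_continuous_on bnd)
      also have "\<dots> = fact k * 2 * C' * 2 ^ k * ((real n + 1) * (exp (m * real n / 2) / exp (real n / 2) ^ k))"
        by (simp add: A_def power_divide)
      also have "exp (m * real n / 2) / exp (real n / 2) ^ k = exp (- \<epsilon> * real n)"
        unfolding exp_of_nat_mult[symmetric] exp_diff[symmetric] by (simp add: \<epsilon>_def field_simps)
      finally show ?thesis .
    qed
    moreover have "(\<lambda>n. fact k * 2 * C' * 2 ^ k * ((real n + 1) * exp (- \<epsilon> * real n))) \<longlonglongrightarrow> fact k * 2 * C' * 2 ^ k * 0"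
    proof (intro tendsto_mult tendsto_const)
      show "(\<lambda>n. (real n + 1) * exp (- \<epsilon> * real n)) \<longlonglongrightarrow> 0"
        using \<epsilon> by real_asymp
    qed
    ultimately have "cmod ((deriv ^^ k) f 0) \<le> fact k * 2 * C' * 2 ^ k * 0"
      by (intro tendsto_lowerbound[of "\<lambda>n. fact k * 2 * C' * 2 ^ k * ((real n + 1) * exp (- \<epsilon> * real n))" _ sequentially]) auto
    then show ?thesis by simp
  qed
  define N where "N = nat \<lfloor>m\<rfloor>"
  have N: "real N \<le> m" "\<And>k. k > N \<Longrightarrow> real k > m" using m by (auto simp: N_def nat_less_iff floor_less_iff)
  define a where "a k = (deriv ^^ k) f 0 / fact k" for k
  define p where "p = [:g 0:] + (\<Sum>k\<le>N. monom (a k) k)"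
  show ?thesis
  proof
    have "degree p \<le> N" unfolding p_def
      by (intro degree_add_le degree_sum_le) (auto intro: order_trans[OF degree_monom_le])
    then show "real (degree p) \<le> m" using N(1) by linarith
    fix z
    have "(\<lambda>k. a k * z ^ k) sums f z"
      using holomorphic_power_series[OF holomorphic_on_subset[OF f], of 0 "cmod z + 1" z] by (simp add: a_def)
    moreover have "(\<lambda>k. a k * z ^ k) sums (\<Sum>k\<le>N. a k * z ^ k)"
      by (rule sums_finite) (auto simp: a_def zero N(2))
    ultimately have "f z = (\<Sum>k\<le>N. a k * z ^ k)" by (rule sums_unique2)
    then show "g z = poly p z" by (simp add: f_def p_def poly_sum poly_monom algebra_simps)
  qed
qed

section \<open>Second differences of log K along a ray\<close>

text \<open>Each summand is a jump d(2j+1) - d(2j) of the increasing slopes. Adding the skipped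
  jumps telescopes to at most d(2J), since d(0) \<ge> 0. This slope is at most the mean of L slopes
  from there on, so a growth bound can replace a derivative bound.\<close>

lemma convex_sequence_alternating_sum_le:
  fixes \<phi> :: "nat \<Rightarrow> real"
  assumes conv: "\<And>i. 2 * \<phi> (i + 1) \<le> \<phi> i + \<phi> (i + 2)" and mono: "\<phi> 0 \<le> \<phi> 1" and L: "L \<ge> 1"
  shows "(\<Sum>j<J. \<phi> (2 * j) + \<phi> (2 * j + 2) - 2 * \<phi> (2 * j + 1)) \<le> (\<phi> (2 * J + L) - \<phi> (2 * J)) / real L"
proof -
  define d where "d i = \<phi> (i + 1) - \<phi> i" for i
  have d: "d i \<le> d (i + 1)" for i using conv[of i] by (simp add: d_def)
  have dm: "d i \<le> d (i + l)" for i l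
    by (induction l) (auto intro: order_trans[OF _ d[simplified]])
  have "(\<Sum>j<J. \<phi> (2 * j) + \<phi> (2 * j + 2) - 2 * \<phi> (2 * j + 1)) \<le> d (2 * J) - d 0"
  proof (induction J)
    case (Suc J)
    have "\<phi> (2 * J) + \<phi> (2 * J + 2) - 2 * \<phi> (2 * J + 1) = d (2 * J + 1) - d (2 * J)" by (simp add: d_def)
    also have "\<dots> \<le> d (2 * Suc J) - d (2 * J)" using d[of "2 * J + 1"] by simp
    finally show ?case using Suc by simp
  qed simp
  also have "\<dots> \<le> d (2 * J)" using mono by (simp add: d_def)
  also have "\<dots> \<le> (\<phi> (2 * J + L) - \<phi> (2 * J)) / real L"
  proof -
    have "real L * d (2 * J) = (\<Sum>i<L. d (2 * J))" by simp
    also have "\<dots> \<le> (\<Sum>i<L. d (2 * J + i))" by (intro sum_mono dm)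
    also have "\<dots> = \<phi> (2 * J + L) - \<phi> (2 * J)"
      by (induction L) (auto simp: d_def)
    finally show ?thesis using L by (simp add: field_simps)
  qed
  finally show ?thesis .
qed

text \<open>For |z| = exp(t/2) this is log K(z,z) up to the constant log(m/\<pi>), which drops out
  of second differences.\<close>

definition log_ml :: "real \<Rightarrow> real \<Rightarrow> real" where
  "log_ml m t = ln (ml_real m (exp t))"

lemma fock_kernel_ray:
  assumes "m \<ge> 1" "cmod e = 1"
  shows "fock_kernel m (of_real (exp x) * e) (of_real (exp y) * e) = of_real (m / pi * ml_real m (exp (x + y)))"
proof -
  have "of_real (exp x) * e * cnj (of_real (exp y) * e) = of_real (exp x * exp y) * (e * cnj e)" by simp
  also have "e * cnj e = 1" using assms(2) by (simp add: complex_norm_square[symmetric])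
  finally have "of_real (exp x) * e * cnj (of_real (exp y) * e) = of_real (exp (x + y))" by (simp add: exp_add)
  then show ?thesis unfolding fock_kernel_eq_ml by (simp add: ml_of_real[OF assms(1)] del: of_real_exp)
qed

lemma log_ml_convex:
  assumes m: "m \<ge> 1"
  shows "2 * log_ml m (x + y) \<le> log_ml m (2 * x) + log_ml m (2 * y)"
proof -
  have pos: "ml_real m (exp t) > 0" for t by (rule ml_real_pos[OF m]) simp
  have "(m / pi * ml_real m (exp (x + y)))\<^sup>2 \<le> (m / pi * ml_real m (exp (2 * x))) * (m / pi * ml_real m (exp (2 * y)))"
    using norm_fock_kernel_sq_le[OF m, of "of_real (exp x) * 1" "of_real (exp y) * 1"]
    unfolding fock_kernel_ray[OF m norm_one] norm_of_real Re_complex_of_real power2_abs by (simp only: mult_2)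
  then have "(m / pi)\<^sup>2 * (ml_real m (exp (x + y)))\<^sup>2 \<le> (m / pi)\<^sup>2 * (ml_real m (exp (2 * x)) * ml_real m (exp (2 * y)))"
    by (simp add: power_mult_distrib power2_eq_square mult_ac)
  then have "(ml_real m (exp (x + y)))\<^sup>2 \<le> ml_real m (exp (2 * x)) * ml_real m (exp (2 * y))"
    using m by (subst (asm) mult_le_cancel_left_pos) auto
  then have "ln ((ml_real m (exp (x + y)))\<^sup>2) \<le> ln (ml_real m (exp (2 * x)) * ml_real m (exp (2 * y)))"
    using pos[of "x + y"] by (intro ln_mono) auto
  then show ?thesis using pos[of "x + y"] pos[of "2 * x"] pos[of "2 * y"] unfolding log_ml_def
    by (simp add: ln_mult_pos ln_realpow)
qed

lemma log_ml_mono: "m \<ge> 1 \<Longrightarrow> x \<le> y \<Longrightarrow> log_ml m x \<le> log_ml m y"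
  unfolding log_ml_def by (intro ln_mono ml_real_pos ml_real_mono) auto

text \<open>Cauchy--Schwarz makes \<open>log_ml\<close> convex, so its second differences telescope. With $N$ pieces
  per unit of $2\log|z|$, the constants $D$ contribute $O(N\log|z|)$ and the second differences
  $O(|z|^{2m}/N)$, which suggests $N\approx|z|^m$.\<close>

lemma Re_growth_of_log_ml_oscillation:
  fixes m D :: real
  assumes m: "m \<ge> 1" and g: "continuous_on UNIV g"
    and osc: "\<And>e x y. cmod e = 1 \<Longrightarrow> Re (g (of_real (exp y) * e)) - Re (g (of_real (exp x) * e)) \<le>
        D + log_ml m (2 * x) + log_ml m (2 * y) - 2 * log_ml m (x + y)"
  obtains C where "\<And>n z. cmod z = exp (real n / 2) \<Longrightarrow> Re (g z) \<le> C * (real n + 1) * exp (m * real n / 2)"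
proof -
  obtain C0 where C0: "C0 > 0" "\<And>x. x \<ge> 0 \<Longrightarrow> ml_real m x \<le> C0 * exp (m * x powr m)"
    using ml_real_growth[OF m] by blast
  obtain M1 where M1: "\<And>z. cmod z = 1 \<Longrightarrow> Re (g z) \<le> M1"
  proof -
    have "compact (g ` sphere 0 1)" by (intro compact_continuous_image continuous_on_subset[OF g]) auto
    then obtain B where "\<And>z. z \<in> sphere 0 1 \<Longrightarrow> cmod (g z) \<le> B"
      unfolding compact_eq_bounded_closed bounded_iff by blast
    then have "Re (g z) \<le> B" if "cmod z = 1" for z using that complex_Re_le_cmod order_trans by fastforce
    then show ?thesis using that by blast
  qed
  \<comment> \<open>Bounds the increment of \<open>log_ml\<close> over [n, n+1] by K X^2 with X =
    |z|^m: above through exp(n+1)^m = exp(m) X^2, below through monotonicity and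
    \<open>log_ml m 0\<close>.\<close>
  define K where "K = \<bar>ln C0\<bar> + m * exp m + \<bar>log_ml m 0\<bar>"
  define C where "C = \<bar>M1\<bar> + 2 * \<bar>D\<bar> + K"
  show ?thesis
  proof
    fix n :: nat and z :: complex
    assume z: "cmod z = exp (real n / 2)"
    define X where "X = exp (m * real n / 2)"
    have X1: "X \<ge> 1" using m by (simp add: X_def)
    \<comment> \<open>Rounding up costs at most a factor 2 because X \<ge> 1.\<close>
    define N where "N = nat \<lceil>X\<rceil>"
    have N: "X \<le> real N" "real N \<le> 2 * X" using X1 by (auto simp: N_def intro: order_trans[OF real_nat_ceiling_ge]) linarith
    have N1: "N \<ge> 1" using N X1 by linarith
    define e where "e = z / of_real (exp (real n / 2))"
    have e: "cmod e = 1" by (simp add: e_def norm_divide z)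
    have ze: "z = of_real (exp (real n / 2)) * e" by (simp add: e_def)
    \<comment> \<open>The ray points have exponents j h, and K at exponents x and y depends on x +
      y: even indices of \<open>\<phi>\<close> are diagonal values, odd ones mixed values. J = n N
      steps reach the exponent n/2, and 2 N samples span one unit for \<open>log_ml\<close>, whence
      L = 2 N below.\<close>
    define h where "h = 1 / (2 * real N)"
    have h: "h > 0" "2 * real N * h = 1" using N1 by (auto simp: h_def)
    define \<phi> where "\<phi> i = log_ml m (real i * h)" for i
    define \<rho> where "\<rho> j = Re (g (of_real (exp (real j * h)) * e))" for j
    define J where "J = n * N"
    have step: "\<rho> (Suc j) - \<rho> j \<le> D + (\<phi> (2 * j) + \<phi> (2 * j + 2) - 2 * \<phi> (2 * j + 1))" for j
      using osc[OF e, of "real (Suc j) * h" "real j * h"]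
      by (simp add: \<rho>_def \<phi>_def algebra_simps)
    have "\<rho> J - \<rho> 0 = (\<Sum>j<J. \<rho> (Suc j) - \<rho> j)" by (rule sum_lessThan_telescope[symmetric])
    also have "\<dots> \<le> (\<Sum>j<J. D + (\<phi> (2 * j) + \<phi> (2 * j + 2) - 2 * \<phi> (2 * j + 1)))" by (intro sum_mono step)
    also have "\<dots> = real J * D + (\<Sum>j<J. \<phi> (2 * j) + \<phi> (2 * j + 2) - 2 * \<phi> (2 * j + 1))" by (simp add: sum.distrib)
    also have "(\<Sum>j<J. \<phi> (2 * j) + \<phi> (2 * j + 2) - 2 * \<phi> (2 * j + 1)) \<le> (\<phi> (2 * J + 2 * N) - \<phi> (2 * J)) / real (2 * N)"
    proof (rule convex_sequence_alternating_sum_le)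
      show "2 * \<phi> (i + 1) \<le> \<phi> i + \<phi> (i + 2)" for i
        using log_ml_convex[OF m, of "real i * h / 2" "real (i + 2) * h / 2"]
        by (simp add: \<phi>_def algebra_simps add_divide_distrib)
      show "\<phi> 0 \<le> \<phi> 1" unfolding \<phi>_def using h m by (intro log_ml_mono) auto
    qed (use N1 in auto)
    also have "\<phi> (2 * J) = log_ml m (real n)"
    proof -
      have "real (2 * J) * h = real n * (2 * real N * h)" by (simp add: J_def)
      then show ?thesis unfolding \<phi>_def h(2) by simp
    qed
    also have "\<phi> (2 * J + 2 * N) = log_ml m (real n + 1)"
    proof -
      have "real (2 * J + 2 * N) * h = (real n + 1) * (2 * real N * h)" by (simp add: J_def algebra_simps)
      then show ?thesis unfolding \<phi>_def h(2) by simp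
    qed
    finally have main: "\<rho> J - \<rho> 0 \<le> real J * D + (log_ml m (real n + 1) - log_ml m (real n)) / real (2 * N)" by simp
    have "log_ml m (real n + 1) - log_ml m (real n) \<le> K * X\<^sup>2"
    proof -
      have "log_ml m (real n + 1) \<le> ln (C0 * exp (m * exp (real n + 1) powr m))"
        unfolding log_ml_def by (intro ln_mono ml_real_pos m C0) auto
      also have "\<dots> = ln C0 + m * exp (real n + 1) powr m" using C0(1) by (simp add: ln_mult_pos)
      also have "exp (real n + 1) powr m = exp m * X\<^sup>2"
        by (simp add: X_def powr_def exp_double[symmetric] exp_add[symmetric] algebra_simps)
      finally have "log_ml m (real n + 1) \<le> \<bar>ln C0\<bar> + m * exp m * X\<^sup>2" by linarith
      moreover have "log_ml m 0 \<le> log_ml m (real n)" by (intro log_ml_mono m) auto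
      ultimately have "log_ml m (real n + 1) - log_ml m (real n) \<le> (\<bar>ln C0\<bar> + \<bar>log_ml m 0\<bar>) * 1 + m * exp m * X\<^sup>2"
      proof -
        have "a - b \<le> (\<bar>l\<bar> + \<bar>d\<bar>) * 1 + Y" if "a \<le> \<bar>l\<bar> + Y" "d \<le> b" for a b d l Y :: real using that by simp
        then show "log_ml m (real n + 1) \<le> \<bar>ln C0\<bar> + m * exp m * X\<^sup>2 \<Longrightarrow> log_ml m 0 \<le> log_ml m (real n) \<Longrightarrow>
          log_ml m (real n + 1) - log_ml m (real n) \<le> (\<bar>ln C0\<bar> + \<bar>log_ml m 0\<bar>) * 1 + m * exp m * X\<^sup>2" .
      qed
      also have "\<dots> \<le> (\<bar>ln C0\<bar> + \<bar>log_ml m 0\<bar>) * X\<^sup>2 + m * exp m * X\<^sup>2"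
        using X1 by (intro add_right_mono mult_left_mono) (auto simp: one_le_power)
      finally show ?thesis by (simp add: K_def algebra_simps)
    qed
    then have "(log_ml m (real n + 1) - log_ml m (real n)) / real (2 * N) \<le> K * X\<^sup>2 / real (2 * N)"
      by (intro divide_right_mono) auto
    also have "\<dots> \<le> K * X"
    proof -
      have K0: "K \<ge> 0" using m by (simp add: K_def)
      have "X\<^sup>2 \<le> X * real (2 * N)" unfolding power2_eq_square using N X1 by (intro mult_left_mono) auto
      from mult_left_mono[OF this K0] show ?thesis using N1 by (simp add: field_simps)
    qed
    finally have a: "(log_ml m (real n + 1) - log_ml m (real n)) / real (2 * N) \<le> K * X" .
    have b: "real J * D \<le> real n * (2 * X) * \<bar>D\<bar>"
    proof -
      have "real J * D \<le> real n * real N * \<bar>D\<bar>" unfolding J_def of_nat_mult by (intro mult_left_mono) auto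
      also have "\<dots> \<le> real n * (2 * X) * \<bar>D\<bar>" using N(2) by (intro mult_right_mono mult_left_mono) auto
      finally show ?thesis .
    qed
    have "\<rho> 0 \<le> M1" unfolding \<rho>_def using M1[of e] e by simp
    moreover have "\<rho> J = Re (g z)"
    proof -
      have "real J * h = real n * (2 * real N * h) / 2" by (simp add: J_def)
      then have Jh: "real J * h = real n / 2" unfolding h(2) by simp
      show ?thesis unfolding \<rho>_def Jh ze ..
    qed
    ultimately have "Re (g z) \<le> M1 + (real n * (2 * X) * \<bar>D\<bar> + K * X)" using main a b by linarith
    also have "\<dots> \<le> \<bar>M1\<bar> * ((real n + 1) * X) + ((real n + 1) * (2 * X) * \<bar>D\<bar> + K * ((real n + 1) * X))"
    proof (intro add_mono)
      have "1 \<le> (real n + 1) * X" using mult_mono[of 1 "real n + 1" 1 X] X1 by simp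
      from mult_left_mono[OF this, of "\<bar>M1\<bar>"] show "M1 \<le> \<bar>M1\<bar> * ((real n + 1) * X)" by linarith
      show "real n * (2 * X) * \<bar>D\<bar> \<le> (real n + 1) * (2 * X) * \<bar>D\<bar>" using X1 by (intro mult_right_mono) auto
      have K0: "K \<ge> 0" using m by (simp add: K_def)
      show "K * X \<le> K * ((real n + 1) * X)" using K0 X1 by (intro mult_left_mono) auto
    qed
    also have "\<dots> = C * (real n + 1) * exp (m * real n / 2)" by (simp add: C_def X_def algebra_simps)
    finally show "Re (g z) \<le> C * (real n + 1) * exp (m * real n / 2)" .
  qed
qed

section \<open>Berezin transforms and the norm of T on kernels\<close>

text \<open>Stated with the denominator cleared, so that it also holds when both sides are
  infinite.\<close>

lemma berezin_eq_fock_norm_sq: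
  assumes m: "m \<ge> 1" and u: "u holomorphic_on UNIV"
  shows "ennreal (Re (fock_kernel m z z)) * berezin m (\<lambda>w. (cmod (u w))\<^sup>2) z = fock_norm_sq m (\<lambda>w. u w * fock_kernel m w z)"
proof -
  have [measurable]: "u \<in> borel_measurable borel" by (rule borel_measurable_holomorphic[OF u])
  note [measurable] = borel_measurable_fock_kernel(1)[OF m, of z]
  have pos: "Re (fock_kernel m z z) > 0" by (rule fock_kernel_diag(2)[OF m])
  have "ennreal (Re (fock_kernel m z z)) * berezin m (\<lambda>w. (cmod (u w))\<^sup>2) z =
    (\<integral>\<^sup>+w. ennreal (Re (fock_kernel m z z)) * ennreal ((cmod (u w))\<^sup>2 * (cmod (fock_kernel m w z))\<^sup>2 / Re (fock_kernel m z z) * fock_weight m w) \<partial>lborel)"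
    unfolding berezin_def by (rule nn_integral_cmult[symmetric]) measurable
  also have "\<dots> = fock_norm_sq m (\<lambda>w. u w * fock_kernel m w z)"
    unfolding fock_norm_sq_def using pos
    by (intro nn_integral_cong) (simp add: ennreal_mult[symmetric] norm_mult power_mult_distrib less_imp_le)
  finally show ?thesis .
qed

text \<open>Identifies the mixed quantity as the squared norm of T on the normalised kernel at
  z.\<close>

lemma fock_norm_sq_toeplitz_prod_kernel:
  assumes m: "m \<ge> 1" and u: "u \<in> fock m" and v: "v \<in> fock m"
  shows "fock_norm_sq m (toeplitz_prod m u v (\<lambda>w. fock_kernel m w z)) =
    ennreal (Re (fock_kernel m z z)) * (ennreal ((cmod (v z))\<^sup>2) * berezin m (\<lambda>w. (cmod (u w))\<^sup>2) z)"
proof -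
  have hu: "u holomorphic_on UNIV" using u by (simp add: fock_iff)
  have T: "toeplitz_prod m u v (\<lambda>w. fock_kernel m w z) = (\<lambda>w. cnj (v z) * (u w * fock_kernel m w z))"
    unfolding toeplitz_prod_eq[OF m u v kernel_in_kernel_span] toeplitz_conj_symbol(3)[OF m v kernel_in_kernel_span]
    by (simp add: mult_ac)
  have "fock_norm_sq m (\<lambda>w. cnj (v z) * (u w * fock_kernel m w z)) = ennreal ((cmod (cnj (v z)))\<^sup>2) * fock_norm_sq m (\<lambda>w. u w * fock_kernel m w z)"
    by (rule fock_norm_sq_cmult) (intro borel_measurable_holomorphic holomorphic_intros hu m)
  then show ?thesis unfolding T berezin_eq_fock_norm_sq[OF m hu, symmetric] by (simp add: mult_ac)
qed

lemma mixed_kernel_bound: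
  assumes m: "m \<ge> 1" and u: "u holomorphic_on UNIV" and B: "B \<ge> 0"
    and Q: "ennreal ((cmod (v a))\<^sup>2) * berezin m (\<lambda>w. (cmod (u w))\<^sup>2) a \<le> ennreal B"
  shows "(cmod (v a))\<^sup>2 * (cmod (u b))\<^sup>2 * (cmod (fock_kernel m b a))\<^sup>2 \<le> B * Re (fock_kernel m a a) * Re (fock_kernel m b b)"
proof -
  have pos: "Re (fock_kernel m a a) > 0" "Re (fock_kernel m b b) > 0" by (rule fock_kernel_diag(2)[OF m])+
  have "ennreal ((cmod (v a))\<^sup>2 * (cmod (u b))\<^sup>2 * (cmod (fock_kernel m b a))\<^sup>2) =
     ennreal ((cmod (v a))\<^sup>2) * ennreal ((cmod (u b * fock_kernel m b a))\<^sup>2)"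
    by (simp add: ennreal_mult[symmetric] norm_mult power_mult_distrib mult_ac)
  also have "\<dots> \<le> ennreal ((cmod (v a))\<^sup>2) * (ennreal (Re (fock_kernel m b b)) * fock_norm_sq m (\<lambda>w. u w * fock_kernel m w a))"
    by (intro mult_left_mono fock_pointwise_bound[OF m]) (auto intro!: holomorphic_intros u m)
  also have "\<dots> = ennreal (Re (fock_kernel m b b)) * ennreal (Re (fock_kernel m a a)) *
     (ennreal ((cmod (v a))\<^sup>2) * berezin m (\<lambda>w. (cmod (u w))\<^sup>2) a)"
    unfolding berezin_eq_fock_norm_sq[OF m u, symmetric] by (simp add: mult_ac)
  also have "\<dots> \<le> ennreal (Re (fock_kernel m b b)) * ennreal (Re (fock_kernel m a a)) * ennreal B"
    by (intro mult_left_mono Q) auto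
  also have "\<dots> = ennreal (B * Re (fock_kernel m a a) * Re (fock_kernel m b b))"
    using pos B by (simp add: ennreal_mult[symmetric] less_imp_le mult_ac)
  finally show ?thesis using pos B by (subst (asm) ennreal_le_iff) (auto intro!: mult_nonneg_nonneg less_imp_le)
qed

lemma berezin_ge:
  assumes m: "m \<ge> 1" and u: "u holomorphic_on UNIV"
  shows "ennreal ((cmod (u z))\<^sup>2) \<le> berezin m (\<lambda>w. (cmod (u w))\<^sup>2) z"
proof (cases "berezin m (\<lambda>w. (cmod (u w))\<^sup>2) z = \<infinity>")
  case False
  then obtain B where B: "B \<ge> 0" "berezin m (\<lambda>w. (cmod (u w))\<^sup>2) z = ennreal B"
    by (cases "berezin m (\<lambda>w. (cmod (u w))\<^sup>2) z") auto
  have pos: "Re (fock_kernel m z z) > 0" by (rule fock_kernel_diag(2)[OF m])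
  have n: "(cmod (fock_kernel m z z))\<^sup>2 = Re (fock_kernel m z z) * Re (fock_kernel m z z)"
    unfolding fock_kernel_diag(1)[OF m, of z] norm_of_real by (simp add: power2_eq_square)
  \<comment> \<open>The mixed bound on the diagonal a = b = z with the constant 1 in place of
    \<open>v\<close>.\<close>
  have "(cmod (u z))\<^sup>2 * (Re (fock_kernel m z z) * Re (fock_kernel m z z)) \<le> B * (Re (fock_kernel m z z) * Re (fock_kernel m z z))"
    using mixed_kernel_bound[OF m u B(1), of "\<lambda>_. 1" z z] B(2) n by (simp add: mult_ac)
  then have "(cmod (u z))\<^sup>2 \<le> B" using pos by (simp add: mult_le_cancel_right)
  then show ?thesis using B by (simp add: ennreal_leI)
qed simp

lemma symbols_of_mixed_berezin_bound:
  assumes m: "m \<ge> 1" and u: "u holomorphic_on UNIV" and v: "v holomorphic_on UNIV"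
    and u0: "u \<noteq> (\<lambda>_. 0)" and v0: "v \<noteq> (\<lambda>_. 0)"
    and Q: "\<And>z. ennreal ((cmod (v z))\<^sup>2) * berezin m (\<lambda>w. (cmod (u w))\<^sup>2) z \<le> ennreal B"
  obtains g :: "complex poly" and c where "real (degree g) \<le> m" "c \<noteq> 0" "\<And>z. u z = exp (poly g z)" "\<And>z. v z = c * exp (- poly g z)"
proof -
  \<comment> \<open>Positive, since its logarithm is taken below.\<close>
  define B' where "B' = max B 1"
  have B': "B' > 0" by (simp add: B'_def)
  have Q': "ennreal ((cmod (v z))\<^sup>2) * berezin m (\<lambda>w. (cmod (u w))\<^sup>2) z \<le> ennreal B'" for z
    using Q[of z] by (rule order_trans) (simp add: B'_def ennreal_leI)
  note MK = mixed_kernel_bound[OF m u less_imp_le[OF B'], of v, OF Q']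
  have "(cmod (u z * v z))\<^sup>2 \<le> B'" for z
  proof -
    have "ennreal ((cmod (u z * v z))\<^sup>2) = ennreal ((cmod (v z))\<^sup>2) * ennreal ((cmod (u z))\<^sup>2)"
      by (simp add: ennreal_mult[symmetric] norm_mult power_mult_distrib mult_ac)
    also have "\<dots> \<le> ennreal ((cmod (v z))\<^sup>2) * berezin m (\<lambda>w. (cmod (u w))\<^sup>2) z"
      by (intro mult_left_mono berezin_ge[OF m u]) auto
    also have "\<dots> \<le> ennreal B'" by (rule Q')
    finally show ?thesis using B' by (subst (asm) ennreal_le_iff) auto
  qed
  then have "cmod (u z * v z) \<le> sqrt B'" for z by (intro real_le_rsqrt)
  then have "bounded (range (\<lambda>z. u z * v z))" unfolding bounded_iff by blast
  moreover have "(\<lambda>z. u z * v z) holomorphic_on UNIV" by (intro holomorphic_intros u v)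
  ultimately have "(\<lambda>z. u z * v z) constant_on UNIV" by (intro Liouville_theorem)
  then obtain c where c: "\<And>z. u z * v z = c" by (auto simp: constant_on_def)
  have c0: "c \<noteq> 0"
  proof
    assume "c = 0"
    obtain z0 where z0: "u z0 \<noteq> 0" using u0 by auto
    \<comment> \<open>If c = 0, then v vanishes on the nonempty open set where u does not, hence
      everywhere by the identity theorem.\<close>
    have "open (u -` (- {0}))"
      using holomorphic_on_imp_continuous_on[OF u] by (intro open_vimage) (auto simp: open_Compl)
    then have "v z = 0" for z
    proof (rule analytic_continuation_open[where s' = UNIV and f = v and g = "\<lambda>_. 0"])
      show "v z = 0" if "z \<in> u -` (- {0})" for z using c[of z] that \<open>c = 0\<close> by simp
    qed (use z0 v in auto)
    then show False using v0 by auto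
  qed
  have unz: "u z \<noteq> 0" for z using c[of z] c0 by auto
  obtain h where h: "h holomorphic_on UNIV" "\<And>z. u z = exp (h z)"
    using simply_connected_eq_holomorphic_log[OF open_UNIV] u unz by (auto simp: convex_imp_simply_connected)
  have vh: "v z = c * exp (- h z)" for z
    using c[of z] unfolding h(2) by (simp add: exp_minus field_simps)
  define D where "D = ln (B' / (cmod c)\<^sup>2)"
  \<comment> \<open>The function 2 h appears because the estimate is for squared moduli; the
    polynomial found at the end is therefore halved.\<close>
  have osc: "Re (2 * h (of_real (exp y) * e)) - Re (2 * h (of_real (exp x) * e)) \<le>
        D + log_ml m (2 * x) + log_ml m (2 * y) - 2 * log_ml m (x + y)" if e: "cmod e = 1" for e x y
  proof -
    define a b where "a = of_real (exp x) * e" and "b = of_real (exp y) * e"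
    have pos: "ml_real m (exp t) > 0" for t by (rule ml_real_pos[OF m]) simp
    define \<Delta> where "\<Delta> = Re (2 * h b) - Re (2 * h a)"
    have uv: "(cmod (v a))\<^sup>2 * (cmod (u b))\<^sup>2 = (cmod c)\<^sup>2 * exp \<Delta>"
      unfolding vh h(2) norm_mult norm_exp_eq_Re \<Delta>_def power_mult_distrib
      by (simp add: exp_double[symmetric] exp_diff exp_minus field_simps)
    have K: "(cmod (fock_kernel m b a))\<^sup>2 = (m / pi)\<^sup>2 * (ml_real m (exp (x + y)))\<^sup>2"
      "Re (fock_kernel m a a) * Re (fock_kernel m b b) = (m / pi)\<^sup>2 * (ml_real m (exp (2 * x)) * ml_real m (exp (2 * y)))"
      unfolding a_def b_def fock_kernel_ray[OF m e] norm_of_real power2_abs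
      by (simp_all add: power_mult_distrib power2_eq_square add.commute)
    have "(m / pi)\<^sup>2 * ((cmod c)\<^sup>2 * exp \<Delta> * (ml_real m (exp (x + y)))\<^sup>2) \<le> (m / pi)\<^sup>2 * (B' * (ml_real m (exp (2 * x)) * ml_real m (exp (2 * y))))"
      using MK[of a b] unfolding uv mult.assoc[of B'] K by (simp add: mult_ac)
    then have "(cmod c)\<^sup>2 * exp \<Delta> * (ml_real m (exp (x + y)))\<^sup>2 \<le> B' * (ml_real m (exp (2 * x)) * ml_real m (exp (2 * y)))"
      using m by (subst (asm) mult_le_cancel_left_pos) auto
    then have "ln ((cmod c)\<^sup>2 * exp \<Delta> * (ml_real m (exp (x + y)))\<^sup>2) \<le> ln (B' * (ml_real m (exp (2 * x)) * ml_real m (exp (2 * y))))"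
      using c0 pos[of "x + y"] by (intro ln_mono) auto
    moreover have "ln ((cmod c)\<^sup>2 * exp \<Delta> * (ml_real m (exp (x + y)))\<^sup>2) = ln ((cmod c)\<^sup>2) + \<Delta> + 2 * log_ml m (x + y)"
      using c0 pos[of "x + y"] by (simp add: ln_mult_pos ln_realpow log_ml_def)
    moreover have "ln (B' * (ml_real m (exp (2 * x)) * ml_real m (exp (2 * y)))) = ln B' + (log_ml m (2 * x) + log_ml m (2 * y))"
      using B' pos[of "2 * x"] pos[of "2 * y"] by (simp add: ln_mult_pos log_ml_def)
    moreover have "D = ln B' - ln ((cmod c)\<^sup>2)" using B' c0 by (simp add: D_def ln_div)
    ultimately show ?thesis unfolding \<Delta>_def a_def b_def by linarith
  qed
  have h2: "(\<lambda>z. 2 * h z) holomorphic_on UNIV" by (intro holomorphic_intros h)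
  obtain C where C: "\<And>n z. cmod z = exp (real n / 2) \<Longrightarrow> Re (2 * h z) \<le> C * (real n + 1) * exp (m * real n / 2)"
    using Re_growth_of_log_ml_oscillation[OF m holomorphic_on_imp_continuous_on[OF h2] osc] by blast
  obtain p where p: "real (degree p) \<le> m" "\<And>z. 2 * h z = poly p z"
    using entire_eq_poly_of_Re_growth[OF h2 m C] by blast
  show ?thesis
  proof
    show "real (degree (smult (1 / 2) p)) \<le> m" using p(1) by simp
    have hp: "poly (smult (1 / 2) p) z = h z" for z using p(2)[of z] by (simp add: field_simps)
    show "c \<noteq> 0" by (rule c0)
    show "u z = exp (poly (smult (1 / 2) p) z)" "v z = c * exp (- poly (smult (1 / 2) p) z)" for z
      unfolding hp using h(2) vh by auto
  qed
qed

lemma mixed_berezin_bound_of_toeplitz_bounded: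
  assumes m: "m \<ge> 1" and u: "u \<in> fock m" and v: "v \<in> fock m" and T: "toeplitz_prod_bounded m u v"
  obtains B where "B \<ge> 0" "\<And>z. ennreal ((cmod (v z))\<^sup>2) * berezin m (\<lambda>w. (cmod (u w))\<^sup>2) z \<le> ennreal B"
proof -
  obtain C where C: "\<And>f. f \<in> kernel_span m \<Longrightarrow> toeplitz_prod m u v f \<in> fock m \<and> fock_norm m (toeplitz_prod m u v f) \<le> C * fock_norm m f"
    using T by (auto simp: toeplitz_prod_bounded_def)
  show ?thesis
  proof
    show "C\<^sup>2 \<ge> 0" by simp
    fix z
    let ?K = "\<lambda>w. fock_kernel m w z" and ?P = "ennreal ((cmod (v z))\<^sup>2) * berezin m (\<lambda>w. (cmod (u w))\<^sup>2) z"
    define d where "d = Re (fock_kernel m z z)"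
    have d: "d > 0" unfolding d_def by (rule fock_kernel_diag(2)[OF m])
    have Tf: "toeplitz_prod m u v ?K \<in> fock m" and le: "fock_norm m (toeplitz_prod m u v ?K) \<le> C * fock_norm m ?K"
      using C[OF kernel_in_kernel_span] by auto
    have nK: "(fock_norm m ?K)\<^sup>2 = d"
    proof -
      have "ennreal ((fock_norm m ?K)\<^sup>2) = ennreal d"
        using fock_norm_sq_eq[OF borel_measurable_fock_kernel(1)[OF m] fock_norm_sq_kernel_mult_finite(2)[OF m], of z]
        unfolding fock_norm_sq_kernel[OF m] d_def by simp
      then show ?thesis using d by (subst (asm) ennreal_inj) auto
    qed
    have "ennreal d * ?P = fock_norm_sq m (toeplitz_prod m u v ?K)"
      unfolding fock_norm_sq_toeplitz_prod_kernel[OF m u v] d_def ..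
    also have "\<dots> = ennreal ((fock_norm m (toeplitz_prod m u v ?K))\<^sup>2)"
      using Tf by (intro fock_norm_sq_eq) (auto simp: fock_iff intro: borel_measurable_holomorphic)
    also have "\<dots> \<le> ennreal ((C * fock_norm m ?K)\<^sup>2)"
      using le fock_norm_nonneg by (intro ennreal_leI power_mono)
    also have "\<dots> = ennreal (C\<^sup>2 * d)" by (simp add: power_mult_distrib nK)
    finally have "ennreal (1 / d) * (ennreal d * ?P) \<le> ennreal (1 / d) * ennreal (C\<^sup>2 * d)" by (rule mult_left_mono) simp
    moreover have "ennreal (1 / d) * (ennreal d * ?P) = ?P"
      using d by (simp add: mult.assoc[symmetric] ennreal_mult[symmetric])
    moreover have "ennreal (1 / d) * ennreal (C\<^sup>2 * d) = ennreal (C\<^sup>2)"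
      using d by (simp add: ennreal_mult[symmetric])
    ultimately show "?P \<le> ennreal (C\<^sup>2)" by simp
  qed
qed

section \<open>Equivalence of the three conditions\<close>

text \<open>Condition (2) as a predicate, so that its symmetry in u and v can be stated.\<close>

definition exp_poly_pair :: "real \<Rightarrow> (complex \<Rightarrow> complex) \<Rightarrow> (complex \<Rightarrow> complex) \<Rightarrow> bool" where
  "exp_poly_pair m u v \<longleftrightarrow> (\<exists>(g::complex poly) c. real (degree g) \<le> m \<and> c \<noteq> 0 \<and>
     (\<forall>z. u z = exp (poly g z)) \<and> (\<forall>z. v z = c * exp (- poly g z)))"

text \<open>The constant moves into the polynomial: v = exp(Ln c - g) and u = c exp(-(Ln c - g)),
  without raising the degree.\<close>

lemma exp_poly_pair_swap:
  assumes "exp_poly_pair m u v"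
  shows "exp_poly_pair m v u"
proof -
  obtain g c where g: "real (degree g) \<le> m" "c \<noteq> 0" "\<And>z. u z = exp (poly g z)" "\<And>z. v z = c * exp (- poly g z)"
    using assms by (auto simp: exp_poly_pair_def)
  have "degree ([:Ln c:] - g) \<le> degree g" by (intro degree_diff_le) auto
  then have "real (degree ([:Ln c:] - g)) \<le> m" using g(1) by linarith
  moreover have "v z = exp (poly ([:Ln c:] - g) z)" "u z = c * exp (- poly ([:Ln c:] - g) z)" for z
    using g(2) unfolding g(3,4) by (simp_all add: exp_diff exp_minus field_simps)
  ultimately show ?thesis using g(2) unfolding exp_poly_pair_def by blast
qed

lemma exp_poly_pair_imp_bounded:
  assumes m: "m \<ge> 1" and "exp_poly_pair m u v"
  shows "toeplitz_prod_bounded m u v"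
proof -
  obtain g c where g: "real (degree g) \<le> m" "\<And>z. u z = exp (poly g z)" "\<And>z. v z = c * exp (- poly g z)"
    using assms by (auto simp: exp_poly_pair_def)
  have uv: "u = (\<lambda>z. exp (poly g z))" "v = (\<lambda>z. c * exp (- poly g z))" using g by auto
  show ?thesis
    using toeplitz_prod_exp_bound[OF m] g(1) unfolding toeplitz_prod_bounded_def uv by metis
qed

text \<open>The product of the mixed bounds for (u, v) and (v, u) is the wanted product times
  \<open>|uv|^2\<close> = \<open>|c|^2\<close>, a nonzero constant that divides out.\<close>

lemma exp_poly_pair_imp_berezin_bounded:
  assumes m: "m \<ge> 1" and u: "u \<in> fock m" and v: "v \<in> fock m" and uv: "exp_poly_pair m u v"
  obtains B where "\<And>z. berezin m (\<lambda>w. (cmod (u w))\<^sup>2) z * berezin m (\<lambda>w. (cmod (v w))\<^sup>2) z \<le> ennreal B"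
proof -
  obtain g c where g: "c \<noteq> 0" "\<And>z. u z = exp (poly g z)" "\<And>z. v z = c * exp (- poly g z)"
    using uv by (auto simp: exp_poly_pair_def)
  obtain B1 where B1: "B1 \<ge> 0" "\<And>z. ennreal ((cmod (v z))\<^sup>2) * berezin m (\<lambda>w. (cmod (u w))\<^sup>2) z \<le> ennreal B1"
    using mixed_berezin_bound_of_toeplitz_bounded[OF m u v exp_poly_pair_imp_bounded[OF m uv]] by blast
  obtain B2 where B2: "B2 \<ge> 0" "\<And>z. ennreal ((cmod (u z))\<^sup>2) * berezin m (\<lambda>w. (cmod (v w))\<^sup>2) z \<le> ennreal B2"
    using mixed_berezin_bound_of_toeplitz_bounded[OF m v u exp_poly_pair_imp_bounded[OF m exp_poly_pair_swap[OF uv]]] by blast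
  define d where "d = (cmod c)\<^sup>2"
  have d: "d > 0" using g(1) by (simp add: d_def)
  show ?thesis
  proof
    fix z
    let ?P = "berezin m (\<lambda>w. (cmod (u w))\<^sup>2) z" and ?R = "berezin m (\<lambda>w. (cmod (v w))\<^sup>2) z"
    have "u z * v z = c" by (simp add: g exp_minus)
    then have "ennreal d = ennreal ((cmod (v z))\<^sup>2) * ennreal ((cmod (u z))\<^sup>2)"
      unfolding d_def by (auto simp: ennreal_mult[symmetric] norm_mult power_mult_distrib mult_ac)
    then have "ennreal d * (?P * ?R) = (ennreal ((cmod (v z))\<^sup>2) * ?P) * (ennreal ((cmod (u z))\<^sup>2) * ?R)"
      by (simp add: mult_ac)
    also have "\<dots> \<le> ennreal B1 * ennreal B2" by (intro mult_mono B1 B2) auto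
    finally have "ennreal (1 / d) * (ennreal d * (?P * ?R)) \<le> ennreal (1 / d) * (ennreal B1 * ennreal B2)"
      by (rule mult_left_mono) simp
    moreover have "ennreal (1 / d) * (ennreal d * (?P * ?R)) = ?P * ?R"
      using d by (simp add: mult.assoc[symmetric] ennreal_mult[symmetric])
    moreover have "ennreal (1 / d) * (ennreal B1 * ennreal B2) = ennreal (1 / d * (B1 * B2))"
      using B1(1) B2(1) d by (simp only: ennreal_mult[symmetric] mult_nonneg_nonneg less_imp_le zero_le_divide_1_iff)
    ultimately show "?P * ?R \<le> ennreal (1 / d * (B1 * B2))"
      by (simp only:)
  qed
qed

theorem mainTheorem1:
  fixes m :: real
  assumes "m \<ge> 1"
  shows "(\<forall>u v. u \<in> fock m \<and> v \<in> fock m \<and> u \<noteq> (\<lambda>_. 0) \<and> v \<noteq> (\<lambda>_. 0) \<longrightarrow>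
            (toeplitz_prod_bounded m u v \<longleftrightarrow>
               (\<exists>(g::complex poly) c. real (degree g) \<le> m \<and> c \<noteq> 0 \<and>
                  (\<forall>z. u z = exp (poly g z)) \<and> (\<forall>z. v z = c * exp (- poly g z))))
          \<and> (toeplitz_prod_bounded m u v \<longleftrightarrow>
               (\<exists>B::real. \<forall>z. berezin m (\<lambda>w. (cmod (u w))\<^sup>2) z * berezin m (\<lambda>w. (cmod (v w))\<^sup>2) z
                              \<le> ennreal B)))
       \<and> (\<forall>c::complex. c \<noteq> 0 \<longrightarrow> (\<exists>C1>0. \<exists>C2>0. \<forall>g::complex poly. real (degree g) \<le> m \<longrightarrow>
            (\<forall>f\<in>kernel_span m.
               fock_norm m (toeplitz_prod m (\<lambda>z. exp (poly g z)) (\<lambda>z. c * exp (- poly g z)) f)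
                 \<le> C1 * exp (C2 * H2_norm_sq g) * fock_norm m f)))"
proof (intro conjI allI impI)
  fix u v :: "complex \<Rightarrow> complex"
  assume uv: "u \<in> fock m \<and> v \<in> fock m \<and> u \<noteq> (\<lambda>_. 0) \<and> v \<noteq> (\<lambda>_. 0)"
  then have u: "u \<in> fock m" "u holomorphic_on UNIV" "u \<noteq> (\<lambda>_. 0)" and v: "v \<in> fock m" "v holomorphic_on UNIV" "v \<noteq> (\<lambda>_. 0)"
    by (auto simp: fock_iff)
  have mixed: "exp_poly_pair m u v" if "\<And>z. ennreal ((cmod (v z))\<^sup>2) * berezin m (\<lambda>w. (cmod (u w))\<^sup>2) z \<le> ennreal B" for B
    unfolding exp_poly_pair_def using symbols_of_mixed_berezin_bound[OF assms u(2) v(2) u(3) v(3) that] by metis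
  have 12: "exp_poly_pair m u v" if "toeplitz_prod_bounded m u v"
    using mixed_berezin_bound_of_toeplitz_bounded[OF assms u(1) v(1) that] mixed by blast
  have 21: "toeplitz_prod_bounded m u v" if "exp_poly_pair m u v"
    by (rule exp_poly_pair_imp_bounded[OF assms that])
  have 32: "exp_poly_pair m u v"
    if B: "\<And>z. berezin m (\<lambda>w. (cmod (u w))\<^sup>2) z * berezin m (\<lambda>w. (cmod (v w))\<^sup>2) z \<le> ennreal B" for B
  proof (rule mixed)
    fix z
    \<comment> \<open>Replacing \<open>|v|^2\<close> by its Berezin transform only increases the
      left side, so (3) is at least as strong as the mixed bound.\<close>
    have "ennreal ((cmod (v z))\<^sup>2) * berezin m (\<lambda>w. (cmod (u w))\<^sup>2) z \<le>
        berezin m (\<lambda>w. (cmod (v w))\<^sup>2) z * berezin m (\<lambda>w. (cmod (u w))\<^sup>2) z"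
      by (intro mult_right_mono berezin_ge[OF assms v(2)]) auto
    also have "\<dots> \<le> ennreal B" using B[of z] by (simp add: mult.commute)
    finally show "ennreal ((cmod (v z))\<^sup>2) * berezin m (\<lambda>w. (cmod (u w))\<^sup>2) z \<le> ennreal B" .
  qed
  show "toeplitz_prod_bounded m u v \<longleftrightarrow> (\<exists>(g::complex poly) c. real (degree g) \<le> m \<and> c \<noteq> 0 \<and>
                  (\<forall>z. u z = exp (poly g z)) \<and> (\<forall>z. v z = c * exp (- poly g z)))"
    unfolding exp_poly_pair_def[symmetric] using 12 21 by blast
  show "toeplitz_prod_bounded m u v \<longleftrightarrow> (\<exists>B::real. \<forall>z. berezin m (\<lambda>w. (cmod (u w))\<^sup>2) z * berezin m (\<lambda>w. (cmod (v w))\<^sup>2) z \<le> ennreal B)"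
    using 12 21 32 exp_poly_pair_imp_berezin_bounded[OF assms u(1) v(1)] by metis
next
  fix c :: complex assume c: "c \<noteq> 0"
  obtain C1 C2 where C: "C1 > 0" "C2 > 0"
    "\<And>g c f. real (degree g) \<le> m \<Longrightarrow> f \<in> kernel_span m \<Longrightarrow>
       toeplitz_prod m (\<lambda>z. exp (poly g z)) (\<lambda>z. c * exp (- poly g z)) f \<in> fock m \<and>
       fock_norm m (toeplitz_prod m (\<lambda>z. exp (poly g z)) (\<lambda>z. c * exp (- poly g z)) f) \<le>
         cmod c * (C1 * exp (C2 * H2_norm_sq g)) * fock_norm m f"
    using toeplitz_prod_exp_bound[OF assms] by blast
  show "\<exists>C1>0. \<exists>C2>0. \<forall>g::complex poly. real (degree g) \<le> m \<longrightarrow>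
            (\<forall>f\<in>kernel_span m.
               fock_norm m (toeplitz_prod m (\<lambda>z. exp (poly g z)) (\<lambda>z. c * exp (- poly g z)) f)
                 \<le> C1 * exp (C2 * H2_norm_sq g) * fock_norm m f)"
  \<comment> \<open>c is fixed before the constants in this clause, so |c| may enter
    \<open>C1\<close>, while g may not.\<close>
  proof (rule exI[of _ "cmod c * C1"], intro conjI exI[of _ C2] allI impI ballI)
    fix g :: "complex poly" and f assume "real (degree g) \<le> m" "f \<in> kernel_span m"
    from conjunct2[OF C(3)[OF this, of c]]
    show "fock_norm m (toeplitz_prod m (\<lambda>z. exp (poly g z)) (\<lambda>z. c * exp (- poly g z)) f)
                 \<le> cmod c * C1 * exp (C2 * H2_norm_sq g) * fock_norm m f" by (simp only: mult.assoc)
  qed (use c C in auto)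
qed

end
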